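(* Let $\widetilde{\mathbf W}=(\widetilde G,\widetilde m)$ be a $\Gamma$-periodic weighted graph with quotient $\mathbf W=(G,m)$, $G=\widetilde G/\Gamma$, and graph fundamental domain $D=(D^V,D^E)$. Let $E_0:=\{[e]: e\in B(D,\widetilde G)\}\subset E(G)$ be the image in the quotient of the connecting edges, let $V_0\subset V(G)$ be in the neighbourhood of $E_0$, and let $\mathbf W^-=(G-E_0,m^-)$ and $\mathbf W^+=(G-V_0,m^+)$ be the edge-virtualised and vertex-virtualised weighted graphs obtained from $\mathbf W$. Then \[ \sigma(\Delta^{\widetilde{\mathbf W}})\subset\bigcup_{k=1}^{|V(G)|}\bigl[\lambda_k(\Delta^{\mathbf W^-}),\lambda_k(\Delta^{\mathbf W^+})\bigr], \] where eigenvalues are in ascending order repeated with multiplicity and $\lambda_k(\Delta^{\mathbf W^+}):=2\rho_\infty$ for $k>|V(G)|-|V_0|$.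
   Context: Graphs $G=(V,E,\partial)$, $\partial e=(\partial_-e,\partial_+e)$, may have loops and multiple edges. A weight $m$: $m:V\to(0,\infty)$, $m:E\to(0,\infty)$; relative weight $\rho(v)=\sum_{e\in E_v}m_e/m(v)$ ($E_v$: edges at $v$, loops counted twice), $\rho_\infty=\sup_v\rho(v)$. $(d f)_e=f(\partial_+e)-f(\partial_-e)$ and the Laplacian is $\Delta^{\mathbf W}=d^*d$ w.r.t. inner products $\sum_v f\bar g\,m(v)$ and $\sum_e\eta\bar\zeta\,m_e$. Let $\Gamma$ be a finitely generated Abelian group. A connected graph $\widetilde G=(V,E,\partial)$ is $\Gamma$-periodic if $\Gamma$ acts freely on $V$ and $E$ with $\partial_\pm(\gamma e)=\gamma\partial_\pm e$ and finite quotient $G$ (vertices/edges are orbits $[v],[e]$, induced orientation); $\widetilde m$ is $\Gamma$-invariant and induces $m$ on $G$. A graph fundamental domain: $D^V\subset V$ with exactly one vertex from each orbit, $D^E\subset E$ with exactly one edge from each orbit, each edge of $D^E$ having an endpoint in $D^V$. Connecting edges: $B(D,\widetilde G)$ = edges with exactly one endpoint in $D^V$. $V_0$ is in the neighbourhood of $E_0$ if every $e\in E_0$ has $\partial_+e\in V_0$ or $\partial_-e\in V_0$. Edge virtualisation: $\mathbf W^-$ has vertex set $V(G)$ with weights $m(v)$, edge set $E(G)\setminus E_0$ with weights $m_e$; $\Delta^{\mathbf W^-}=d^*d$ on $\ell_2(V(G),m)$ with $d$ the derivative of this graph. Vertex virtualisation: $\mathbf W^+$ has vertex set $V(G)\setminus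 V_0$ with weights $m(v)$, edge set $E(G)\setminus E(V_0)$ ($E(V_0)$: edges with both endpoints in $V_0$) with weights $m_e$; $\Delta^{\mathbf W^+}=\iota^*\Delta^{\mathbf W}\iota$, with $\iota:\ell_2(V(G)\setminus V_0,m)\to\ell_2(V(G),m)$ the extension by zero. *)

theory Defs
  imports
    "HOL-Analysis.Infinite_Sum"
    "HOL-Library.Function_Algebras"
    "HOL-Algebra.Group_Action"
    "HOL-Algebra.Generated_Groups"
    "Graph_Theory.Digraph_Component"
begin

text \<open>
  Oriented multigraphs with loops are records of type \<open>('v, 'e) pre_digraph\<close> satisfying
  \<^locale>\<open>wf_digraph\<close>: the initial vertex \<open>\<partial>\<^sub>- e\<close> is \<open>tail G e\<close> and the terminal vertex
  \<open>\<partial>\<^sub>+ e\<close> is \<open>head G e\<close>.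
\<close>

record ('v, 'e) weight =
  vwt :: "'v \<Rightarrow> real"
  ewt :: "'e \<Rightarrow> real"

locale weighted_graph = wf_digraph G
  for G :: "('v, 'e) pre_digraph" and m :: "('v, 'e) weight" +
  assumes vwt_pos: "v \<in> verts G \<Longrightarrow> 0 < vwt m v"
    and ewt_pos: "e \<in> arcs G \<Longrightarrow> 0 < ewt m e"

text \<open>A loop at \<open>v\<close> occurs in both sums, hence counts twice.\<close>

definition rel_weight :: "('v, 'e) pre_digraph \<Rightarrow> ('v, 'e) weight \<Rightarrow> 'v \<Rightarrow> real" where
  "rel_weight G m v =
     ((\<Sum>\<^sub>\<infinity>e\<in>{e \<in> arcs G. tail G e = v}. ewt m e) +
      (\<Sum>\<^sub>\<infinity>e\<in>{e \<in> arcs G. head G e = v}. ewt m e)) / vwt m v"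

definition rel_weight_sup :: "('v, 'e) pre_digraph \<Rightarrow> ('v, 'e) weight \<Rightarrow> real" where
  "rel_weight_sup G m = (SUP v\<in>verts G. rel_weight G m v)"


section \<open>Weighted square-summable functions\<close>

text \<open>
  The Hilbert space \<open>\<ell>\<^sub>2(A, w)\<close> is modelled by total functions that vanish outside \<open>A\<close>, so that
  equality in \<open>\<ell>\<^sub>2(A, w)\<close> is equality of functions.  Operators are total functions on functions;
  only their values on the respective space are ever relevant.
\<close>

definition l2 :: "'a set \<Rightarrow> ('a \<Rightarrow> real) \<Rightarrow> ('a \<Rightarrow> complex) set" where
  "l2 A w = {f. (\<forall>x. x \<notin> A \<longrightarrow> f x = 0) \<and> (\<lambda>x. (cmod (f x))\<^sup>2 * w x) summable_on A}"

definition l2_inner ::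
    "'a set \<Rightarrow> ('a \<Rightarrow> real) \<Rightarrow> ('a \<Rightarrow> complex) \<Rightarrow> ('a \<Rightarrow> complex) \<Rightarrow> complex" where
  "l2_inner A w f g = (\<Sum>\<^sub>\<infinity>x\<in>A. f x * cnj (g x) * complex_of_real (w x))"

definition l2_norm :: "'a set \<Rightarrow> ('a \<Rightarrow> real) \<Rightarrow> ('a \<Rightarrow> complex) \<Rightarrow> real" where
  "l2_norm A w f = sqrt (\<Sum>\<^sub>\<infinity>x\<in>A. (cmod (f x))\<^sup>2 * w x)"

text \<open>\<open>l2_adjoint A w B u T\<close> is the adjoint of \<open>T : \<ell>\<^sub>2(A, w) \<rightarrow> \<ell>\<^sub>2(B, u)\<close>.\<close>

definition l2_adjoint ::
    "'a set \<Rightarrow> ('a \<Rightarrow> real) \<Rightarrow> 'b set \<Rightarrow> ('b \<Rightarrow> real) \<Rightarrow>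
     (('a \<Rightarrow> complex) \<Rightarrow> ('b \<Rightarrow> complex)) \<Rightarrow> ('b \<Rightarrow> complex) \<Rightarrow> ('a \<Rightarrow> complex)" where
  "l2_adjoint A w B u T h =
     (THE f. f \<in> l2 A w \<and> (\<forall>g\<in>l2 A w. l2_inner B u (T g) h = l2_inner A w g f))"

definition l2_resolvent_set ::
    "'a set \<Rightarrow> ('a \<Rightarrow> real) \<Rightarrow> (('a \<Rightarrow> complex) \<Rightarrow> ('a \<Rightarrow> complex)) \<Rightarrow> complex set" where
  "l2_resolvent_set A w T =
     {z. bij_betw (\<lambda>f x. T f x - z * f x) (l2 A w) (l2 A w) \<and>
         (\<exists>C. \<forall>f\<in>l2 A w. l2_norm A w f \<le> C * l2_norm A w (\<lambda>x. T f x - z * f x))}"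

definition l2_spectrum ::
    "'a set \<Rightarrow> ('a \<Rightarrow> real) \<Rightarrow> (('a \<Rightarrow> complex) \<Rightarrow> ('a \<Rightarrow> complex)) \<Rightarrow> complex set" where
  "l2_spectrum A w T = - l2_resolvent_set A w T"

definition eigenspace ::
    "'a set \<Rightarrow> ('a \<Rightarrow> real) \<Rightarrow> (('a \<Rightarrow> complex) \<Rightarrow> ('a \<Rightarrow> complex)) \<Rightarrow> real \<Rightarrow>
     ('a \<Rightarrow> complex) set" where
  "eigenspace A w T r = {f \<in> l2 A w. T f = (\<lambda>x. complex_of_real r * f x)}"

definition multiplicity_eigenvalue ::
    "'a set \<Rightarrow> ('a \<Rightarrow> real) \<Rightarrow> (('a \<Rightarrow> complex) \<Rightarrow> ('a \<Rightarrow> complex)) \<Rightarrow> real \<Rightarrow> nat" where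
  "multiplicity_eigenvalue A w T r =
     vector_space.dim (\<lambda>(c::complex) f x. c * f x) (eigenspace A w T r)"

text \<open>
  The eigenvalues of an operator on the finite-dimensional space \<open>\<ell>\<^sub>2(A, w)\<close> in ascending order,
  repeated with multiplicity.  This is meant for self-adjoint operators: only real eigenvalues
  are listed, and geometric multiplicities are used.
\<close>

definition eigenvalue_list ::
    "'a set \<Rightarrow> ('a \<Rightarrow> real) \<Rightarrow> (('a \<Rightarrow> complex) \<Rightarrow> ('a \<Rightarrow> complex)) \<Rightarrow> real list" where
  "eigenvalue_list A w T =
     concat (map (\<lambda>r. replicate (multiplicity_eigenvalue A w T r) r)
       (sorted_list_of_set {r. \<exists>f\<in>eigenspace A w T r. f \<noteq> (\<lambda>x. 0)}))"

text \<open>Eigenvalues are numbered from 1.\<close>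

definition nth_eigenvalue ::
    "'a set \<Rightarrow> ('a \<Rightarrow> real) \<Rightarrow> (('a \<Rightarrow> complex) \<Rightarrow> ('a \<Rightarrow> complex)) \<Rightarrow> nat \<Rightarrow> real" where
  "nth_eigenvalue A w T k = eigenvalue_list A w T ! (k - 1)"


section \<open>Laplacians\<close>

definition graph_deriv ::
    "('v, 'e) pre_digraph \<Rightarrow> ('v \<Rightarrow> complex) \<Rightarrow> ('e \<Rightarrow> complex)" where
  "graph_deriv G f = (\<lambda>e. if e \<in> arcs G then f (head G e) - f (tail G e) else 0)"

definition laplacian ::
    "('v, 'e) pre_digraph \<Rightarrow> ('v, 'e) weight \<Rightarrow> ('v \<Rightarrow> complex) \<Rightarrow> ('v \<Rightarrow> complex)" where
  "laplacian G m f =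
     l2_adjoint (verts G) (vwt m) (arcs G) (ewt m) (graph_deriv G) (graph_deriv G f)"

definition edge_virtualised ::
    "('v, 'e) pre_digraph \<Rightarrow> 'e set \<Rightarrow> ('v, 'e) pre_digraph" where
  "edge_virtualised G E0 = G\<lparr>arcs := arcs G - E0\<rparr>"

definition edges_within :: "('v, 'e) pre_digraph \<Rightarrow> 'v set \<Rightarrow> 'e set" where
  "edges_within G V0 = {e \<in> arcs G. tail G e \<in> V0 \<and> head G e \<in> V0}"

text \<open>
  In general this is only a partial graph (not a \<^locale>\<open>wf_digraph\<close>): edges with exactly one
  endpoint in \<open>V0\<close> are kept.
\<close>

definition vertex_virtualised ::
    "('v, 'e) pre_digraph \<Rightarrow> 'v set \<Rightarrow> ('v, 'e) pre_digraph" where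
  "vertex_virtualised G V0 =
     G\<lparr>verts := verts G - V0, arcs := arcs G - edges_within G V0\<rparr>"

definition extend_by_zero :: "'v set \<Rightarrow> ('v \<Rightarrow> complex) \<Rightarrow> ('v \<Rightarrow> complex)" where
  "extend_by_zero A f = (\<lambda>v. if v \<in> A then f v else 0)"

text \<open>\<open>\<iota>\<^sup>* \<Delta> \<iota>\<close>, where \<open>\<iota> : \<ell>\<^sub>2(verts H, m) \<rightarrow> \<ell>\<^sub>2(verts G, m)\<close> is the extension by zero.\<close>

definition compressed_laplacian ::
    "('v, 'e) pre_digraph \<Rightarrow> ('v, 'e) pre_digraph \<Rightarrow> ('v, 'e) weight \<Rightarrow>
     ('v \<Rightarrow> complex) \<Rightarrow> ('v \<Rightarrow> complex)" where
  "compressed_laplacian H G m f =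
     l2_adjoint (verts H) (vwt m) (verts G) (vwt m) (extend_by_zero (verts H))
       (laplacian G m (extend_by_zero (verts H) f))"


section \<open>Periodic graphs and their quotients\<close>

text \<open>
  Vertices and edges of the quotient are orbits.  Since the boundary maps are equivariant and the
  weight is invariant, the image of the orbit of \<open>e\<close> under \<open>tail G\<close> is the orbit of \<open>tail G e\<close>
  (similarly for \<open>head G\<close>), and the image of an orbit under the weight is a singleton.
\<close>

definition quotient_graph ::
    "('g, 'x) monoid_scheme \<Rightarrow> ('g \<Rightarrow> 'v \<Rightarrow> 'v) \<Rightarrow> ('g \<Rightarrow> 'e \<Rightarrow> 'e) \<Rightarrow>
     ('v, 'e) pre_digraph \<Rightarrow> ('v set, 'e set) pre_digraph" where
  "quotient_graph \<Gamma> \<phi> \<psi> G =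
     \<lparr>verts = orbits \<Gamma> (verts G) \<phi>, arcs = orbits \<Gamma> (arcs G) \<psi>,
      tail = (\<lambda>c. tail G ` c), head = (\<lambda>c. head G ` c)\<rparr>"

definition quotient_weight :: "('v, 'e) weight \<Rightarrow> ('v set, 'e set) weight" where
  "quotient_weight m =
     \<lparr>vwt = (\<lambda>c. the_elem (vwt m ` c)), ewt = (\<lambda>c. the_elem (ewt m ` c))\<rparr>"

locale periodic_weighted_graph =
  comm_group \<Gamma> + weighted_graph G m +
  vact: group_action \<Gamma> "verts G" \<phi> + eact: group_action \<Gamma> "arcs G" \<psi>
  for \<Gamma> :: "('g, 'x) monoid_scheme"
    and \<phi> :: "'g \<Rightarrow> 'v \<Rightarrow> 'v" and \<psi> :: "'g \<Rightarrow> 'e \<Rightarrow> 'e"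
    and G :: "('v, 'e) pre_digraph" and m :: "('v, 'e) weight" +
  assumes finitely_generated: "\<exists>S. finite S \<and> S \<subseteq> carrier \<Gamma> \<and> generate \<Gamma> S = carrier \<Gamma>"
    and connected_graph: "Digraph_Component.connected G"
    and free_verts: "\<lbrakk>g \<in> carrier \<Gamma>; v \<in> verts G; \<phi> g v = v\<rbrakk> \<Longrightarrow> g = \<one>\<^bsub>\<Gamma>\<^esub>"
    and free_arcs: "\<lbrakk>g \<in> carrier \<Gamma>; e \<in> arcs G; \<psi> g e = e\<rbrakk> \<Longrightarrow> g = \<one>\<^bsub>\<Gamma>\<^esub>"
    and tail_equivariant:
      "\<lbrakk>g \<in> carrier \<Gamma>; e \<in> arcs G\<rbrakk> \<Longrightarrow> tail G (\<psi> g e) = \<phi> g (tail G e)"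
    and head_equivariant:
      "\<lbrakk>g \<in> carrier \<Gamma>; e \<in> arcs G\<rbrakk> \<Longrightarrow> head G (\<psi> g e) = \<phi> g (head G e)"
    and finite_vert_orbits: "finite (orbits \<Gamma> (verts G) \<phi>)"
    and finite_arc_orbits: "finite (orbits \<Gamma> (arcs G) \<psi>)"
    and vwt_invariant: "\<lbrakk>g \<in> carrier \<Gamma>; v \<in> verts G\<rbrakk> \<Longrightarrow> vwt m (\<phi> g v) = vwt m v"
    and ewt_invariant: "\<lbrakk>g \<in> carrier \<Gamma>; e \<in> arcs G\<rbrakk> \<Longrightarrow> ewt m (\<psi> g e) = ewt m e"

definition fundamental_domain ::
    "('g, 'x) monoid_scheme \<Rightarrow> ('g \<Rightarrow> 'v \<Rightarrow> 'v) \<Rightarrow> ('g \<Rightarrow> 'e \<Rightarrow> 'e) \<Rightarrow>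
     ('v, 'e) pre_digraph \<Rightarrow> 'v set \<Rightarrow> 'e set \<Rightarrow> bool" where
  "fundamental_domain \<Gamma> \<phi> \<psi> G DV DE \<longleftrightarrow>
     DV \<subseteq> verts G \<and> (\<forall>c\<in>orbits \<Gamma> (verts G) \<phi>. \<exists>!v. v \<in> c \<inter> DV) \<and>
     DE \<subseteq> arcs G \<and> (\<forall>c\<in>orbits \<Gamma> (arcs G) \<psi>. \<exists>!e. e \<in> c \<inter> DE) \<and>
     (\<forall>e\<in>DE. tail G e \<in> DV \<or> head G e \<in> DV)"

definition connecting_edges :: "('v, 'e) pre_digraph \<Rightarrow> 'v set \<Rightarrow> 'e set" where
  "connecting_edges G DV = {e \<in> arcs G. (tail G e \<in> DV) \<noteq> (head G e \<in> DV)}"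

definition in_neighbourhood :: "('v, 'e) pre_digraph \<Rightarrow> 'v set \<Rightarrow> 'e set \<Rightarrow> bool" where
  "in_neighbourhood G V0 E0 \<longleftrightarrow> (\<forall>e\<in>E0. head G e \<in> V0 \<or> tail G e \<in> V0)"


section \<open>Well-definedness\<close>

text \<open>The adjoint is uniquely determined by its defining property.\<close>

lemma l2_adjoint_eqI:
  assumes w: "\<And>x. x \<in> A \<Longrightarrow> 0 < w x"
    and f: "f \<in> l2 A w" "\<And>g. g \<in> l2 A w \<Longrightarrow> l2_inner B u (T g) h = l2_inner A w g f"
  shows "l2_adjoint A w B u T h = f"
  unfolding l2_adjoint_def
proof (rule the_equality)
  show "f \<in> l2 A w \<and> (\<forall>g\<in>l2 A w. l2_inner B u (T g) h = l2_inner A w g f)"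
    using f by blast
  fix f' assume f': "f' \<in> l2 A w \<and> (\<forall>g\<in>l2 A w. l2_inner B u (T g) h = l2_inner A w g f')"
  have "f' y = f y" for y
  proof (cases "y \<in> A")
    case False
    then show ?thesis using f' f(1) by (simp add: l2_def)
  next
    case True
    define \<delta> where "\<delta> = (\<lambda>x. if x = y then 1 else 0 :: complex)"
    have "(\<lambda>x. (cmod (\<delta> x))\<^sup>2 * w x) summable_on {y}" by simp
    also have "?this \<longleftrightarrow> (\<lambda>x. (cmod (\<delta> x))\<^sup>2 * w x) summable_on A"
      by (rule summable_on_cong_neutral) (use True in \<open>auto simp: \<delta>_def\<close>)
    finally have "(\<lambda>x. (cmod (\<delta> x))\<^sup>2 * w x) summable_on A" .
    then have \<delta>: "\<delta> \<in> l2 A w" using True by (auto simp: l2_def \<delta>_def)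
    have inner: "l2_inner A w \<delta> k = cnj (k y) * w y" for k
    proof -
      have "l2_inner A w \<delta> k = (\<Sum>\<^sub>\<infinity>x\<in>{y}. \<delta> x * cnj (k x) * complex_of_real (w x))"
        unfolding l2_inner_def
        by (rule infsum_cong_neutral) (use True in \<open>auto simp: \<delta>_def\<close>)
      then show ?thesis by (simp add: \<delta>_def)
    qed
    have "l2_inner A w \<delta> f' = l2_inner A w \<delta> f" using f f' \<delta> by metis
    then show ?thesis using w[OF True] by (simp add: inner)
  qed
  then show "f' = f" by blast
qed

context periodic_weighted_graph
begin

lemma tail_orbit: "e \<in> arcs G \<Longrightarrow> tail G ` Group_Action.orbit \<Gamma> \<psi> e = Group_Action.orbit \<Gamma> \<phi> (tail G e)"
  by (force simp: Group_Action.orbit_def tail_equivariant)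

lemma head_orbit: "e \<in> arcs G \<Longrightarrow> head G ` Group_Action.orbit \<Gamma> \<psi> e = Group_Action.orbit \<Gamma> \<phi> (head G e)"
  by (force simp: Group_Action.orbit_def head_equivariant)

lemma vwt_quotient:
  assumes "v \<in> verts G"
  shows "vwt (quotient_weight m) (Group_Action.orbit \<Gamma> \<phi> v) = vwt m v"
proof -
  have "vwt m y = vwt m v" if "y \<in> Group_Action.orbit \<Gamma> \<phi> v" for y
    using that assms by (auto simp: Group_Action.orbit_def vwt_invariant)
  moreover have "\<phi> \<one>\<^bsub>\<Gamma>\<^esub> v \<in> Group_Action.orbit \<Gamma> \<phi> v"
    unfolding Group_Action.orbit_def by blast
  ultimately have "vwt m ` Group_Action.orbit \<Gamma> \<phi> v = {vwt m v}"
    by (metis (no_types, lifting) empty_iff image_cong image_constant_conv)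
  then show ?thesis by (simp add: quotient_weight_def)
qed

lemma ewt_quotient:
  assumes "e \<in> arcs G"
  shows "ewt (quotient_weight m) (Group_Action.orbit \<Gamma> \<psi> e) = ewt m e"
proof -
  have "ewt m y = ewt m e" if "y \<in> Group_Action.orbit \<Gamma> \<psi> e" for y
    using that assms by (auto simp: Group_Action.orbit_def ewt_invariant)
  moreover have "\<psi> \<one>\<^bsub>\<Gamma>\<^esub> e \<in> Group_Action.orbit \<Gamma> \<psi> e"
    unfolding Group_Action.orbit_def by blast
  ultimately have "ewt m ` Group_Action.orbit \<Gamma> \<psi> e = {ewt m e}"
    by (metis (no_types, lifting) empty_iff image_cong image_constant_conv)
  then show ?thesis by (simp add: quotient_weight_def)
qed

lemma weighted_graph_quotient: "weighted_graph (quotient_graph \<Gamma> \<phi> \<psi> G) (quotient_weight m)"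
proof
  fix c assume "c \<in> arcs (quotient_graph \<Gamma> \<phi> \<psi> G)"
  then obtain e where e: "e \<in> arcs G" "c = Group_Action.orbit \<Gamma> \<psi> e"
    by (auto simp: quotient_graph_def orbits_def)
  show "tail (quotient_graph \<Gamma> \<phi> \<psi> G) c \<in> verts (quotient_graph \<Gamma> \<phi> \<psi> G)"
    "head (quotient_graph \<Gamma> \<phi> \<psi> G) c \<in> verts (quotient_graph \<Gamma> \<phi> \<psi> G)"
    using e tail_orbit head_orbit by (auto simp: quotient_graph_def orbits_def)
  show "0 < ewt (quotient_weight m) c"
    using e ewt_pos ewt_quotient by simp
next
  fix c assume "c \<in> verts (quotient_graph \<Gamma> \<phi> \<psi> G)"
  then show "0 < vwt (quotient_weight m) c"
    using vwt_pos vwt_quotient by (auto simp: quotient_graph_def orbits_def)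
qed

end

end

theory Submission
  imports Defs "HOL-Computational_Algebra.Fundamental_Theorem_Algebra"
begin

text \<open>
  No Floquet decomposition is needed. Write \<open>\<Delta> = d\<^sup>*d\<close> and let \<open>\<mu>\<close> be real, outside all the
  intervals. Then, for some \<open>n\<close>, at most \<open>n\<close> eigenvalues of the edge-virtualised Laplacian are
  \<open>\<le> \<mu>\<close> and at least \<open>n\<close> eigenvalues of the vertex-virtualised one are \<open>< \<mu>\<close> (or \<open>\<mu> > 2\<rho>\<^sub>\<infinity>\<close>, where
  \<open>\<parallel>d F\<parallel>\<^sup>2 \<le> 2\<rho>\<^sub>\<infinity> \<parallel>F\<parallel>\<^sup>2\<close> suffices). The spectral subspaces \<open>P\<close> (above \<open>\<mu>\<close>) and \<open>N\<close> (below \<open>\<mu>\<close>)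
  intersect trivially, because the two quadratic forms are ordered, so by dimension they span
  all functions on the quotient. Functions on the covering are families, indexed by the group, of
  functions on the quotient (their restrictions to the translates of the fundamental domain). Dropping
  the connecting edges only decreases the energy \<open>\<parallel>d F\<parallel>\<^sup>2\<close>, and on functions vanishing over \<open>V\<^sub>0\<close>
  the connecting edges do not couple different translates; so fibrewise membership in \<open>P\<close> or \<open>N\<close>
  gives \<open>\<parallel>d F\<parallel>\<^sup>2 \<ge> (\<mu> + c) \<parallel>F\<parallel>\<^sup>2\<close> or \<open>\<parallel>d F\<parallel>\<^sup>2 \<le> (\<mu> - c) \<parallel>F\<parallel>\<^sup>2\<close>. Such a splitting of the whole space
  makes the self-adjoint operator \<open>\<Delta> - \<mu>\<close> bounded below, hence invertible.
\<close>

section \<open>Weighted \<open>\<ell>\<^sub>2\<close> spaces\<close>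

text \<open>Two facts make the fibrewise argument quantitative. Only finitely many eigenvalues
  occur, so one distance \<open>c\<close> from \<mu> serves all translates and the fibrewise
  inequalities can be summed over the group. The splitting of a fibre into parts in \<open>P\<close>
  and \<open>N\<close> is linear in the fibre, with coefficients independent of the translate, so
  both glued functions are again square summable. An eigenvalue equal to \<mu> belongs to neither
  \<open>P\<close> nor \<open>N\<close>; the dimension count survives because the excluded intervals
  are closed. The Laplacian is a definite description of an adjoint and says nothing until an
  adjoint is known to exist. Bounds for the derivative supply this, on the quotient and on the
  covering; beyond that, the comparison of graphs is a comparison of energies.\<close>

lemma norm_diff_sq_le: "(cmod (x - y))\<^sup>2 \<le> 2 * (cmod x)\<^sup>2 + 2 * (cmod y)\<^sup>2"
proof -
  have "(cmod (x - y))\<^sup>2 \<le> (cmod x + cmod y)\<^sup>2"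
    by (simp add: norm_triangle_ineq4 power_mono)
  also have "\<dots> \<le> 2 * (cmod x)\<^sup>2 + 2 * (cmod y)\<^sup>2"
    using sum_squares_bound[of "cmod x" "cmod y"] by (simp add: power2_sum)
  finally show ?thesis .
qed

text \<open>Holds for every \<open>f\<close>: real parts carry summability back, and where it fails
  both infinite sums take the default value 0.\<close>

lemma infsum_of_real:
  "(\<Sum>\<^sub>\<infinity>x\<in>A. complex_of_real (f x)) = complex_of_real (\<Sum>\<^sub>\<infinity>x\<in>A. f x)"
proof (cases "f summable_on A")
  case True
  then show ?thesis by (intro infsumI has_sum_of_real has_sum_infsum)
next
  case False
  then have "\<not> (\<lambda>x. complex_of_real (f x)) summable_on A"
    using summable_on_Re by fastforce
  then show ?thesis using False by (simp add: infsum_not_exists)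
qed

locale l2_space =
  fixes A :: "'a set" and w :: "'a \<Rightarrow> real"
  assumes weight_pos: "x \<in> A \<Longrightarrow> 0 < w x"
begin

abbreviation "H \<equiv> l2 A w"
abbreviation "nrm \<equiv> l2_norm A w"
abbreviation "inn \<equiv> l2_inner A w"

lemma l2_outside: "f \<in> H \<Longrightarrow> x \<notin> A \<Longrightarrow> f x = 0"
  by (simp add: l2_def)

lemma l2_summable: "f \<in> H \<Longrightarrow> (\<lambda>x. (cmod (f x))\<^sup>2 * w x) summable_on A"
  by (simp add: l2_def)

lemma l2_zero [simp]: "(\<lambda>x. 0) \<in> H"
  by (simp add: l2_def)

lemma l2_scale [intro]:
  assumes "f \<in> H"
  shows "(\<lambda>x. a * f x) \<in> H"
proof -
  have "(\<lambda>x. (cmod a)\<^sup>2 * ((cmod (f x))\<^sup>2 * w x)) summable_on A"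
    by (intro summable_on_cmult_right l2_summable assms)
  then show ?thesis
    using assms by (simp add: l2_def norm_mult power_mult_distrib mult.assoc)
qed

lemma l2_add [intro]:
  assumes "f \<in> H" "g \<in> H"
  shows "(\<lambda>x. f x + g x) \<in> H"
proof -
  have "(\<lambda>x. 2 * ((cmod (f x))\<^sup>2 * w x) + 2 * ((cmod (g x))\<^sup>2 * w x)) summable_on A"
    by (intro summable_on_add summable_on_cmult_right l2_summable assms)
  then have "(\<lambda>x. (cmod (f x + g x))\<^sup>2 * w x) summable_on A"
  proof (rule summable_on_comparison_test)
    fix x assume x: "x \<in> A"
    have "(cmod (f x + g x))\<^sup>2 \<le> 2 * (cmod (f x))\<^sup>2 + 2 * (cmod (g x))\<^sup>2"
      using norm_diff_sq_le[of "f x" "- g x"] by simp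
    then show "(cmod (f x + g x))\<^sup>2 * w x
        \<le> 2 * ((cmod (f x))\<^sup>2 * w x) + 2 * ((cmod (g x))\<^sup>2 * w x)"
      using weight_pos[OF x] mult_right_mono by (fastforce simp: algebra_simps)
    show "0 \<le> (cmod (f x + g x))\<^sup>2 * w x"
      using weight_pos[OF x] by simp
  qed
  then show ?thesis using assms by (simp add: l2_def)
qed

lemma l2_uminus [intro]: "f \<in> H \<Longrightarrow> (\<lambda>x. - f x) \<in> H"
  by (simp add: l2_def)

lemma l2_diff [intro]: "f \<in> H \<Longrightarrow> g \<in> H \<Longrightarrow> (\<lambda>x. f x - g x) \<in> H"
  using l2_add[of f "\<lambda>x. - g x"] l2_uminus[of g] by simp

lemma l2_sum: "(\<And>i. i \<in> I \<Longrightarrow> f i \<in> H) \<Longrightarrow> (\<lambda>x. \<Sum>i\<in>I. f i x) \<in> H"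
  by (induction I rule: infinite_finite_induct) auto

lemma l2_finite: "finite A \<Longrightarrow> f \<in> H \<longleftrightarrow> (\<forall>x. x \<notin> A \<longrightarrow> f x = 0)"
  by (simp add: l2_def)

lemma norm_sq: "(nrm f)\<^sup>2 = (\<Sum>\<^sub>\<infinity>x\<in>A. (cmod (f x))\<^sup>2 * w x)"
proof -
  have "0 \<le> (\<Sum>\<^sub>\<infinity>x\<in>A. (cmod (f x))\<^sup>2 * w x)"
    by (intro infsum_nonneg) (simp add: weight_pos less_imp_le)
  then show ?thesis by (simp add: l2_norm_def)
qed

lemma norm_nonneg [simp]: "0 \<le> nrm f"
  unfolding l2_norm_def
  by (intro real_sqrt_ge_zero infsum_nonneg) (simp add: weight_pos less_imp_le)

lemma inner_summable:
  assumes "f \<in> H" "g \<in> H"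
  shows "(\<lambda>x. f x * cnj (g x) * complex_of_real (w x)) summable_on A"
proof (rule abs_summable_summable, rule abs_summable_on_comparison_test')
  show "(\<lambda>x. (cmod (f x))\<^sup>2 * w x + (cmod (g x))\<^sup>2 * w x) summable_on A"
    by (intro summable_on_add l2_summable assms)
  fix x assume x: "x \<in> A"
  have "cmod (f x) * cmod (g x) \<le> (cmod (f x))\<^sup>2 + (cmod (g x))\<^sup>2"
    using sum_squares_bound[of "cmod (f x)" "cmod (g x)"]
      mult_nonneg_nonneg[OF norm_ge_zero[of "f x"] norm_ge_zero[of "g x"]] by linarith
  then show "norm (f x * cnj (g x) * complex_of_real (w x))
      \<le> (cmod (f x))\<^sup>2 * w x + (cmod (g x))\<^sup>2 * w x"
    using weight_pos[OF x] mult_right_mono[of _ _ "w x"]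
    by (fastforce simp: norm_mult algebra_simps)
qed

lemma inner_self: "inn f f = complex_of_real ((nrm f)\<^sup>2)"
proof -
  have "inn f f = (\<Sum>\<^sub>\<infinity>x\<in>A. complex_of_real ((cmod (f x))\<^sup>2 * w x))"
    unfolding l2_inner_def by (intro infsum_cong) (simp add: complex_norm_square[symmetric])
  also have "\<dots> = complex_of_real (\<Sum>\<^sub>\<infinity>x\<in>A. (cmod (f x))\<^sup>2 * w x)"
    by (rule infsum_of_real)
  finally show ?thesis by (simp add: norm_sq)
qed

lemma inner_commute: "inn g f = cnj (inn f g)"
  unfolding l2_inner_def infsum_cnj[symmetric] by (intro infsum_cong) simp

lemma inner_add_left:
  "f \<in> H \<Longrightarrow> g \<in> H \<Longrightarrow> h \<in> H \<Longrightarrow> inn (\<lambda>x. f x + g x) h = inn f h + inn g h"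
  unfolding l2_inner_def
  by (subst infsum_add[symmetric]) (auto simp: distrib_right intro: inner_summable)

lemma inner_scale_left: "inn (\<lambda>x. a * f x) h = a * inn f h"
  unfolding l2_inner_def by (subst infsum_cmult_right'[symmetric]) (simp add: mult.assoc)

lemma inner_uminus_left: "inn (\<lambda>x. - f x) h = - inn f h"
  using inner_scale_left[of "-1" f h] by simp

lemma inner_diff_left:
  "f \<in> H \<Longrightarrow> g \<in> H \<Longrightarrow> h \<in> H \<Longrightarrow> inn (\<lambda>x. f x - g x) h = inn f h - inn g h"
  using inner_add_left[of f "\<lambda>x. - g x" h] by (simp add: inner_uminus_left l2_uminus)

lemma inner_add_right:
  "f \<in> H \<Longrightarrow> g \<in> H \<Longrightarrow> h \<in> H \<Longrightarrow> inn h (\<lambda>x. f x + g x) = inn h f + inn h g"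
  using arg_cong[OF inner_add_left[of f g h], of cnj] by (simp add: inner_commute[symmetric])

lemma inner_scale_right: "inn h (\<lambda>x. a * f x) = cnj a * inn h f"
  using arg_cong[OF inner_scale_left[of a f h], of cnj] by (simp add: inner_commute[symmetric])

lemma inner_diff_right:
  "f \<in> H \<Longrightarrow> g \<in> H \<Longrightarrow> h \<in> H \<Longrightarrow> inn h (\<lambda>x. f x - g x) = inn h f - inn h g"
  using arg_cong[OF inner_diff_left[of f g h], of cnj] by (simp add: inner_commute[symmetric])

lemmas inner_simps = inner_add_left inner_diff_left inner_add_right inner_diff_right
  inner_scale_left inner_scale_right l2_add l2_diff l2_scale

lemma inner_zero_left [simp]: "inn (\<lambda>x. 0) h = 0"
  by (simp add: l2_inner_def)

lemma inner_zero_right [simp]: "inn h (\<lambda>x. 0) = 0"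
  by (simp add: l2_inner_def)

lemma norm_fun_zero [simp]: "nrm (\<lambda>x. 0) = 0"
  by (simp add: l2_norm_def)

lemma norm_sq_inner: "(nrm f)\<^sup>2 = Re (inn f f)"
  by (simp add: inner_self)

lemma Re_inner_commute: "Re (inn g f) = Re (inn f g)"
  by (subst inner_commute) simp

lemma norm_sq_add:
  assumes "f \<in> H" "g \<in> H"
  shows "(nrm (\<lambda>x. f x + g x))\<^sup>2 = (nrm f)\<^sup>2 + (nrm g)\<^sup>2 + 2 * Re (inn f g)"
  using assms by (simp add: norm_sq_inner inner_simps Re_inner_commute[of g f])

lemma norm_sq_diff:
  assumes "f \<in> H" "g \<in> H"
  shows "(nrm (\<lambda>x. f x - g x))\<^sup>2 = (nrm f)\<^sup>2 + (nrm g)\<^sup>2 - 2 * Re (inn f g)"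
  using assms by (simp add: norm_sq_inner inner_simps Re_inner_commute[of g f])

lemma norm_scale: "nrm (\<lambda>x. a * f x) = cmod a * nrm f"
proof -
  have "inn (\<lambda>x. a * f x) (\<lambda>x. a * f x) = complex_of_real ((cmod a * nrm f)\<^sup>2)"
    by (simp only: inner_scale_left inner_scale_right inner_self power_mult_distrib
        of_real_mult complex_norm_square mult.assoc)
  then have "(nrm (\<lambda>x. a * f x))\<^sup>2 = (cmod a * nrm f)\<^sup>2"
    by (simp only: norm_sq_inner Re_complex_of_real)
  then show ?thesis by (simp add: power2_eq_iff_nonneg)
qed

lemma norm_point_le:
  assumes "f \<in> H" "x \<in> A"
  shows "(cmod (f x))\<^sup>2 * w x \<le> (nrm f)\<^sup>2"
  using finite_sum_le_infsum[OF l2_summable[OF assms(1)], of "{x}"] assms weight_pos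
  by (simp add: norm_sq less_imp_le)

lemma norm_eq_0:
  assumes "f \<in> H" "nrm f = 0"
  shows "f = (\<lambda>x. 0)"
proof
  fix x show "f x = 0"
  proof (cases "x \<in> A")
    case True
    then show ?thesis
      using norm_point_le[OF assms(1) True] weight_pos[OF True] assms(2)
      by (auto simp: mult_le_0_iff not_le)
  qed (use assms l2_outside in auto)
qed

text \<open>Young's inequality, from the square of \<open>sqrt t * f - g / sqrt t\<close>. The free
  \<open>t\<close> lets later estimates absorb one term into the left-hand side; its best value
  gives Cauchy-Schwarz.\<close>

lemma Re_inner_le:
  assumes "f \<in> H" "g \<in> H" "0 < t"
  shows "2 * Re (inn f g) \<le> t * (nrm f)\<^sup>2 + (nrm g)\<^sup>2 / t"
proof -
  have "0 \<le> (nrm (\<lambda>x. complex_of_real (sqrt t) * f x - complex_of_real (1 / sqrt t) * g x))\<^sup>2"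
    by simp
  also have "\<dots> = t * (nrm f)\<^sup>2 + (nrm g)\<^sup>2 / t - 2 * Re (inn f g)"
    using assms by (simp add: norm_sq_diff l2_scale norm_scale power_mult_distrib
        inner_scale_left inner_scale_right power_divide del: of_real_divide)
  finally show ?thesis by simp
qed

lemma Re_inner_le_norm:
  assumes "f \<in> H" "g \<in> H"
  shows "Re (inn f g) \<le> nrm f * nrm g"
proof (cases "nrm f = 0 \<or> nrm g = 0")
  case True
  then have "f = (\<lambda>x. 0) \<or> g = (\<lambda>x. 0)" using norm_eq_0 assms by blast
  then show ?thesis by (elim disjE) simp_all
next
  case False
  then have pos: "0 < nrm f" "0 < nrm g" by (simp_all add: less_le)
  \<comment> \<open>This \<open>t\<close> makes the two terms of the bound equal and so minimises
    it; it is available only for nonzero \<open>f\<close> and \<open>g\<close>, whence the case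
    split.\<close>
  then show ?thesis
    using Re_inner_le[OF assms, of "nrm g / nrm f"] by (simp add: power2_eq_square)
qed

lemma cauchy_schwarz:
  assumes "f \<in> H" "g \<in> H"
  shows "cmod (inn f g) \<le> nrm f * nrm g"
proof (cases "inn f g = 0")
  case False
  \<comment> \<open>A unimodular factor rotating the inner product onto the nonnegative real
    axis.\<close>
  define a where "a = cnj (inn f g) / cmod (inn f g)"
  have a: "cmod a = 1" using False by (simp add: a_def norm_divide)
  have "a * inn f g = cmod (inn f g)"
    using False by (simp add: a_def mult.commute[of "cnj _"] complex_norm_square[symmetric]
        power2_eq_square)
  then have "cmod (inn f g) = Re (inn (\<lambda>x. a * f x) g)" by (simp add: inner_scale_left)
  also have "\<dots> \<le> nrm (\<lambda>x. a * f x) * nrm g" by (intro Re_inner_le_norm l2_scale assms)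
  finally show ?thesis by (simp add: norm_scale a)
qed simp

lemma norm_triangle:
  assumes "f \<in> H" "g \<in> H"
  shows "nrm (\<lambda>x. f x + g x) \<le> nrm f + nrm g"
proof -
  have "(nrm (\<lambda>x. f x + g x))\<^sup>2 \<le> (nrm f + nrm g)\<^sup>2"
    using Re_inner_le_norm[OF assms] assms by (simp add: norm_sq_add power2_sum)
  then show ?thesis by (rule power2_le_imp_le) simp
qed

lemma norm_diff_commute: "nrm (\<lambda>x. f x - g x) = nrm (\<lambda>x. g x - f x)"
  by (simp add: l2_norm_def norm_minus_commute)

lemma norm_triangle_diff:
  assumes "f \<in> H" "g \<in> H" "h \<in> H"
  shows "nrm (\<lambda>x. f x - h x) \<le> nrm (\<lambda>x. f x - g x) + nrm (\<lambda>x. g x - h x)"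
  using norm_triangle[of "\<lambda>x. f x - g x" "\<lambda>x. g x - h x"] assms by (auto simp: l2_diff)

lemma l2_bounded_partial_sums:
  assumes out: "\<And>x. x \<notin> A \<Longrightarrow> f x = 0" and "0 \<le> C"
    and fin: "\<And>F. finite F \<Longrightarrow> F \<subseteq> A \<Longrightarrow> (\<Sum>x\<in>F. (cmod (f x))\<^sup>2 * w x) \<le> C\<^sup>2"
  shows "f \<in> H" "nrm f \<le> C"
proof -
  have *: "(\<lambda>x. (cmod (f x))\<^sup>2 * w x) summable_on A"
    using fin by (intro nonneg_bdd_above_summable_on bdd_aboveI[of _ "C\<^sup>2"])
      (auto simp: weight_pos less_imp_le)
  then show "f \<in> H" using out by (simp add: l2_def)
  have "(nrm f)\<^sup>2 \<le> C\<^sup>2"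
    unfolding norm_sq by (intro infsum_le_finite_sums * fin)
  then show "nrm f \<le> C" using \<open>0 \<le> C\<close> by (rule power2_le_imp_le)
qed

text \<open>Point evaluation at \<open>x\<close> costs a factor \<open>1 / sqrt (w x)\<close>, so
  the sequence converges pointwise. The norm bounds pass to the limit through finite partial sums.
  An explicit rate \<open>e\<close> replaces the Cauchy condition because it also bounds the
  distance to the limit.\<close>

lemma l2_complete:
  assumes u: "\<And>n. u n \<in> H" and e: "e \<longlonglongrightarrow> 0"
    and cauchy: "\<And>m n. n \<le> m \<Longrightarrow> nrm (\<lambda>x. u m x - u n x) \<le> e n"
  obtains f where "f \<in> H" "\<And>n. nrm (\<lambda>x. f x - u n x) \<le> e n"
proof -
  have "\<exists>l. (\<lambda>n. u n x) \<longlonglongrightarrow> l \<and> (x \<notin> A \<longrightarrow> l = 0)" for x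
  proof (cases "x \<in> A")
    case False
    then have "\<And>n. u n x = 0" using u l2_outside by blast
    then show ?thesis by (intro exI[of _ 0]) simp
  next
    case True
    have bd: "cmod (u m x - u n x) \<le> e n / sqrt (w x)" if "n \<le> m" for m n
    proof -
      have "(cmod (u m x - u n x))\<^sup>2 * w x \<le> (e n)\<^sup>2"
        using norm_point_le[OF l2_diff[OF u[of m] u[of n]] True] cauchy[OF that]
        by (smt (verit) norm_nonneg power_mono)
      then have "(cmod (u m x - u n x) * sqrt (w x))\<^sup>2 \<le> (e n)\<^sup>2"
        using weight_pos[OF True] by (simp add: power_mult_distrib)
      moreover have "0 \<le> e n" using cauchy[OF that] by (smt (verit) norm_nonneg)
      ultimately have "cmod (u m x - u n x) * sqrt (w x) \<le> e n" by (rule power2_le_imp_le)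
      then show ?thesis using weight_pos[OF True] by (simp add: field_simps)
    qed
    have "(\<lambda>n. e n / sqrt (w x)) \<longlonglongrightarrow> 0"
      using tendsto_divide[OF e tendsto_const[of "sqrt (w x)"]] weight_pos[OF True] by simp
    have "Cauchy (\<lambda>n. u n x)"
    proof (rule metric_CauchyI)
      fix \<epsilon> :: real assume "0 < \<epsilon>"
      then obtain N where N: "\<And>n. n \<ge> N \<Longrightarrow> \<bar>e n / sqrt (w x)\<bar> < \<epsilon> / 2"
        using \<open>(\<lambda>n. e n / sqrt (w x)) \<longlonglongrightarrow> 0\<close> unfolding LIMSEQ_def dist_real_def
        by (metis diff_zero half_gt_zero)
      have "dist (u m x) (u N x) < \<epsilon> / 2" if "m \<ge> N" for m
        using bd[OF that] N[of N] unfolding dist_norm by linarith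
      then show "\<exists>N. \<forall>m\<ge>N. \<forall>n\<ge>N. dist (u m x) (u n x) < \<epsilon>"
        using dist_triangle_half_l by blast
    qed
    then show ?thesis using True by (auto simp: Cauchy_convergent_iff convergent_def)
  qed
  then obtain f where f: "\<And>x. (\<lambda>n. u n x) \<longlonglongrightarrow> f x" "\<And>x. x \<notin> A \<Longrightarrow> f x = 0" by metis
  have e0: "0 \<le> e n" for n using cauchy[of n n] by (smt (verit) norm_nonneg order_refl)
  have *: "(\<lambda>x. f x - u n x) \<in> H \<and> nrm (\<lambda>x. f x - u n x) \<le> e n" for n
  proof (intro conjI l2_bounded_partial_sums[OF _ e0])
    fix F assume F: "finite F" "F \<subseteq> A"
    have "(\<lambda>m. \<Sum>x\<in>F. (cmod (u m x - u n x))\<^sup>2 * w x)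
        \<longlonglongrightarrow> (\<Sum>x\<in>F. (cmod (f x - u n x))\<^sup>2 * w x)"
      by (intro tendsto_intros f)
    moreover have "(\<Sum>x\<in>F. (cmod (u m x - u n x))\<^sup>2 * w x) \<le> (e n)\<^sup>2" if "m \<ge> n" for m
    proof -
      have "(\<Sum>x\<in>F. (cmod (u m x - u n x))\<^sup>2 * w x) \<le> (nrm (\<lambda>x. u m x - u n x))\<^sup>2"
        unfolding norm_sq using F weight_pos
        by (intro finite_sum_le_infsum l2_summable l2_diff u) (auto simp: less_imp_le)
      also have "\<dots> \<le> (e n)\<^sup>2" using cauchy[OF that] by (simp add: power_mono)
      finally show ?thesis .
    qed
    ultimately show "(\<Sum>x\<in>F. (cmod (f x - u n x))\<^sup>2 * w x) \<le> (e n)\<^sup>2"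
      by (intro LIMSEQ_le_const2) auto
    then show "(\<Sum>x\<in>F. (cmod (f x - u n x))\<^sup>2 * w x) \<le> (e n)\<^sup>2" .
  qed (use f u l2_outside in auto)
  then have "f \<in> H" using l2_add[OF u[of 0], of "\<lambda>x. f x - u 0 x"] by simp
  then show ?thesis using that * by blast
qed

lemma contraction_fixed_point:
  assumes K: "\<And>f. f \<in> H \<Longrightarrow> K f \<in> H" and q: "0 \<le> q" "q < 1"
    and contr: "\<And>f g. f \<in> H \<Longrightarrow> g \<in> H \<Longrightarrow>
      nrm (\<lambda>x. K f x - K g x) \<le> q * nrm (\<lambda>x. f x - g x)"
  obtains f where "f \<in> H" "K f = f"
proof -
  define u where "u = (\<lambda>n. (K ^^ n) (\<lambda>x. 0))"
  have u: "u n \<in> H" for n by (induction n) (auto simp: u_def K)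
  \<comment> \<open>The solution of \<open>D = q * D + nrm (u 1)\<close>: as a bound for one iterate
    it passes to the next.\<close>
  define D where "D = nrm (u 1) / (1 - q)"
  have u_bound: "nrm (u n) \<le> D" for n
  proof (induction n)
    case 0 show ?case using q by (simp add: u_def D_def)
  next
    case (Suc n)
    have "nrm (u (Suc n)) \<le> nrm (\<lambda>x. K (u n) x - K (\<lambda>x. 0) x) + nrm (u 1)"
      using norm_triangle[OF l2_diff[OF u[of "Suc n"] u[of 1]] u[of 1]]
      by (simp add: u_def)
    also have "\<dots> \<le> q * D + nrm (u 1)"
      using contr[OF u[of n] l2_zero] mult_left_mono[OF Suc q(1)] by simp
    also have "\<dots> = D" using q by (simp add: D_def field_simps)
    finally show ?case .
  qed
  have iter: "nrm (\<lambda>x. (K ^^ n) f x - (K ^^ n) g x) \<le> q ^ n * nrm (\<lambda>x. f x - g x)"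
    if "f \<in> H" "g \<in> H" for n f g
  proof (induction n)
    case (Suc n)
    have "(K ^^ n) f \<in> H" "(K ^^ n) g \<in> H" using that by (induction n) (auto simp: K)
    then show ?case
      using contr[of "(K ^^ n) f" "(K ^^ n) g"] mult_left_mono[OF Suc q(1)]
      by (simp add: mult.assoc)
  qed simp
  have cauchy: "nrm (\<lambda>x. u m x - u n x) \<le> q ^ n * D" if "n \<le> m" for m n
  proof -
    have "u m = (K ^^ n) (u (m - n))"
      using that by (metis u_def funpow_add comp_apply le_add_diff_inverse)
    then have "nrm (\<lambda>x. u m x - u n x) \<le> q ^ n * nrm (u (m - n))"
      using iter[OF u[of "m - n"] l2_zero, of n] by (simp add: u_def)
    also have "\<dots> \<le> q ^ n * D" using u_bound q by (simp add: mult_left_mono)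
    finally show ?thesis .
  qed
  have e: "(\<lambda>n. q ^ n * D) \<longlonglongrightarrow> 0"
    using q by (intro tendsto_mult_left_zero LIMSEQ_realpow_zero) auto
  obtain f where f: "f \<in> H" "\<And>n. nrm (\<lambda>x. f x - u n x) \<le> q ^ n * D"
    using l2_complete[of u "\<lambda>n. q ^ n * D"] u e cauchy by blast
  have "nrm (\<lambda>x. K f x - f x) \<le> 2 * (q ^ n * D)" for n
  proof -
    have "nrm (\<lambda>x. K f x - f x)
        \<le> nrm (\<lambda>x. K f x - u (Suc n) x) + nrm (\<lambda>x. u (Suc n) x - f x)"
      by (intro norm_triangle_diff K f u)
    also have "nrm (\<lambda>x. K f x - u (Suc n) x) \<le> q * nrm (\<lambda>x. f x - u n x)"
      using contr[OF f(1) u[of n]] by (simp add: u_def)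
    also have "\<dots> \<le> q ^ n * D"
      using f(2)[of n] q mult_left_le_one_le[OF norm_nonneg, of q "\<lambda>x. f x - u n x"] by linarith
    also have "nrm (\<lambda>x. u (Suc n) x - f x) \<le> q ^ Suc n * D"
      using f(2)[of "Suc n"] by (simp add: norm_diff_commute)
    also have "\<dots> \<le> q ^ n * D"
      using q u_bound[of 0] norm_nonneg[of "u 0"]
      by (intro mult_right_mono power_decreasing) linarith+
    finally show ?thesis by linarith
  qed
  moreover have "(\<lambda>n. 2 * (q ^ n * D)) \<longlonglongrightarrow> 0"
    using tendsto_mult_right_zero[OF e] by simp
  ultimately have "nrm (\<lambda>x. K f x - f x) \<le> 0"
    using LIMSEQ_le_const by blast
  then have "(\<lambda>x. K f x - f x) = (\<lambda>x. 0)"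
    using norm_eq_0 l2_diff[OF K[OF f(1)] f(1)] norm_nonneg by (metis order_antisym)
  then have "K f = f" by (metis eq_iff_diff_eq_0 ext)
  then show ?thesis using that f(1) by blast
qed

end

section \<open>Bounded operators and spectral gaps\<close>

lemma (in l2_space) norm_sq_add_le:
  assumes "f \<in> H" "g \<in> H"
  shows "(nrm (\<lambda>x. f x + g x))\<^sup>2 \<le> 2 * (nrm f)\<^sup>2 + 2 * (nrm g)\<^sup>2"
  using norm_sq_add[OF assms] Re_inner_le[OF assms, of 1] by simp

text \<open>\<open>M\<close> bounds the square of the operator norm, so that energies are compared
  directly. Its positivity allows \<open>1 / M\<close> as the parameter of
  \<open>Re_inner_le\<close>.\<close>

locale l2_operator = dom: l2_space A w + cod: l2_space B u
  for A :: "'a set" and w and B :: "'b set" and u +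
  fixes T :: "('a \<Rightarrow> complex) \<Rightarrow> 'b \<Rightarrow> complex" and M :: real
  assumes maps: "f \<in> l2 A w \<Longrightarrow> T f \<in> l2 B u"
    and lincomb: "f \<in> l2 A w \<Longrightarrow> g \<in> l2 A w \<Longrightarrow>
      T (\<lambda>x. a * f x + b * g x) = (\<lambda>x. a * T f x + b * T g x)"
    and bound_pos: "0 < M"
    and bound: "f \<in> l2 A w \<Longrightarrow> (l2_norm B u (T f))\<^sup>2 \<le> M * (l2_norm A w f)\<^sup>2"
begin

lemma op_add: "f \<in> l2 A w \<Longrightarrow> g \<in> l2 A w \<Longrightarrow> T (\<lambda>x. f x + g x) = (\<lambda>x. T f x + T g x)"
  using lincomb[of f g 1 1] by simp

lemma op_diff: "f \<in> l2 A w \<Longrightarrow> g \<in> l2 A w \<Longrightarrow> T (\<lambda>x. f x - g x) = (\<lambda>x. T f x - T g x)"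
  using lincomb[of f g 1 "-1"] by simp

lemma op_scale: "f \<in> l2 A w \<Longrightarrow> T (\<lambda>x. a * f x) = (\<lambda>x. a * T f x)"
  using lincomb[of f f a 0] by simp

lemma op_zero [simp]: "T (\<lambda>x. 0) = (\<lambda>x. 0)"
  using op_scale[of "\<lambda>x. 0" 0] by simp

lemma bound_norm: "f \<in> l2 A w \<Longrightarrow> l2_norm B u (T f) \<le> sqrt M * l2_norm A w f"
  using real_sqrt_le_mono[OF bound[of f]] by (simp add: real_sqrt_mult)

text \<open>The Riesz representative of \<open>g \<mapsto> \<langle>T g, h\<rangle>\<close> is read off from the values on the point masses.\<close>

lemma adjoint_exists:
  assumes h: "h \<in> l2 B u"
  shows "\<exists>f\<in>l2 A w. \<forall>g\<in>l2 A w. l2_inner B u (T g) h = l2_inner A w g f"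
proof -
  define ell where "ell g = l2_inner B u (T g) h" for g
  define \<delta> :: "'a \<Rightarrow> 'a \<Rightarrow> complex" where "\<delta> = (\<lambda>y x. if x = y then 1 else 0)"
  define f where "f = (\<lambda>y. if y \<in> A then cnj (ell (\<delta> y)) / w y else 0)"
  define tr :: "'a set \<Rightarrow> ('a \<Rightarrow> complex) \<Rightarrow> 'a \<Rightarrow> complex"
    where "tr = (\<lambda>F g x. if x \<in> F then g x else 0)"
  have norm_tr: "tr F g \<in> l2 A w \<and> (l2_norm A w (tr F g))\<^sup>2 = (\<Sum>x\<in>F. (cmod (g x))\<^sup>2 * w x)"
    if "finite F" "F \<subseteq> A" for F g
  proof -
    have "((\<lambda>x. (cmod (tr F g x))\<^sup>2 * w x) has_sum (\<Sum>x\<in>F. (cmod (g x))\<^sup>2 * w x)) A"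
      using that by (intro has_sum_finite_neutralI[where B = F]) (auto simp: tr_def)
    then show ?thesis
      using that by (auto simp: l2_def dom.norm_sq tr_def infsumI dest: has_sum_imp_summable)
  qed
  have ell_tr: "ell (tr F g) = (\<Sum>x\<in>F. g x * cnj (f x) * w x)"
    if "finite F" "F \<subseteq> A" for F g
    using that
  proof (induction F rule: finite_induct)
    case empty
    then show ?case by (simp add: tr_def ell_def)
  next
    case (insert y F)
    have y: "\<delta> y \<in> l2 A w"
      using norm_tr[of "{y}" "\<lambda>_. 1"] insert.prems by (simp add: tr_def \<delta>_def)
    have F: "tr F g \<in> l2 A w" using norm_tr insert by auto
    have "tr (insert y F) g = (\<lambda>x. tr F g x + g y * \<delta> y x)"
      using insert.hyps by (auto simp: tr_def \<delta>_def)
    then have "ell (tr (insert y F) g) = ell (tr F g) + g y * ell (\<delta> y)"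
      using h y F by (simp add: ell_def op_add op_scale dom.l2_scale cod.inner_add_left
          cod.inner_scale_left maps cod.l2_scale)
    moreover have "ell (\<delta> y) = cnj (f y) * w y"
      using insert.prems dom.weight_pos[of y] by (simp add: f_def)
    ultimately show ?case using insert by simp
  qed
  \<comment> \<open>Testing the functional on the truncation of \<open>f\<close> itself returns the
    squared norm of that truncation, so the boundedness of \<open>T\<close> controls it uniformly in
    \<open>F\<close>.\<close>
  have f: "f \<in> l2 A w"
  proof (rule dom.l2_bounded_partial_sums(1))
    show "0 \<le> sqrt M * l2_norm B u h" using bound_pos by simp
    fix F assume F: "finite F" "F \<subseteq> A"
    let ?S = "\<Sum>x\<in>F. (cmod (f x))\<^sup>2 * w x"
    have "ell (tr F f) = ?S"
      unfolding ell_tr[OF F] by (simp add: complex_norm_square[symmetric])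
    then have "2 * ?S = 2 * Re (l2_inner B u (T (tr F f)) h)" by (simp add: ell_def)
    also have "\<dots> \<le> 1 / M * (l2_norm B u (T (tr F f)))\<^sup>2 + (l2_norm B u h)\<^sup>2 / (1 / M)"
      using norm_tr[OF F] h bound_pos by (intro cod.Re_inner_le maps) auto
    also have "\<dots> \<le> 1 / M * (M * ?S) + (l2_norm B u h)\<^sup>2 / (1 / M)"
      using bound[of "tr F f"] norm_tr[OF F, of f] bound_pos
      by (intro add_right_mono mult_left_mono) auto
    finally show "?S \<le> (sqrt M * l2_norm B u h)\<^sup>2"
      using bound_pos by (simp add: power_mult_distrib mult.commute)
  qed (simp add: f_def)
  moreover have "ell g = l2_inner A w g f" if g: "g \<in> l2 A w" for g
  proof -
    define C where "C = sqrt M * l2_norm B u h"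
    \<comment> \<open>The error of a truncation is the functional at the remaining tail of
      \<open>g\<close>, whose norm tends to 0 along the finite subsets.\<close>
    have "norm (ell g - (\<Sum>x\<in>F. g x * cnj (f x) * w x))
        \<le> C * sqrt ((l2_norm A w g)\<^sup>2 - (\<Sum>x\<in>F. (cmod (g x))\<^sup>2 * w x))"
      if F: "finite F" "F \<subseteq> A" for F
    proof -
      let ?k = "\<lambda>x. g x - tr F g x"
      have tr: "tr F g \<in> l2 A w" using norm_tr[OF F] by blast
      have inner_tr: "l2_inner A w g (tr F g) = (\<Sum>x\<in>F. (cmod (g x))\<^sup>2 * w x)"
        unfolding l2_inner_def of_real_sum
        using F by (intro infsumI has_sum_finite_neutralI[where B = F])
          (auto simp: tr_def complex_norm_square[symmetric])
      have k: "?k \<in> l2 A w" using g tr by auto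
      have "ell g - (\<Sum>x\<in>F. g x * cnj (f x) * w x) = l2_inner B u (T ?k) h"
        using ell_tr[OF F, of g] g tr h by (simp add: ell_def op_diff cod.inner_diff_left maps)
      also have "norm \<dots> \<le> l2_norm B u (T ?k) * l2_norm B u h"
        by (intro cod.cauchy_schwarz maps k h)
      also have "\<dots> \<le> sqrt M * l2_norm A w ?k * l2_norm B u h"
        by (intro mult_right_mono bound_norm k) simp
      also have "l2_norm A w ?k = sqrt ((l2_norm A w g)\<^sup>2 - (\<Sum>x\<in>F. (cmod (g x))\<^sup>2 * w x))"
        using dom.norm_sq_diff[OF g tr] norm_tr[OF F, of g]
        by (intro real_sqrt_unique[symmetric]) (auto simp: inner_tr)
      finally show ?thesis by (simp add: C_def mult_ac)
    qed
    then have ev: "\<forall>\<^sub>F F in finite_subsets_at_top A.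
        norm (ell g - (\<Sum>x\<in>F. g x * cnj (f x) * w x))
        \<le> C * sqrt ((l2_norm A w g)\<^sup>2 - (\<Sum>x\<in>F. (cmod (g x))\<^sup>2 * w x))"
      by (intro eventually_finite_subsets_at_top_weakI)
    have "((\<lambda>F. \<Sum>x\<in>F. (cmod (g x))\<^sup>2 * w x) \<longlongrightarrow> (l2_norm A w g)\<^sup>2) (finite_subsets_at_top A)"
      using dom.l2_summable[OF g] has_sum_infsum unfolding dom.norm_sq has_sum_def by blast
    then have lim: "((\<lambda>F. C * sqrt ((l2_norm A w g)\<^sup>2 - (\<Sum>x\<in>F. (cmod (g x))\<^sup>2 * w x)))
        \<longlongrightarrow> C * sqrt ((l2_norm A w g)\<^sup>2 - (l2_norm A w g)\<^sup>2)) (finite_subsets_at_top A)"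
      by (intro tendsto_intros)
    have "((\<lambda>F. ell g - (\<Sum>x\<in>F. g x * cnj (f x) * w x)) \<longlongrightarrow> 0) (finite_subsets_at_top A)"
    proof (rule tendsto_0_le[where K = 1, rotated])
      show "\<forall>\<^sub>F F in finite_subsets_at_top A. norm (ell g - (\<Sum>x\<in>F. g x * cnj (f x) * w x))
          \<le> norm (C * sqrt ((l2_norm A w g)\<^sup>2 - (\<Sum>x\<in>F. (cmod (g x))\<^sup>2 * w x))) * 1"
        using ev by eventually_elim (unfold real_norm_def mult_1_right, linarith)
    qed (use lim in simp)
    then have "((\<lambda>F. ell g - (ell g - (\<Sum>x\<in>F. g x * cnj (f x) * w x))) \<longlongrightarrow> ell g - 0)
        (finite_subsets_at_top A)"
      by (intro tendsto_intros)
    then show ?thesis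
      unfolding l2_inner_def by (intro infsumI[symmetric]) (simp add: has_sum_def)
  qed
  ultimately show ?thesis unfolding ell_def by blast
qed

lemma adjoint:
  assumes h: "h \<in> l2 B u"
  shows "l2_adjoint A w B u T h \<in> l2 A w"
    and "g \<in> l2 A w \<Longrightarrow> l2_inner B u (T g) h = l2_inner A w g (l2_adjoint A w B u T h)"
proof -
  obtain f where f: "f \<in> l2 A w" "\<And>g. g \<in> l2 A w \<Longrightarrow> l2_inner B u (T g) h = l2_inner A w g f"
    using adjoint_exists[OF h] by blast
  then have "l2_adjoint A w B u T h = f" by (intro l2_adjoint_eqI dom.weight_pos)
  with f show "l2_adjoint A w B u T h \<in> l2 A w"
    "g \<in> l2 A w \<Longrightarrow> l2_inner B u (T g) h = l2_inner A w g (l2_adjoint A w B u T h)" by auto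
qed

abbreviation "gram f \<equiv> l2_adjoint A w B u T (T f)"

lemma gram_in: "f \<in> l2 A w \<Longrightarrow> gram f \<in> l2 A w"
  by (intro adjoint maps)

lemma inner_gram_right:
  "f \<in> l2 A w \<Longrightarrow> g \<in> l2 A w \<Longrightarrow> l2_inner A w g (gram f) = l2_inner B u (T g) (T f)"
  by (simp add: adjoint maps)

lemma inner_gram_left:
  "f \<in> l2 A w \<Longrightarrow> g \<in> l2 A w \<Longrightarrow> l2_inner A w (gram f) g = l2_inner B u (T f) (T g)"
  by (subst dom.inner_commute, subst cod.inner_commute) (simp add: inner_gram_right)

lemma gram_operator: "l2_operator A w A w (\<lambda>f. gram f) (M\<^sup>2)"
proof
  fix f g :: "'a \<Rightarrow> complex" and a b assume fg: "f \<in> l2 A w" "g \<in> l2 A w"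
  show "gram (\<lambda>x. a * f x + b * g x) = (\<lambda>x. a * gram f x + b * gram g x)"
    using fg by (intro l2_adjoint_eqI dom.weight_pos)
      (auto simp: lincomb gram_in dom.inner_simps cod.inner_simps inner_gram_right maps)
next
  fix f :: "'a \<Rightarrow> complex" assume f: "f \<in> l2 A w"
  have gf: "gram f \<in> l2 A w" using gram_in[OF f] .
  \<comment> \<open>\<open>gram f\<close> is tested against itself; with parameter
    \<open>1 / M\<close>, half of the left-hand side reappears on the right and cancels.\<close>
  have "2 * (l2_norm A w (gram f))\<^sup>2 = 2 * Re (l2_inner B u (T (gram f)) (T f))"
    using f by (simp only: dom.norm_sq_inner inner_gram_right[OF f gf])
  also have "\<dots> \<le> 1 / M * (l2_norm B u (T (gram f)))\<^sup>2 + (l2_norm B u (T f))\<^sup>2 / (1 / M)"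
    using bound_pos by (intro cod.Re_inner_le maps gram_in f) auto
  also have "\<dots> \<le> 1 / M * (M * (l2_norm A w (gram f))\<^sup>2) + (M * (l2_norm A w f)\<^sup>2) / (1 / M)"
    using bound_pos bound[OF f] bound[OF gf]
    by (intro add_mono mult_left_mono divide_right_mono) auto
  finally show "(l2_norm A w (gram f))\<^sup>2 \<le> M\<^sup>2 * (l2_norm A w f)\<^sup>2"
    using bound_pos by (simp add: power2_eq_square mult_ac)
qed (use bound_pos gram_in in auto)

end

lemma l2_operator_shift:
  assumes "l2_operator A w A w T M"
  shows "l2_operator A w A w (\<lambda>f x. T f x - z * f x) (2 * M + 2 * (cmod z)\<^sup>2)"
proof -
  interpret l2_operator A w A w T M by fact
  show ?thesis
  proof
    fix f :: "'a \<Rightarrow> complex" assume f: "f \<in> l2 A w"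
    then show "(\<lambda>x. T f x - z * f x) \<in> l2 A w" by (intro dom.l2_diff maps dom.l2_scale)
    have "(l2_norm A w (\<lambda>x. T f x - z * f x))\<^sup>2
        \<le> 2 * (l2_norm A w (T f))\<^sup>2 + 2 * (l2_norm A w (\<lambda>x. z * f x))\<^sup>2"
      using dom.norm_sq_add_le[OF maps[OF f] dom.l2_scale[OF f, of "- z"]]
        dom.norm_scale[of "- z" f] by (simp add: dom.norm_scale)
    also have "\<dots> \<le> 2 * (M * (l2_norm A w f)\<^sup>2) + 2 * (l2_norm A w (\<lambda>x. z * f x))\<^sup>2"
      using bound[OF f] by simp
    finally show "(l2_norm A w (\<lambda>x. T f x - z * f x))\<^sup>2
        \<le> (2 * M + 2 * (cmod z)\<^sup>2) * (l2_norm A w f)\<^sup>2"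
      by (simp add: dom.norm_scale power_mult_distrib algebra_simps)
  qed (use bound_pos in \<open>auto simp: lincomb algebra_simps add_pos_nonneg\<close>)
qed

lemma l2_operator_comp:
  assumes "l2_operator A w A w S M" "l2_operator A w A w T M'"
  shows "l2_operator A w A w (\<lambda>f. S (T f)) (M * M')"
proof -
  interpret S: l2_operator A w A w S M by fact
  interpret T: l2_operator A w A w T M' by fact
  show ?thesis
  proof
    fix f :: "'a \<Rightarrow> complex" assume f: "f \<in> l2 A w"
    have "(l2_norm A w (S (T f)))\<^sup>2 \<le> M * (l2_norm A w (T f))\<^sup>2"
      by (intro S.bound T.maps f)
    also have "\<dots> \<le> M * (M' * (l2_norm A w f)\<^sup>2)"
      using S.bound_pos by (intro mult_left_mono T.bound f) simp
    finally show "(l2_norm A w (S (T f)))\<^sup>2 \<le> M * M' * (l2_norm A w f)\<^sup>2"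
      by (simp add: mult.assoc)
  qed (use S.bound_pos T.bound_pos in \<open>auto simp: S.lincomb T.lincomb S.maps T.maps\<close>)
qed

section \<open>Surjectivity and the resolvent set\<close>

text \<open>Lax--Milgram: \<open>f \<mapsto> f - t (T f - h)\<close> is a contraction for small \<open>t > 0\<close>.\<close>

lemma coercive_surjective:
  assumes "l2_operator A w A w T M" and "0 < \<alpha>"
    and coercive: "\<And>f. f \<in> l2 A w \<Longrightarrow> \<alpha> * (l2_norm A w f)\<^sup>2 \<le> Re (l2_inner A w (T f) f)"
    and h: "h \<in> l2 A w"
  shows "\<exists>f\<in>l2 A w. T f = h"
proof -
  interpret l2_operator A w A w T M by fact
  \<comment> \<open>The expression \<open>1 - 2 t \<alpha> + t^2 N\<close> is smallest at
    \<open>t = \<alpha> / N\<close>, with value \<open>q^2\<close>. Taking \<open>N\<close> at least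
    \<open>\<alpha>^2\<close> keeps this value nonnegative.\<close>
  define N where "N = max M (\<alpha>\<^sup>2)"
  have N: "0 < N" "M \<le> N" "\<alpha>\<^sup>2 \<le> N" using bound_pos by (auto simp: N_def)
  define t where "t = \<alpha> / N"
  define q where "q = sqrt (1 - \<alpha>\<^sup>2 / N)"
  have "0 < t" using N \<open>0 < \<alpha>\<close> by (simp add: t_def)
  have q: "0 \<le> q" "q < 1" "q\<^sup>2 = 1 - \<alpha>\<^sup>2 / N"
    using N \<open>0 < \<alpha>\<close> by (auto simp: q_def)
  define K where "K = (\<lambda>f x. f x - complex_of_real t * (T f x - h x))"
  have K: "K f \<in> l2 A w" if "f \<in> l2 A w" for f
    unfolding K_def using that h by (intro dom.l2_diff dom.l2_scale maps)
  have contr: "l2_norm A w (\<lambda>x. K f x - K g x) \<le> q * l2_norm A w (\<lambda>x. f x - g x)"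
    if fg: "f \<in> l2 A w" "g \<in> l2 A w" for f g
  proof -
    define k where "k = (\<lambda>x. f x - g x)"
    have k: "k \<in> l2 A w" using fg by (auto simp: k_def)
    have Kfg: "(\<lambda>x. K f x - K g x) = (\<lambda>x. k x - complex_of_real t * T k x)"
      using fg by (simp add: K_def k_def op_diff algebra_simps)
    have "(l2_norm A w (\<lambda>x. K f x - K g x))\<^sup>2
        = (l2_norm A w k)\<^sup>2 + t\<^sup>2 * (l2_norm A w (T k))\<^sup>2 - 2 * t * Re (l2_inner A w (T k) k)"
      unfolding Kfg using k maps[OF k]
      by (simp add: dom.norm_sq_diff dom.l2_scale dom.norm_scale dom.inner_scale_right
          dom.Re_inner_commute[of k] power_mult_distrib)
    also have "\<dots> \<le> (l2_norm A w k)\<^sup>2 + t\<^sup>2 * (N * (l2_norm A w k)\<^sup>2)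
        - 2 * t * (\<alpha> * (l2_norm A w k)\<^sup>2)"
    proof (intro diff_mono add_left_mono mult_left_mono coercive k)
      have "(l2_norm A w (T k))\<^sup>2 \<le> M * (l2_norm A w k)\<^sup>2" by (rule bound[OF k])
      also have "\<dots> \<le> N * (l2_norm A w k)\<^sup>2" using N by (intro mult_right_mono) auto
      finally show "(l2_norm A w (T k))\<^sup>2 \<le> N * (l2_norm A w k)\<^sup>2" .
    qed (use \<open>0 < t\<close> in auto)
    also have "\<dots> = (q * l2_norm A w k)\<^sup>2"
      using N unfolding power_mult_distrib q by (simp add: t_def field_simps power2_eq_square)
    finally show ?thesis
      unfolding k_def by (rule power2_le_imp_le) (simp add: q)
  qed
  obtain f where f: "f \<in> l2 A w" "K f = f"
    using dom.contraction_fixed_point[of K q] K q contr by blast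
  have "T f x = h x" for x
    using fun_cong[OF f(2), of x] \<open>0 < t\<close> by (simp add: K_def)
  then show ?thesis using f(1) by blast
qed

text \<open>By symmetry \<open>T - cnj z\<close> is the adjoint of \<open>T - z\<close>. Its lower
  bound makes the product of \<open>T - z\<close> with its adjoint coercive, so \<open>T - z\<close>
  is onto; the lower bound of \<open>T - z\<close> itself gives injectivity and the bounded
  inverse.\<close>

lemma resolvent_setI:
  assumes T: "l2_operator A w A w T M" and "0 < \<alpha>"
    and sym: "\<And>f g. f \<in> l2 A w \<Longrightarrow> g \<in> l2 A w \<Longrightarrow> l2_inner A w (T f) g = l2_inner A w f (T g)"
    and below: "\<And>f. f \<in> l2 A w \<Longrightarrow>
      \<alpha> * (l2_norm A w f)\<^sup>2 \<le> (l2_norm A w (\<lambda>x. T f x - z * f x))\<^sup>2"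
    and below': "\<And>f. f \<in> l2 A w \<Longrightarrow>
      \<alpha> * (l2_norm A w f)\<^sup>2 \<le> (l2_norm A w (\<lambda>x. T f x - cnj z * f x))\<^sup>2"
  shows "z \<in> l2_resolvent_set A w T"
proof -
  interpret l2_operator A w A w T M by fact
  let ?S = "\<lambda>f x. T f x - z * f x" and ?S' = "\<lambda>f x. T f x - cnj z * f x"
  interpret S: l2_operator A w A w ?S "2 * M + 2 * (cmod z)\<^sup>2"
    by (rule l2_operator_shift[OF T])
  interpret S': l2_operator A w A w ?S' "2 * M + 2 * (cmod (cnj z))\<^sup>2"
    by (rule l2_operator_shift[OF T])
  have adj: "l2_inner A w (?S f) g = l2_inner A w f (?S' g)" if "f \<in> l2 A w" "g \<in> l2 A w" for f g
    using that sym[OF that] by (simp add: dom.inner_simps maps)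
  have surj: "\<exists>f\<in>l2 A w. ?S f = h" if h: "h \<in> l2 A w" for h
  proof -
    have "\<exists>f\<in>l2 A w. ?S (?S' f) = h"
    proof (rule coercive_surjective[OF l2_operator_comp[OF S.l2_operator_axioms
            S'.l2_operator_axioms] \<open>0 < \<alpha>\<close> _ h])
      fix f assume f: "f \<in> l2 A w"
      have "Re (l2_inner A w (?S (?S' f)) f) = (l2_norm A w (?S' f))\<^sup>2"
        unfolding dom.norm_sq_inner using adj[OF S'.maps[OF f] f] by simp
      then show "\<alpha> * (l2_norm A w f)\<^sup>2 \<le> Re (l2_inner A w (?S (?S' f)) f)"
        using below'[OF f] by simp
    qed
    then show ?thesis using S'.maps by blast
  qed
  have bd: "l2_norm A w f \<le> 1 / sqrt \<alpha> * l2_norm A w (?S f)" if "f \<in> l2 A w" for f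
    using real_sqrt_le_mono[OF below[OF that]] \<open>0 < \<alpha>\<close>
    by (simp add: real_sqrt_mult field_simps)
  have "f = g" if fg: "f \<in> l2 A w" "g \<in> l2 A w" "?S f = ?S g" for f g
  proof -
    have "?S (\<lambda>x. f x - g x) = (\<lambda>x. 0)" using S.op_diff[OF fg(1,2)] fun_cong[OF fg(3)] by simp
    then have "l2_norm A w (\<lambda>x. f x - g x) \<le> 0"
      using bd[OF dom.l2_diff[OF fg(1,2)]] by simp
    then have "(\<lambda>x. f x - g x) = (\<lambda>x. 0)"
      using dom.norm_eq_0[OF dom.l2_diff[OF fg(1,2)]] dom.norm_nonneg by (metis order_antisym)
    then show ?thesis by (metis eq_iff_diff_eq_0 ext)
  qed
  then have "inj_on ?S (l2 A w)" by (intro inj_onI)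
  moreover have "?S ` l2 A w = l2 A w"
  proof
    show "?S ` l2 A w \<subseteq> l2 A w" using S.maps by (intro image_subsetI)
    show "l2 A w \<subseteq> ?S ` l2 A w"
    proof
      fix h assume "h \<in> l2 A w"
      then obtain f where f: "f \<in> l2 A w" "?S f = h" using surj by blast
      then show "h \<in> ?S ` l2 A w" by (intro image_eqI[of _ _ f]) simp_all
    qed
  qed
  ultimately have "bij_betw ?S (l2 A w) (l2 A w)" by (simp add: bij_betw_def)
  then show ?thesis unfolding l2_resolvent_set_def using bd by blast
qed

context l2_operator
begin

text \<open>The form of \<open>gram\<close> is real, so the imaginary part of \<open>y\<close>
  separates: the squared norm of \<open>gram f - y f\<close> is that of
  \<open>gram f - Re y f\<close> plus \<open>(Im y)^2\<close> times that of \<open>f\<close>. This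
  serves \<open>z\<close> and \<open>cnj z\<close> alike.\<close>

lemma gram_nonreal_resolvent:
  assumes "Im z \<noteq> 0"
  shows "z \<in> l2_resolvent_set A w (\<lambda>f. gram f)"
proof -
  have "(Im y)\<^sup>2 * (l2_norm A w f)\<^sup>2 \<le> (l2_norm A w (\<lambda>x. gram f x - y * f x))\<^sup>2"
    if f: "f \<in> l2 A w" for f y
  proof -
    have g: "gram f \<in> l2 A w" using gram_in[OF f] .
    have real: "l2_inner A w (gram f) f = of_real ((l2_norm B u (T f))\<^sup>2)"
      using inner_gram_left[OF f f] by (simp add: cod.inner_self)
    have expand: "(l2_norm A w (\<lambda>x. gram f x - v * f x))\<^sup>2
        = (l2_norm A w (gram f))\<^sup>2 + (cmod v)\<^sup>2 * (l2_norm A w f)\<^sup>2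
          - 2 * Re v * (l2_norm B u (T f))\<^sup>2" for v
      using dom.norm_sq_diff[OF g dom.l2_scale[OF f, of v]]
      by (simp add: dom.norm_scale dom.inner_scale_right real power_mult_distrib)
    have "(l2_norm A w (\<lambda>x. gram f x - y * f x))\<^sup>2
        = (l2_norm A w (\<lambda>x. gram f x - of_real (Re y) * f x))\<^sup>2 + (Im y)\<^sup>2 * (l2_norm A w f)\<^sup>2"
      unfolding expand by (simp add: cmod_power2 algebra_simps)
    then show ?thesis by simp
  qed
  from this[of _ z] this[of _ "cnj z"] show ?thesis
    using assms by (intro resolvent_setI[OF gram_operator, of "(Im z)\<^sup>2"])
      (auto simp: inner_gram_left inner_gram_right)
qed

text \<open>
  Testing \<open>(T\<^sup>*T - \<mu>)(p + n)\<close> against \<open>p - n\<close>, the mixed terms are purely imaginary, so that the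
  real part is at least \<open>c (\<parallel>p\<parallel>\<^sup>2 + \<parallel>n\<parallel>\<^sup>2)\<close>.
\<close>

lemma gram_gap_resolvent:
  assumes "0 < c"
    and split: "\<And>f. f \<in> l2 A w \<Longrightarrow> \<exists>p\<in>l2 A w. \<exists>n\<in>l2 A w. f = (\<lambda>x. p x + n x) \<and>
      (\<mu> + c) * (l2_norm A w p)\<^sup>2 \<le> (l2_norm B u (T p))\<^sup>2 \<and>
      (l2_norm B u (T n))\<^sup>2 \<le> (\<mu> - c) * (l2_norm A w n)\<^sup>2"
  shows "complex_of_real \<mu> \<in> l2_resolvent_set A w (\<lambda>f. gram f)"
proof -
  have "c\<^sup>2 / 4 * (l2_norm A w f)\<^sup>2 \<le> (l2_norm A w (\<lambda>x. gram f x - of_real \<mu> * f x))\<^sup>2"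
    if f: "f \<in> l2 A w" for f
  proof -
    obtain p n where pn: "p \<in> l2 A w" "n \<in> l2 A w" "f = (\<lambda>x. p x + n x)"
      and p: "(\<mu> + c) * (l2_norm A w p)\<^sup>2 \<le> (l2_norm B u (T p))\<^sup>2"
      and n: "(l2_norm B u (T n))\<^sup>2 \<le> (\<mu> - c) * (l2_norm A w n)\<^sup>2"
      using split[OF f] by blast
    define a where "a = (\<lambda>x. gram f x - of_real \<mu> * f x)"
    define s where "s = (l2_norm A w p)\<^sup>2 + (l2_norm A w n)\<^sup>2"
    have a: "a \<in> l2 A w" unfolding a_def using f by (intro dom.l2_diff gram_in dom.l2_scale)
    have j: "(\<lambda>x. p x - n x) \<in> l2 A w" using pn by auto
    have T: "T p \<in> l2 B u" "T n \<in> l2 B u" using maps pn by auto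
    have Tf: "T f = (\<lambda>x. T p x + T n x)" "T (\<lambda>x. p x - n x) = (\<lambda>x. T p x - T n x)"
      using pn by (simp_all add: op_add op_diff)
    have "Re (l2_inner A w a (\<lambda>x. p x - n x))
        = Re (l2_inner B u (T f) (T (\<lambda>x. p x - n x))) - \<mu> * Re (l2_inner A w f (\<lambda>x. p x - n x))"
      unfolding a_def using f j gram_in[OF f]
      by (simp add: dom.inner_diff_left dom.l2_scale dom.inner_scale_left inner_gram_left)
    also have "Re (l2_inner B u (T f) (T (\<lambda>x. p x - n x)))
        = (l2_norm B u (T p))\<^sup>2 - (l2_norm B u (T n))\<^sup>2"
      unfolding Tf using T
      by (simp add: cod.inner_simps cod.norm_sq_inner cod.Re_inner_commute[of "T n" "T p"])
    also have "Re (l2_inner A w f (\<lambda>x. p x - n x)) = (l2_norm A w p)\<^sup>2 - (l2_norm A w n)\<^sup>2"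
      unfolding pn(3) using pn(1,2)
      by (simp add: dom.inner_simps dom.norm_sq_inner dom.Re_inner_commute[of n p])
    finally have "2 * (c * s) \<le> 2 * Re (l2_inner A w a (\<lambda>x. p x - n x))"
      using p n by (simp add: s_def algebra_simps)
    \<comment> \<open>With parameter \<open>2 / c\<close> the last term is at most
      \<open>c * s\<close>, half of the left-hand side, which leaves
      \<open>c^2 s \<le> 2 |a|^2\<close>. Since the squared norm of \<open>f\<close> is at most
      \<open>2 * s\<close>, the final constant is \<open>c^2 / 4\<close>.\<close>
    also have "\<dots> \<le> 2 / c * (l2_norm A w a)\<^sup>2 + (l2_norm A w (\<lambda>x. p x - n x))\<^sup>2 / (2 / c)"
      using \<open>0 < c\<close> a j by (intro dom.Re_inner_le) auto
    also have "(l2_norm A w (\<lambda>x. p x - n x))\<^sup>2 \<le> 2 * s"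
      using dom.norm_sq_add_le[OF pn(1) dom.l2_uminus[OF pn(2)]] dom.norm_scale[of "-1" n]
      by (simp add: s_def)
    finally have 1: "c\<^sup>2 * s \<le> 2 * (l2_norm A w a)\<^sup>2"
      using \<open>0 < c\<close> by (simp add: field_simps power2_eq_square)
    have "c\<^sup>2 * (l2_norm A w f)\<^sup>2 \<le> c\<^sup>2 * (2 * s)"
      using dom.norm_sq_add_le[OF pn(1,2)] unfolding pn(3) s_def by (intro mult_left_mono) auto
    with 1 show ?thesis unfolding a_def by simp
  qed
  with \<open>0 < c\<close> show ?thesis
    by (intro resolvent_setI[OF gram_operator, of "c\<^sup>2 / 4"])
      (auto simp: inner_gram_left inner_gram_right)
qed

end

section \<open>Symmetric operators in finite dimension\<close>

lemma (in vector_space) independent_Un_disjoint_spans: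
  assumes "independent S" "independent T" "span S \<inter> span T \<subseteq> {0}"
  shows "independent (S \<union> T)"
proof -
  have half: "a \<notin> span (S \<union> T - {a})"
    if "independent S" "span S \<inter> span T \<subseteq> {0}" "a \<in> S" for S T a
  proof
    assume "a \<in> span (S \<union> T - {a})"
    then have "a \<in> span ((S - {a}) \<union> T)"
      using span_mono[of "S \<union> T - {a}" "(S - {a}) \<union> T"] by blast
    then obtain x y where xy: "a = x + y" "x \<in> span (S - {a})" "y \<in> span T"
      unfolding span_Un by blast
    have "x \<in> span S" using xy span_mono[of "S - {a}" S] by blast
    then have "a - x \<in> span S" using that(3) by (auto intro: span_diff span_base)
    then have "y = 0" using xy that(2) by auto
    then show False using xy that(1,3) by (auto simp: dependent_def)
  qed
  have "a \<notin> span (S \<union> T - {a})" if "a \<in> S \<union> T" for a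
    using that half[of S T a] half[of T S a] assms by (auto simp: Int_commute Un_commute)
  then show ?thesis by (auto simp: dependent_def)
qed

text \<open>The scaling is written exactly as in \<open>multiplicity_eigenvalue\<close>, so that the
  dimension there is \<open>fun_vs.dim\<close>. All functions form one ambient space, in which
  spectral subspaces of operators on different carriers can be intersected.\<close>

interpretation fun_vs: vector_space "\<lambda>(c::complex) (f::'a \<Rightarrow> complex) x. c * f x"
  by unfold_locales (auto simp: fun_eq_iff algebra_simps)

lemma sum_fun_apply: "(\<Sum>i\<in>I. f i) x = (\<Sum>i\<in>I. f i x)"
  for f :: "'i \<Rightarrow> 'a \<Rightarrow> 'b::comm_monoid_add"
  by (induction I rule: infinite_finite_induct) auto

lemma fun_subspaceI:
  assumes "(\<lambda>x. 0) \<in> S" "\<And>f g. f \<in> S \<Longrightarrow> g \<in> S \<Longrightarrow> (\<lambda>x. f x + g x) \<in> S"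
    "\<And>c f. f \<in> S \<Longrightarrow> (\<lambda>x. c * f x) \<in> S"
  shows "fun_vs.subspace S"
  using assms by (auto simp: fun_vs.subspace_def zero_fun_def plus_fun_def)

lemma
  assumes "fun_vs.subspace S"
  shows fun_subspace_zero: "(\<lambda>x. 0) \<in> S"
    and fun_subspace_add: "f \<in> S \<Longrightarrow> g \<in> S \<Longrightarrow> (\<lambda>x. f x + g x) \<in> S"
    and fun_subspace_diff: "f \<in> S \<Longrightarrow> g \<in> S \<Longrightarrow> (\<lambda>x. f x - g x) \<in> S"
    and fun_subspace_scale: "f \<in> S \<Longrightarrow> (\<lambda>x. c * f x) \<in> S"
  using fun_vs.subspace_0[OF assms] fun_vs.subspace_add[OF assms] fun_vs.subspace_diff[OF assms]
    fun_vs.subspace_scale[OF assms]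
  by (simp_all add: zero_fun_def plus_fun_def fun_diff_def)

lemma fun_subspace_sum:
  assumes "fun_vs.subspace S" "\<And>i. i \<in> I \<Longrightarrow> f i \<in> S"
  shows "(\<lambda>x. \<Sum>i\<in>I. c i * f i x) \<in> S"
  using assms(2)
proof (induction I rule: infinite_finite_induct)
  case (insert i I)
  then show ?case
    using fun_subspace_add[OF assms(1) fun_subspace_scale[OF assms(1)]] by simp
qed (auto intro: fun_subspace_zero[OF assms(1)])

lemma fun_span_induct [consumes 1, case_names base zero add scale]:
  assumes "f \<in> fun_vs.span S" "\<And>f. f \<in> S \<Longrightarrow> P f" "P (\<lambda>x. 0)"
    "\<And>f g. P f \<Longrightarrow> P g \<Longrightarrow> P (\<lambda>x. f x + g x)" "\<And>c f. P f \<Longrightarrow> P (\<lambda>x. c * f x)"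
  shows "P f"
  using fun_vs.span_minimal[of S "Collect P"] fun_subspaceI[of "Collect P"] assms by auto

lemma (in l2_space) subspace_l2: "fun_vs.subspace H"
  by (rule fun_subspaceI) auto

definition point_mass :: "'a \<Rightarrow> 'a \<Rightarrow> complex" where
  "point_mass y = (\<lambda>x. if x = y then 1 else 0)"

lemma (in l2_space) l2_finite_decomp:
  assumes "finite A" "f \<in> H"
  shows "f = (\<lambda>x. \<Sum>y\<in>A. f y * point_mass y x)"
proof
  fix x
  show "f x = (\<Sum>y\<in>A. f y * point_mass y x)"
    using assms l2_outside[of f x]
    by (cases "x \<in> A") (auto simp: point_mass_def if_distrib[of "(*) _"] sum.delta cong: if_cong)
qed

lemma (in l2_space) l2_subset_span_point_masses:
  assumes "finite A"
  shows "H \<subseteq> fun_vs.span (point_mass ` A)"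
proof
  fix f assume "f \<in> H"
  then have "f = (\<Sum>y\<in>A. (\<lambda>x. f y * point_mass y x))"
    using l2_finite_decomp[OF assms] by (simp add: sum_fun_apply fun_eq_iff)
  also have "\<dots> \<in> fun_vs.span (point_mass ` A)"
    by (intro fun_vs.span_sum fun_vs.span_scale fun_vs.span_base imageI)
  finally show "f \<in> fun_vs.span (point_mass ` A)" .
qed

lemma inj_point_mass: "inj point_mass"
  by (auto simp: inj_def point_mass_def fun_eq_iff split: if_splits)

lemma independent_point_masses: "fun_vs.independent (point_mass ` A)"
proof -
  have "point_mass y \<notin> fun_vs.span (point_mass ` A - {point_mass y})" for y
  proof
    assume "point_mass y \<in> fun_vs.span (point_mass ` A - {point_mass y})"
    then have "point_mass y y = 0"
      by (induction rule: fun_span_induct[where P = "\<lambda>f. f y = 0"])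
        (auto simp: point_mass_def)
    then show False by (simp add: point_mass_def)
  qed
  then show ?thesis by (auto simp: fun_vs.dependent_def)
qed

lemma (in l2_space) independent_card_le:
  assumes "finite A" "fun_vs.independent S" "S \<subseteq> H"
  shows "finite S \<and> card S \<le> card A"
proof -
  have "finite S \<and> card S \<le> card (point_mass ` A)"
    using assms l2_subset_span_point_masses[OF assms(1)]
    by (intro fun_vs.independent_span_bound) auto
  then show ?thesis using card_image_le[OF assms(1), of point_mass] by linarith
qed

lemma (in l2_space) independent_card_spanning:
  assumes "finite A" "fun_vs.independent S" "S \<subseteq> H" "card A \<le> card S"
  shows "H \<subseteq> fun_vs.span S"
proof -
  obtain B where B: "S \<subseteq> B" "B \<subseteq> H" "fun_vs.independent B" "H \<subseteq> fun_vs.span B"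
    using fun_vs.maximal_independent_subset_extend[OF assms(3,2)] by blast
  then have "finite B" "card B \<le> card S"
    using independent_card_le[OF assms(1) B(3,2)] assms by auto
  then have "S = B" using B(1) card_seteq by blast
  with B show ?thesis by simp
qed

lemma (in l2_space) spanning_card_ge:
  assumes "finite A" "finite S" "H \<subseteq> fun_vs.span S"
  shows "card A \<le> card S"
proof -
  have "point_mass ` A \<subseteq> H" using assms(1) by (auto simp: l2_finite point_mass_def)
  then have "card (point_mass ` A) \<le> card S"
    using assms fun_vs.independent_span_bound[OF assms(2) independent_point_masses] by blast
  then show ?thesis by (simp add: card_image inj_on_subset[OF inj_point_mass])
qed

section \<open>Diagonalisation of symmetric operators\<close>

locale symmetric_operator = l2_space A w
  for A :: "'a set" and w +
  fixes T :: "('a \<Rightarrow> complex) \<Rightarrow> ('a \<Rightarrow> complex)"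
  assumes finite_carrier: "finite A"
    and maps: "f \<in> H \<Longrightarrow> T f \<in> H"
    and lincomb: "f \<in> H \<Longrightarrow> g \<in> H \<Longrightarrow>
      T (\<lambda>x. a * f x + b * g x) = (\<lambda>x. a * T f x + b * T g x)"
    and symmetric: "f \<in> H \<Longrightarrow> g \<in> H \<Longrightarrow> inn (T f) g = inn f (T g)"
begin

abbreviation "E r \<equiv> eigenspace A w T r"
abbreviation "eigenvalues \<equiv> {r. \<exists>f\<in>E r. f \<noteq> (\<lambda>x. 0)}"

lemma op_add: "f \<in> H \<Longrightarrow> g \<in> H \<Longrightarrow> T (\<lambda>x. f x + g x) = (\<lambda>x. T f x + T g x)"
  using lincomb[of f g 1 1] by simp

lemma op_scale: "f \<in> H \<Longrightarrow> T (\<lambda>x. a * f x) = (\<lambda>x. a * T f x)"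
  using lincomb[of f f a 0] by simp

lemma op_diff: "f \<in> H \<Longrightarrow> g \<in> H \<Longrightarrow> T (\<lambda>x. f x - g x) = (\<lambda>x. T f x - T g x)"
  using lincomb[of f g 1 "-1"] by simp

lemma op_zero: "T (\<lambda>x. 0) = (\<lambda>x. 0)"
  using op_scale[of "\<lambda>x. 0" 0] by simp

lemma eigenspace_subset: "E r \<subseteq> H"
  by (auto simp: eigenspace_def)

lemma eigenspace_op: "f \<in> E r \<Longrightarrow> T f = (\<lambda>x. complex_of_real r * f x)"
  by (simp add: eigenspace_def)

lemma subspace_eigenspace: "fun_vs.subspace (E r)"
  by (rule fun_subspaceI)
    (auto simp: eigenspace_def op_add op_scale op_zero fun_eq_iff algebra_simps)

lemma span_eigenspaces_subset: "fun_vs.span (\<Union>r\<in>R. E r) \<subseteq> H"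
  using eigenspace_subset by (intro fun_vs.span_minimal subspace_l2) blast

lemma eigenspaces_orthogonal:
  assumes "f \<in> E r" "g \<in> E s" "r \<noteq> s"
  shows "inn f g = 0"
proof -
  have "inn (T f) g = inn f (T g)" using assms eigenspace_subset by (intro symmetric) auto
  then have "r * inn f g = s * inn f g"
    by (simp add: eigenspace_op[OF assms(1)] eigenspace_op[OF assms(2)]
        inner_scale_left inner_scale_right)
  with \<open>r \<noteq> s\<close> show ?thesis by simp
qed

lemma span_orthogonal:
  assumes "f \<in> fun_vs.span (\<Union>r\<in>R. E r)" "g \<in> E s" "s \<notin> R"
  shows "inn f g = 0"
proof -
  have g: "g \<in> H" using assms eigenspace_subset by blast
  from assms(1) have "f \<in> H \<and> inn f g = 0"
  proof (induction rule: fun_span_induct)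
    case (base f)
    then show ?case using eigenspaces_orthogonal[OF _ assms(2)] assms(3) eigenspace_subset by blast
  qed (use g in \<open>auto simp: inner_simps\<close>)
  then show ?thesis by blast
qed

lemma eigenvalue_real:
  assumes "f \<in> H" "T f = (\<lambda>x. z * f x)" "f \<noteq> (\<lambda>x. 0)"
  shows "z = complex_of_real (Re z)"
proof -
  have "z * inn f f = cnj z * inn f f"
    using symmetric[OF assms(1,1)] by (simp add: assms(2) inner_scale_left inner_scale_right)
  moreover have "inn f f \<noteq> 0" using norm_eq_0[OF assms(1)] assms(3) by (auto simp: inner_self)
  ultimately have "z = cnj z" by simp
  then show ?thesis by (simp add: complex_eq_iff)
qed

lemma eigenfunction_in_span:
  assumes "f \<in> H" "T f = (\<lambda>x. z * f x)"
  shows "f \<in> fun_vs.span (\<Union>r. E r)"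
proof (cases "f = (\<lambda>x. 0)")
  case True
  then show ?thesis using fun_subspace_zero[OF fun_vs.subspace_span] by blast
next
  case False
  then have "f \<in> E (Re z)" using eigenvalue_real[OF assms] assms by (auto simp: eigenspace_def)
  then show ?thesis by (intro fun_vs.span_base) blast
qed

text \<open>\<open>v\<close> lies both in the range and in the kernel of \<open>T - z\<close>, which
  are orthogonal for real \<open>z\<close>; and \<open>z\<close> is real as soon as the
  eigenfunction \<open>v\<close> is nonzero.\<close>

lemma kernel_shift_square:
  assumes u: "u \<in> H" and v: "v = (\<lambda>x. T u x - z * u x)" and Tv: "T v = (\<lambda>x. z * v x)"
  shows "v = (\<lambda>x. 0)"
proof (rule ccontr)
  assume nz: "v \<noteq> (\<lambda>x. 0)"
  have vH: "v \<in> H" unfolding v by (intro l2_diff maps l2_scale u)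
  have z: "cnj z = z" using eigenvalue_real[OF vH Tv nz] by (metis complex_cnj_complex_of_real)
  have "inn v v = inn v (T u) - z * inn v u"
    using u vH maps[OF u] z by (subst (2) v) (simp add: inner_simps)
  also have "inn v (T u) = z * inn v u"
    using symmetric[OF vH u] by (simp add: Tv inner_scale_left)
  finally have "nrm v = 0" by (simp add: inner_self)
  with nz norm_eq_0[OF vH] show False by blast
qed

text \<open>
  Modulo the kernel of \<open>T - z\<close>, an element \<open>(T - z) f\<close> of the span of the eigenspaces is \<open>(T - z) f'\<close>
  with \<open>f'\<close> in the span; then \<open>f - f'\<close> is killed by \<open>(T - z)\<^sup>2\<close>, hence by \<open>T - z\<close>.
\<close>

lemma shift_in_span:
  assumes f: "f \<in> H" and g: "(\<lambda>x. T f x - z * f x) \<in> fun_vs.span (\<Union>r. E r)"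
  shows "f \<in> fun_vs.span (\<Union>r. E r)"
proof -
  let ?S = "fun_vs.span (\<Union>r. E r)"
  define D where "D = (\<lambda>u x. T u x - z * u x)"
  have SH: "?S \<subseteq> H" by (rule span_eigenspaces_subset)
  have DH: "D u \<in> H" if "u \<in> H" for u unfolding D_def by (intro l2_diff maps l2_scale that)
  have D_add: "D (\<lambda>x. u x + v x) = (\<lambda>x. D u x + D v x)" if "u \<in> H" "v \<in> H" for u v
    using that by (simp add: D_def op_add algebra_simps)
  have D_diff: "D (\<lambda>x. u x - v x) = (\<lambda>x. D u x - D v x)" if "u \<in> H" "v \<in> H" for u v
    using that by (simp add: D_def op_diff algebra_simps)
  have D_scale: "D (\<lambda>x. a * u x) = (\<lambda>x. a * D u x)" if "u \<in> H" for u a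
    using that by (simp add: D_def op_scale algebra_simps)
  have D_kernel: "T u = (\<lambda>x. z * u x)" if "D u = (\<lambda>x. 0)" for u
    using that by (simp add: D_def fun_eq_iff)
  have D_zero: "D (\<lambda>x. 0) = (\<lambda>x. 0)" by (simp add: D_def op_zero)
  \<comment> \<open>A nonzero eigenfunction at \<open>z\<close> is not in the range of
    \<open>D\<close>, so \<open>D f' = h\<close> is asked for only modulo the kernel of
    \<open>D\<close>. Then \<open>f' = 0\<close> serves these eigenfunctions, and the others are
    divided by \<open>r - z\<close>.\<close>
  have "h \<in> H \<and> (\<exists>f'\<in>?S. D (\<lambda>x. D f' x - h x) = (\<lambda>x. 0))" if "h \<in> ?S" for h
    using that
  proof (induction rule: fun_span_induct)
    case (base h)
    then obtain r where h: "h \<in> E r" by blast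
    have hH: "h \<in> H" using h eigenspace_subset by blast
    have Dh: "D h = (\<lambda>x. (of_real r - z) * h x)"
      by (simp add: D_def eigenspace_op[OF h] algebra_simps)
    show ?case
    proof (cases "of_real r = z")
      case True
      then have "D (\<lambda>x. D (\<lambda>x. 0) x - h x) = (\<lambda>x. 0)"
        using D_scale[OF hH, of "-1"] by (simp add: D_zero Dh)
      then show ?thesis using hH fun_subspace_zero[OF fun_vs.subspace_span] by blast
    next
      case False
      have "D (\<lambda>x. 1 / (of_real r - z) * h x) = h"
        unfolding D_scale[OF hH] Dh using False by (simp add: fun_eq_iff)
      then have "D (\<lambda>x. D (\<lambda>x. 1 / (of_real r - z) * h x) x - h x) = (\<lambda>x. 0)"
        by (simp add: D_zero)
      moreover have "(\<lambda>x. 1 / (of_real r - z) * h x) \<in> ?S"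
        using h by (intro fun_vs.span_scale fun_vs.span_base) blast
      ultimately show ?thesis using hH by blast
    qed
  next
    case zero
    have "D (\<lambda>x. D (\<lambda>x. 0) x - 0) = (\<lambda>x. 0)" by (simp add: D_zero)
    then show ?case using fun_subspace_zero[OF fun_vs.subspace_span] l2_zero by blast
  next
    case (add h k)
    then obtain h' k' where hk: "h' \<in> ?S" "k' \<in> ?S" "h \<in> H" "k \<in> H"
      "D (\<lambda>x. D h' x - h x) = (\<lambda>x. 0)" "D (\<lambda>x. D k' x - k x) = (\<lambda>x. 0)" by blast
    have "D (\<lambda>x. D (\<lambda>x. h' x + k' x) x - (h x + k x))
        = D (\<lambda>x. (D h' x - h x) + (D k' x - k x))"
      using hk SH by (subst D_add[of h' k']) (auto simp: algebra_simps)
    also have "\<dots> = (\<lambda>x. 0)"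
      using hk SH by (subst D_add) (auto intro!: l2_diff DH)
    finally show ?case
      using fun_subspace_add[OF fun_vs.subspace_span hk(1,2)] l2_add[OF hk(3,4)] by blast
  next
    case (scale c h)
    then obtain h' where h: "h' \<in> ?S" "h \<in> H" "D (\<lambda>x. D h' x - h x) = (\<lambda>x. 0)" by blast
    have "D (\<lambda>x. D (\<lambda>x. c * h' x) x - c * h x) = D (\<lambda>x. c * (D h' x - h x))"
      using h SH by (subst D_scale[of h']) (auto simp: algebra_simps)
    also have "\<dots> = (\<lambda>x. 0)"
      using h SH by (subst D_scale) (auto intro!: l2_diff DH)
    finally show ?case
      using fun_subspace_scale[OF fun_vs.subspace_span h(1)] l2_scale[OF h(2)] by blast
  qed
  from this[OF g] obtain f' where f': "f' \<in> ?S" "D (\<lambda>x. D f' x - D f x) = (\<lambda>x. 0)"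
    by (auto simp: D_def)
  have f'H: "f' \<in> H" using f' SH by blast
  define u where "u = (\<lambda>x. f' x - f x)"
  have u: "u \<in> H" unfolding u_def by (intro l2_diff f f'H)
  have "D (D u) = (\<lambda>x. 0)" using f'(2) by (simp add: u_def D_diff f f'H)
  then have "T (D u) = (\<lambda>x. z * D u x)" by (rule D_kernel)
  then have "D u = (\<lambda>x. 0)" using kernel_shift_square[OF u] by (simp add: D_def)
  then have "T u = (\<lambda>x. z * u x)" by (rule D_kernel)
  then have "u \<in> ?S" using eigenfunction_in_span[OF u] by blast
  then have "(\<lambda>x. f' x - u x) \<in> ?S" using fun_subspace_diff[OF fun_vs.subspace_span f'(1)] by blast
  then show ?thesis by (simp add: u_def)
qed

lemma pow_maps: "f \<in> H \<Longrightarrow> (T ^^ i) f \<in> H"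
  by (induction i) (auto simp: maps)

lemma pow_shift:
  assumes "f \<in> H"
  shows "(T ^^ i) (\<lambda>x. T f x - z * f x) = (\<lambda>x. (T ^^ Suc i) f x - z * (T ^^ i) f x)"
proof (induction i)
  case (Suc i)
  have "(T ^^ Suc i) (\<lambda>x. T f x - z * f x) = T (\<lambda>x. (T ^^ Suc i) f x - z * (T ^^ i) f x)"
    using Suc by simp
  also have "\<dots> = (\<lambda>x. T ((T ^^ Suc i) f) x - z * T ((T ^^ i) f) x)"
    using pow_maps[OF assms, of i] pow_maps[OF assms, of "Suc i"]
    by (simp only: op_diff op_scale l2_scale)
  finally show ?case by simp
qed simp

text \<open>A root \<open>z\<close> splits \<open>p\<close> as \<open>(X - z) q\<close>; then
  \<open>q\<close> annihilates \<open>(T - z) f\<close>, and \<open>shift_in_span\<close> takes the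
  factor off again. Summing up to a bound \<open>n\<close> on the degree, padded by zero
  coefficients, gives the induction a plain natural number to lower.\<close>

lemma annihilated_in_span:
  "p \<noteq> 0 \<Longrightarrow> degree p \<le> n \<Longrightarrow> f \<in> H \<Longrightarrow>
    (\<And>x. (\<Sum>i\<le>n. coeff p i * (T ^^ i) f x) = 0) \<Longrightarrow> f \<in> fun_vs.span (\<Union>r. E r)"
proof (induction n arbitrary: p f)
  case 0
  then have "coeff p 0 \<noteq> 0" by (metis le_zero_eq leading_coeff_0_iff)
  with 0 have "f = (\<lambda>x. 0)" by (auto simp: fun_eq_iff)
  then show ?case using fun_subspace_zero[OF fun_vs.subspace_span] by simp
next
  case (Suc n)
  show ?case
  proof (cases "degree p = 0")
    case True
    then have "coeff p 0 \<noteq> 0" using Suc.prems(1) leading_coeff_0_iff by metis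
    moreover have "(\<Sum>i\<le>Suc n. coeff p i * (T ^^ i) f x) = coeff p 0 * f x" for x
      using True by (subst sum.mono_neutral_right[of _ "{0}"]) (auto simp: coeff_eq_0)
    ultimately have "f = (\<lambda>x. 0)" using Suc.prems(4) by (auto simp: fun_eq_iff)
    then show ?thesis using fun_subspace_zero[OF fun_vs.subspace_span] by simp
  next
    case False
    then obtain z where "poly p z = 0"
      using fundamental_theorem_of_algebra[of p] by (auto simp: constant_degree)
    then obtain q where p: "p = [:- z, 1:] * q" by (auto simp: poly_eq_0_iff_dvd dvd_def)
    have q: "q \<noteq> 0" using p Suc.prems(1) by auto
    have "degree p = Suc (degree q)" 
      unfolding p by (subst degree_mult_eq) (use q in auto)
    with Suc.prems have deg: "degree q \<le> n" by simp
    let ?g = "\<lambda>x. T f x - z * f x"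
    have "(\<Sum>i\<le>n. coeff q i * (T ^^ i) ?g x) = 0" for x
    proof -
      have c: "coeff p i = (case i of 0 \<Rightarrow> 0 | Suc j \<Rightarrow> coeff q j) - z * coeff q i" for i
        unfolding p by (simp add: coeff_pCons split: nat.split)
      have "0 = (\<Sum>i\<le>Suc n. (case i of 0 \<Rightarrow> 0 | Suc j \<Rightarrow> coeff q j) * (T ^^ i) f x)
          - (\<Sum>i\<le>Suc n. z * coeff q i * (T ^^ i) f x)"
        using Suc.prems(4)[of x] by (simp only: c left_diff_distrib sum_subtractf)
      also have "(\<Sum>i\<le>Suc n. (case i of 0 \<Rightarrow> 0 | Suc j \<Rightarrow> coeff q j) * (T ^^ i) f x)
          = (\<Sum>i\<le>n. coeff q i * (T ^^ Suc i) f x)"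
        by (subst sum.atMost_Suc_shift) simp
      also have "(\<Sum>i\<le>Suc n. z * coeff q i * (T ^^ i) f x)
          = (\<Sum>i\<le>n. z * coeff q i * (T ^^ i) f x)"
        using deg by (simp add: coeff_eq_0)
      finally show ?thesis
        unfolding pow_shift[OF Suc.prems(3)]
        by (simp add: right_diff_distrib sum_subtractf mult_ac)
    qed
    then have "?g \<in> fun_vs.span (\<Union>r. E r)"
      by (intro Suc.IH[OF q deg] l2_diff maps l2_scale Suc.prems(3))
    then show ?thesis by (rule shift_in_span[OF Suc.prems(3)])
  qed
qed

text \<open>The iterates \<open>f\<close>, \<open>T f\<close>, ... up to exponent
  \<open>card A\<close> are one too many to be independent, so a nonzero polynomial in
  \<open>T\<close> kills \<open>f\<close>.\<close>

theorem l2_subset_span_eigenspaces: "H \<subseteq> fun_vs.span (\<Union>r. E r)"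
proof
  fix f assume f: "f \<in> H"
  let ?v = "\<lambda>i. (T ^^ i) f" and ?N = "card A"
  have "\<exists>p. p \<noteq> 0 \<and> degree p \<le> ?N \<and> (\<forall>x. (\<Sum>i\<le>?N. coeff p i * ?v i x) = 0)"
  proof (cases "inj_on ?v {..?N}")
    \<comment> \<open>Independence speaks of the set of iterates, which is smaller than the index
      range when two of them coincide. A coincidence yields the polynomial directly.\<close>
    case False
    then obtain i j where ij: "i \<le> ?N" "j \<le> ?N" "i \<noteq> j" "?v i = ?v j" by (auto simp: inj_on_def)
    let ?p = "monom (1::complex) i - monom 1 j"
    have "coeff ?p i = 1" using ij by simp
    then have "?p \<noteq> 0" by (metis coeff_0 zero_neq_one)
    moreover have "degree ?p \<le> ?N"
      using ij by (intro degree_diff_le) (auto simp: degree_monom_eq)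
    moreover have "(\<Sum>k\<le>?N. coeff ?p k * ?v k x) = 0" for x
      using ij by (simp add: left_diff_distrib sum_subtractf if_distrib[of "\<lambda>a. a * _"]
          sum.delta' cong: if_cong)
    ultimately show ?thesis by blast
  next
    case True
    have "\<not> fun_vs.independent (?v ` {..?N})"
    proof
      assume "fun_vs.independent (?v ` {..?N})"
      then have "card (?v ` {..?N}) \<le> ?N"
        using independent_card_le[OF finite_carrier] pow_maps[OF f] by blast
      then show False using card_image[OF True] by simp
    qed
    then obtain c where c: "\<exists>g\<in>?v ` {..?N}. c g \<noteq> 0"
      "(\<Sum>g\<in>?v ` {..?N}. (\<lambda>x. c g * g x)) = 0"
      using fun_vs.dependent_finite[of "?v ` {..?N}"] by auto
    let ?p = "\<Sum>i\<le>?N. monom (c (?v i)) i"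
    have coeff: "coeff ?p k = (if k \<le> ?N then c (?v k) else 0)" for k
      by (simp add: coeff_sum sum.delta)
    obtain i where "i \<le> ?N" "c (?v i) \<noteq> 0" using c(1) by auto
    then have "?p \<noteq> 0" using coeff[of i] by (metis coeff_0)
    moreover have "degree ?p \<le> ?N" using coeff by (intro degree_le) auto
    moreover have "(\<Sum>k\<le>?N. coeff ?p k * ?v k x) = 0" for x
    proof -
      have "(\<Sum>k\<le>?N. coeff ?p k * ?v k x) = (\<Sum>k\<le>?N. c (?v k) * ?v k x)"
        by (intro sum.cong refl) (simp add: coeff)
      also have "\<dots> = (\<Sum>g\<in>?v ` {..?N}. c g * g x)"
        by (simp add: sum.reindex[OF True])
      also have "\<dots> = 0" using fun_cong[OF c(2), of x] by (simp add: sum_fun_apply)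
      finally show ?thesis .
    qed
    ultimately show ?thesis by blast
  qed
  then show "f \<in> fun_vs.span (\<Union>r. E r)" using annihilated_in_span[OF _ _ f] by blast
qed

end

section \<open>Eigenbases and the list of eigenvalues\<close>

context symmetric_operator
begin

definition eigenbasis :: "real \<Rightarrow> ('a \<Rightarrow> complex) set" where
  "eigenbasis r = (SOME B. B \<subseteq> E r \<and> fun_vs.independent B \<and> E r \<subseteq> fun_vs.span B \<and>
     card B = multiplicity_eigenvalue A w T r)"

lemma eigenbasis:
  shows eigenbasis_subset: "eigenbasis r \<subseteq> E r"
    and independent_eigenbasis: "fun_vs.independent (eigenbasis r)"
    and eigenspace_subset_span: "E r \<subseteq> fun_vs.span (eigenbasis r)"
    and card_eigenbasis: "card (eigenbasis r) = multiplicity_eigenvalue A w T r"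
proof -
  have "\<exists>B. B \<subseteq> E r \<and> fun_vs.independent B \<and> E r \<subseteq> fun_vs.span B \<and>
     card B = multiplicity_eigenvalue A w T r"
    unfolding multiplicity_eigenvalue_def using fun_vs.basis_exists[of "E r"] by metis
  from someI_ex[OF this, folded eigenbasis_def]
  show "eigenbasis r \<subseteq> E r" "fun_vs.independent (eigenbasis r)"
    "E r \<subseteq> fun_vs.span (eigenbasis r)" "card (eigenbasis r) = multiplicity_eigenvalue A w T r"
    by auto
qed

lemma span_eigenbases: "fun_vs.span (\<Union>r\<in>R. eigenbasis r) = fun_vs.span (\<Union>r\<in>R. E r)"
proof (rule antisym)
  show "fun_vs.span (\<Union>r\<in>R. eigenbasis r) \<subseteq> fun_vs.span (\<Union>r\<in>R. E r)"
    using eigenbasis_subset by (intro fun_vs.span_mono) blast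
  have "E r \<subseteq> fun_vs.span (\<Union>r\<in>R. eigenbasis r)" if "r \<in> R" for r
    using eigenspace_subset_span[of r] fun_vs.span_mono[of "eigenbasis r" "\<Union>r\<in>R. eigenbasis r"] that
    by blast
  then show "fun_vs.span (\<Union>r\<in>R. E r) \<subseteq> fun_vs.span (\<Union>r\<in>R. eigenbasis r)"
    by (intro fun_vs.span_minimal) auto
qed

text \<open>Eigenspaces at different values are orthogonal, so their spans meet trivially and the
  bases unite without loss. This is how multiplicities become dimensions.\<close>

lemma eigenbases:
  assumes "finite R"
  shows "fun_vs.independent (\<Union>r\<in>R. eigenbasis r) \<and> finite (\<Union>r\<in>R. eigenbasis r) \<and>
    card (\<Union>r\<in>R. eigenbasis r) = (\<Sum>r\<in>R. multiplicity_eigenvalue A w T r)"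
  using assms
proof (induction R rule: finite_induct)
  case (insert s R)
  let ?U = "\<Union>r\<in>R. eigenbasis r"
  have trivial: "fun_vs.span (eigenbasis s) \<inter> fun_vs.span ?U \<subseteq> {0}"
  proof
    fix f assume f: "f \<in> fun_vs.span (eigenbasis s) \<inter> fun_vs.span ?U"
    then have fE: "f \<in> E s"
      using fun_vs.span_minimal[OF eigenbasis_subset subspace_eigenspace] by blast
    have "f \<in> fun_vs.span (\<Union>r\<in>R. E r)" using f span_eigenbases by blast
    then have "inn f f = 0" using fE insert.hyps by (intro span_orthogonal[where R = R and s = s])
    then show "f \<in> {0}"
      using norm_eq_0[of f] fE eigenspace_subset by (auto simp: inner_self zero_fun_def)
  qed
  have "fun_vs.independent (eigenbasis s \<union> ?U)"
    using independent_eigenbasis insert trivial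
    by (intro fun_vs.independent_Un_disjoint_spans) auto
  moreover have "finite (eigenbasis s)"
    using independent_card_le[OF finite_carrier independent_eigenbasis[of s]] eigenbasis_subset
      eigenspace_subset by blast
  moreover have "eigenbasis s \<inter> ?U = {}"
  proof -
    have "0 \<notin> eigenbasis s" using independent_eigenbasis fun_vs.dependent_zero by blast
    then show ?thesis using trivial fun_vs.span_superset[of "eigenbasis s"] fun_vs.span_superset[of ?U]
      by blast
  qed
  ultimately show ?case using insert by (simp add: card_Un_disjoint card_eigenbasis)
qed (simp add: fun_vs.independent_empty)

text \<open>\<open>sorted_list_of_set\<close> returns the empty list on infinite sets, so nothing
  can be counted in \<open>eigenvalue_list\<close> before this. Each eigenvalue adds at least one
  vector to an independent set of size at most \<open>card A\<close>.\<close>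

lemma finite_eigenvalues: "finite eigenvalues"
proof (rule ccontr)
  assume "infinite eigenvalues"
  then obtain R where R: "R \<subseteq> eigenvalues" "finite R" "card R = Suc (card A)"
    using infinite_arbitrarily_large by blast
  have "1 \<le> multiplicity_eigenvalue A w T r" if "r \<in> R" for r
  proof (rule ccontr)
    assume "\<not> 1 \<le> multiplicity_eigenvalue A w T r"
    then have "card (eigenbasis r) = 0" by (simp add: card_eigenbasis)
    then have "eigenbasis r = {}" using eigenbases[of "{r}"] by simp
    then have "E r \<subseteq> {0}" using eigenspace_subset_span[of r] by simp
    then show False using that R by (auto simp: zero_fun_def)
  qed
  then have "card R \<le> (\<Sum>r\<in>R. multiplicity_eigenvalue A w T r)"
    using sum_mono[of R "\<lambda>_. 1" "multiplicity_eigenvalue A w T"] by simp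
  also have "\<dots> \<le> card A"
    using eigenbases[OF R(2)] eigenbasis_subset eigenspace_subset
      independent_card_le[OF finite_carrier, of "\<Union>r\<in>R. eigenbasis r"] by (metis UN_least order_trans)
  finally show False using R by simp
qed

lemma span_eigenvalues: "fun_vs.span (\<Union>r\<in>eigenvalues. E r) = H"
proof (rule antisym[OF span_eigenspaces_subset])
  have "(\<Union>r. E r) \<subseteq> insert 0 (\<Union>r\<in>eigenvalues. E r)" by (auto simp: zero_fun_def)
  then have "fun_vs.span (\<Union>r. E r) \<subseteq> fun_vs.span (insert 0 (\<Union>r\<in>eigenvalues. E r))"
    by (rule fun_vs.span_mono)
  also have "\<dots> = fun_vs.span (\<Union>r\<in>eigenvalues. E r)" by (rule fun_vs.span_insert_0)
  finally have "fun_vs.span (\<Union>r. E r) \<subseteq> fun_vs.span (\<Union>r\<in>eigenvalues. E r)" .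
  with l2_subset_span_eigenspaces
  show "H \<subseteq> fun_vs.span (\<Union>r\<in>eigenvalues. E r)" by blast
qed

lemma sorted_eigenvalue_list: "sorted (eigenvalue_list A w T)"
proof -
  have "sorted (concat (map (\<lambda>r. replicate (d r) r) xs))" if "sorted xs" for xs :: "real list" and d
    using that by (induction xs) (auto simp: sorted_append)
  then show ?thesis by (simp add: eigenvalue_list_def)
qed

lemma length_filter_eigenvalue_list:
  "length (filter P (eigenvalue_list A w T))
    = (\<Sum>r\<in>{r \<in> eigenvalues. P r}. multiplicity_eigenvalue A w T r)"
proof -
  have "length (filter P (concat (map (\<lambda>r. replicate (d r) r) xs))) = (\<Sum>r\<in>{r \<in> set xs. P r}. d r)"
    if "distinct xs" for xs :: "real list" and d
    using that
  proof (induction xs)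
    case (Cons x xs)
    have "{r \<in> set (x # xs). P r} = (if P x then insert x {r \<in> set xs. P r} else {r \<in> set xs. P r})"
      by auto
    with Cons show ?case by auto
  qed simp
  from this[of "sorted_list_of_set eigenvalues"] show ?thesis
    using finite_eigenvalues by (simp add: eigenvalue_list_def)
qed

lemma length_eigenvalue_list: "length (eigenvalue_list A w T) = card A"
proof -
  let ?U = "\<Union>r\<in>eigenvalues. eigenbasis r"
  have U: "?U \<subseteq> H" using eigenbasis_subset eigenspace_subset by blast
  have "length (eigenvalue_list A w T) = card ?U"
    using length_filter_eigenvalue_list[of "\<lambda>_. True"] eigenbases[OF finite_eigenvalues] by simp
  moreover have "card ?U \<le> card A"
    using independent_card_le[OF finite_carrier _ U] eigenbases[OF finite_eigenvalues] by blast
  moreover have "card A \<le> card ?U"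
    using spanning_card_ge[OF finite_carrier, of ?U] eigenbases[OF finite_eigenvalues]
    by (simp add: span_eigenbases span_eigenvalues)
  ultimately show ?thesis by simp
qed

text \<open>The sign \<open>s\<close> yields lower and upper bounds in one induction. Splitting off
  an eigenspace leaves no mixed terms, since \<open>T h\<close> is again orthogonal to the
  eigenfunction \<open>g\<close>.\<close>

lemma form_on_span:
  assumes "finite R" "\<And>r. r \<in> R \<Longrightarrow> 0 \<le> s * (r - \<mu>)"
    and "f \<in> fun_vs.span (\<Union>r\<in>R. E r)"
  shows "0 \<le> s * (Re (inn (T f) f) - \<mu> * (nrm f)\<^sup>2)"
  using assms
proof (induction R arbitrary: f rule: finite_induct)
  case empty
  then have "f = (\<lambda>x. 0)" by (simp add: zero_fun_def)
  then show ?case by (simp add: op_zero)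
next
  case (insert r R)
  have "f \<in> fun_vs.span (E r \<union> (\<Union>r\<in>R. E r))" using insert.prems by simp
  then obtain g h where gh: "f = g + h" "g \<in> fun_vs.span (E r)" "h \<in> fun_vs.span (\<Union>r\<in>R. E r)"
    unfolding fun_vs.span_Un by blast
  then have g: "g \<in> E r"
    using subspace_eigenspace by (metis fun_vs.span_eq_iff)
  have H: "g \<in> H" "h \<in> H" using g gh eigenspace_subset span_eigenspaces_subset by auto
  have orth: "inn h g = 0" using gh(3) g insert.hyps by (intro span_orthogonal)
  then have orth': "inn g h = 0" by (subst inner_commute) simp
  have f: "f = (\<lambda>x. g x + h x)" using gh(1) by (simp add: plus_fun_def)
  have "inn (T h) g = 0"
    using symmetric[OF H(2,1)] orth by (simp add: eigenspace_op[OF g] inner_scale_right)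
  then have "inn (T f) f = r * inn g g + inn (T h) h"
    unfolding f using H maps[OF H(2)]
    by (simp add: op_add eigenspace_op[OF g] inner_simps orth orth')
  moreover have "(nrm f)\<^sup>2 = (nrm g)\<^sup>2 + (nrm h)\<^sup>2"
    unfolding f using H by (simp add: norm_sq_add orth')
  ultimately have "s * (Re (inn (T f) f) - \<mu> * (nrm f)\<^sup>2)
      = s * (r - \<mu>) * (nrm g)\<^sup>2 + s * (Re (inn (T h) h) - \<mu> * (nrm h)\<^sup>2)"
    by (simp add: inner_self algebra_simps)
  moreover have "0 \<le> s * (r - \<mu>) * (nrm g)\<^sup>2" using insert.prems by simp
  moreover have "0 \<le> s * (Re (inn (T h) h) - \<mu> * (nrm h)\<^sup>2)"
    using insert gh(3) by auto
  ultimately show ?case by linarith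
qed

end

section \<open>Counting eigenvalues on the two sides of \<mu>\<close>

lemma sorted_nth_le:
  fixes xs :: "'a::linorder list"
  assumes "sorted xs" "i < length (filter (\<lambda>x. x \<le> c) xs)"
  shows "xs ! i \<le> c"
proof (rule ccontr)
  assume i: "\<not> xs ! i \<le> c"
  have "{j. j < length xs \<and> xs ! j \<le> c} \<subseteq> {..<i}"
  proof
    fix j assume j: "j \<in> {j. j < length xs \<and> xs ! j \<le> c}"
    then have "\<not> i \<le> j" using i sorted_nth_mono[OF assms(1), of i j] by auto
    then show "j \<in> {..<i}" by simp
  qed
  then have "card {j. j < length xs \<and> xs ! j \<le> c} \<le> i"
    using card_mono[of "{..<i}"] by simp
  with assms(2) show False by (simp add: length_filter_conv_card)
qed

lemma sorted_nth_ge: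
  fixes xs :: "'a::linorder list"
  assumes "sorted xs" "length (filter (\<lambda>x. x < c) xs) \<le> i" "i < length xs"
  shows "c \<le> xs ! i"
proof (rule ccontr)
  assume i: "\<not> c \<le> xs ! i"
  have "{..i} \<subseteq> {j. j < length xs \<and> xs ! j < c}"
  proof
    fix j assume "j \<in> {..i}"
    then have "xs ! j \<le> xs ! i" using assms by (intro sorted_nth_mono) auto
    with i \<open>j \<in> {..i}\<close> assms(3) show "j \<in> {j. j < length xs \<and> xs ! j < c}" by auto
  qed
  then have "card {..i} \<le> card {j. j < length xs \<and> xs ! j < c}"
    by (intro card_mono) auto
  with assms(2) show False by (simp add: length_filter_conv_card)
qed

lemma finite_real_gap:
  fixes \<mu> :: real
  assumes "finite F"
  obtains c where "0 < c" "\<And>r. r \<in> F \<Longrightarrow> r \<noteq> \<mu> \<Longrightarrow> c \<le> \<bar>r - \<mu>\<bar>"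
proof
  \<comment> \<open>The 1 keeps the set nonempty when \<open>F\<close> has no point other than
    \<mu>.\<close>
  let ?D = "insert 1 ((\<lambda>r. \<bar>r - \<mu>\<bar>) ` (F - {\<mu>}))"
  have D: "finite ?D" using assms by simp
  show "0 < Min ?D" using D by (subst Min_gr_iff) auto
  show "Min ?D \<le> \<bar>r - \<mu>\<bar>" if "r \<in> F" "r \<noteq> \<mu>" for r using D that by (intro Min_le) auto
qed

text \<open>
  If \<open>\<mu>\<close> lies in none of the bracketing intervals, then \<open>S\<close> has at most as many eigenvalues
  \<open>\<le> \<mu>\<close> as \<open>T\<close> has eigenvalues \<open>< \<mu>\<close>; the corresponding spectral subspaces then meet trivially and
  span the whole space for dimension reasons.
\<close>

lemma bracketing_decomposition:
  assumes "symmetric_operator A w S" "symmetric_operator A' w T" and sub: "A' \<subseteq> A"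
    and outside: "\<And>k. k \<in> {1..card A} \<Longrightarrow> \<not> (nth_eigenvalue A w S k \<le> \<mu> \<and>
      \<mu> \<le> (if k \<le> card A' then nth_eigenvalue A' w T k else \<rho>))"
    and "\<mu> \<le> \<rho>"
    and le: "\<And>f. f \<in> l2 A' w \<Longrightarrow> Re (l2_inner A w (S f) f) \<le> Re (l2_inner A' w (T f) f)"
  obtains c P N where "0 < c" "fun_vs.subspace P" "fun_vs.subspace N"
    "P \<subseteq> l2 A w" "N \<subseteq> l2 A' w" "l2 A w = {\<lambda>x. p x + n x | p n. p \<in> P \<and> n \<in> N}"
    "\<And>p. p \<in> P \<Longrightarrow> (\<mu> + c) * (l2_norm A w p)\<^sup>2 \<le> Re (l2_inner A w (S p) p)"
    "\<And>n. n \<in> N \<Longrightarrow> Re (l2_inner A' w (T n) n) \<le> (\<mu> - c) * (l2_norm A' w n)\<^sup>2"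
proof -
  interpret S: symmetric_operator A w S by fact
  interpret T: symmetric_operator A' w T by fact
  have l2_sub: "l2 A' w \<subseteq> l2 A w"
    using sub by (auto simp: S.l2_finite[OF S.finite_carrier] T.l2_finite[OF T.finite_carrier]) blast
  have norm_eq: "l2_norm A w f = l2_norm A' w f" if "f \<in> l2 A' w" for f
    unfolding l2_norm_def using that sub T.l2_outside
    by (intro arg_cong[of _ _ sqrt] infsum_cong_neutral) auto
  define F where "F = S.eigenvalues \<union> T.eigenvalues"
  have "finite F" unfolding F_def using S.finite_eigenvalues T.finite_eigenvalues by simp
  then obtain c where c: "0 < c" "\<And>r. r \<in> F \<Longrightarrow> r \<noteq> \<mu> \<Longrightarrow> c \<le> \<bar>r - \<mu>\<bar>"
    using finite_real_gap[of F \<mu>] by blast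
  \<comment> \<open>Both sets leave out \<mu> itself, which secures the gap \<open>c\<close> on
    either side. That the two subspaces are still large enough together is the claim
    \<open>a \<le> b\<close> below.\<close>
  define Rp where "Rp = {r \<in> S.eigenvalues. \<not> r \<le> \<mu>}"
  define Rn where "Rn = {r \<in> T.eigenvalues. r < \<mu>}"
  have fin: "finite Rp" "finite Rn"
    using S.finite_eigenvalues T.finite_eigenvalues by (simp_all add: Rp_def Rn_def)
  define P where "P = fun_vs.span (\<Union>r\<in>Rp. S.E r)"
  define N where "N = fun_vs.span (\<Union>r\<in>Rn. T.E r)"
  have P: "P \<subseteq> l2 A w" and N: "N \<subseteq> l2 A' w"
    unfolding P_def N_def by (rule S.span_eigenspaces_subset, rule T.span_eigenspaces_subset)
  have formP: "(\<mu> + c) * (l2_norm A w p)\<^sup>2 \<le> Re (l2_inner A w (S p) p)" if "p \<in> P" for p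
  proof -
    have "0 \<le> 1 * (r - (\<mu> + c))" if "r \<in> Rp" for r using c(2)[of r] that by (auto simp: Rp_def F_def)
    from S.form_on_span[OF fin(1) this] that show ?thesis by (simp add: P_def)
  qed
  have formN: "Re (l2_inner A' w (T n) n) \<le> (\<mu> - c) * (l2_norm A' w n)\<^sup>2" if "n \<in> N" for n
  proof -
    have "0 \<le> (-1) * (r - (\<mu> - c))" if "r \<in> Rn" for r using c(2)[of r] that by (auto simp: Rn_def F_def)
    from T.form_on_span[OF fin(2) this] that show ?thesis by (simp add: N_def)
  qed
  define Vp where "Vp = (\<Union>r\<in>Rp. S.eigenbasis r)"
  define Vn where "Vn = (\<Union>r\<in>Rn. T.eigenbasis r)"
  have spans: "fun_vs.span Vp = P" "fun_vs.span Vn = N"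
    by (simp_all add: Vp_def Vn_def P_def N_def S.span_eigenbases T.span_eigenbases)
  have trivial: "fun_vs.span Vp \<inter> fun_vs.span Vn \<subseteq> {0}"
  proof
    fix f assume "f \<in> fun_vs.span Vp \<inter> fun_vs.span Vn"
    then have f: "f \<in> P" "f \<in> N" by (simp_all add: spans)
    have "(\<mu> + c) * (l2_norm A w f)\<^sup>2 \<le> (\<mu> - c) * (l2_norm A w f)\<^sup>2"
      using formP[OF f(1)] formN[OF f(2)] le[of f] norm_eq[of f] N f by auto
    then have "2 * c * (l2_norm A w f)\<^sup>2 \<le> 0" by (simp add: algebra_simps)
    then have "l2_norm A w f = 0" using c(1) by (simp add: mult_le_0_iff)
    then show "f \<in> {0}" using S.norm_eq_0[of f] f P by (auto simp: zero_fun_def)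
  qed
  have indep: "fun_vs.independent (Vp \<union> Vn)"
    using S.eigenbases[OF fin(1)] T.eigenbases[OF fin(2)] trivial unfolding Vp_def Vn_def
    by (intro fun_vs.independent_Un_disjoint_spans) auto
  have disj: "Vp \<inter> Vn = {}"
  proof -
    have "0 \<notin> Vp" using S.eigenbases[OF fin(1)] fun_vs.dependent_zero unfolding Vp_def by blast
    then show ?thesis using trivial fun_vs.span_superset[of Vp] fun_vs.span_superset[of Vn] by blast
  qed
  let ?LS = "eigenvalue_list A w S" and ?LT = "eigenvalue_list A' w T"
  define a where "a = length (filter (\<lambda>r. r \<le> \<mu>) ?LS)"
  define b where "b = length (filter (\<lambda>r. r < \<mu>) ?LT)"
  have "a + card Vp = length ?LS"
    using S.eigenbases[OF fin(1)] S.length_filter_eigenvalue_list[of "\<lambda>r. \<not> r \<le> \<mu>"]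
      sum_length_filter_compl[of "\<lambda>r. r \<le> \<mu>" ?LS] by (simp add: a_def Vp_def Rp_def)
  then have card_Vp: "a + card Vp = card A" by (simp add: S.length_eigenvalue_list)
  have card_Vn: "card Vn = b"
    using T.eigenbases[OF fin(2)] T.length_filter_eigenvalue_list[of "\<lambda>r. r < \<mu>"]
    by (simp add: b_def Vn_def Rn_def)
  \<comment> \<open>Otherwise the index \<open>k = b + 1\<close>, list position \<open>b\<close>,
    contradicts \<open>outside\<close>: the lower eigenvalue is at most \<mu> because
    \<open>k \<le> a\<close>, and the upper one is at least \<mu> because only \<open>b\<close>
    entries lie below \<mu>. Beyond the end of the second list, \<rho> takes its place.\<close>
  have "a \<le> b"
  proof (rule ccontr)
    assume "\<not> a \<le> b"
    then have ab: "b < a" by simp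
    have "nth_eigenvalue A w S (Suc b) \<le> \<mu>"
      unfolding nth_eigenvalue_def using ab
      by (auto intro: sorted_nth_le[OF S.sorted_eigenvalue_list] simp: a_def)
    moreover have "\<mu> \<le> nth_eigenvalue A' w T (Suc b)" if "Suc b \<le> card A'"
      unfolding nth_eigenvalue_def using that
      by (auto intro: sorted_nth_ge[OF T.sorted_eigenvalue_list] simp: b_def T.length_eigenvalue_list)
    moreover have "Suc b \<in> {1..card A}" using ab card_Vp by simp
    ultimately show False
      using outside[of "Suc b"] \<open>\<mu> \<le> \<rho>\<close> by (cases "Suc b \<le> card A'") auto
  qed
  have "card (Vp \<union> Vn) = card Vp + card Vn"
    using S.eigenbases[OF fin(1)] T.eigenbases[OF fin(2)] disj
    by (intro card_Un_disjoint) (auto simp: Vp_def Vn_def)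
  then have "card A \<le> card (Vp \<union> Vn)" using card_Vp card_Vn \<open>a \<le> b\<close> by simp
  moreover have "Vp \<union> Vn \<subseteq> l2 A w"
    using spans fun_vs.span_superset[of Vp] fun_vs.span_superset[of Vn] P N l2_sub by blast
  ultimately have "l2 A w \<subseteq> fun_vs.span (Vp \<union> Vn)"
    using S.independent_card_spanning[OF S.finite_carrier indep] by blast
  then have "l2 A w \<subseteq> {\<lambda>x. p x + n x | p n. p \<in> P \<and> n \<in> N}"
    unfolding fun_vs.span_Un spans by (auto simp: plus_fun_def)
  moreover have "{\<lambda>x. p x + n x | p n. p \<in> P \<and> n \<in> N} \<subseteq> l2 A w"
    using P N l2_sub S.l2_add by blast
  ultimately show ?thesis
    using that[of c P N] c(1) P N formP formN unfolding P_def N_def by blast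
qed

section \<open>Laplacians of graphs\<close>

context weighted_graph
begin

sublocale vs: l2_space "verts G" "vwt m"
  by unfold_locales (rule vwt_pos)

sublocale es: l2_space "arcs G" "ewt m"
  by unfold_locales (rule ewt_pos)

lemma graph_deriv_lincomb:
  "graph_deriv G (\<lambda>x. a * f x + b * g x) = (\<lambda>x. a * graph_deriv G f x + b * graph_deriv G g x)"
  by (auto simp: graph_deriv_def algebra_simps)

lemma deriv_operatorI:
  assumes "0 < M"
    and "\<And>f. f \<in> l2 (verts G) (vwt m) \<Longrightarrow>
      graph_deriv G f \<in> l2 (arcs G) (ewt m) \<and>
      (l2_norm (arcs G) (ewt m) (graph_deriv G f))\<^sup>2 \<le> M * (l2_norm (verts G) (vwt m) f)\<^sup>2"
  shows "l2_operator (verts G) (vwt m) (arcs G) (ewt m) (graph_deriv G) M"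
  by unfold_locales (use assms graph_deriv_lincomb in auto)

text \<open>Any constant will do, since it only has to guarantee that adjoints exist: each value of
  \<open>f\<close> is bounded by the whole norm. The \<open>1 +\<close> keeps the constant positive
  for an edgeless graph.\<close>

lemma deriv_operator_finite:
  assumes "finite (verts G)" "finite (arcs G)"
  shows "\<exists>M. l2_operator (verts G) (vwt m) (arcs G) (ewt m) (graph_deriv G) M"
proof (intro exI deriv_operatorI conjI)
  let ?c = "\<lambda>e. 2 * ewt m e * (1 / vwt m (head G e) + 1 / vwt m (tail G e))"
  have c: "0 \<le> ?c e" if "e \<in> arcs G" for e
    using that ewt_pos vwt_pos by (simp add: less_imp_le)
  then have "0 \<le> (\<Sum>e\<in>arcs G. ?c e)" by (rule sum_nonneg)
  then show "0 < 1 + (\<Sum>e\<in>arcs G. ?c e)" by linarith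
  fix f assume f: "f \<in> l2 (verts G) (vwt m)"
  show "graph_deriv G f \<in> l2 (arcs G) (ewt m)"
    using assms by (simp add: es.l2_finite graph_deriv_def)
  let ?n = "(l2_norm (verts G) (vwt m) f)\<^sup>2"
  have point: "(cmod (f v))\<^sup>2 \<le> 1 / vwt m v * ?n" if "v \<in> verts G" for v
    using vs.norm_point_le[OF f that] vwt_pos[OF that] by (simp add: field_simps)
  have "(cmod (graph_deriv G f e))\<^sup>2 * ewt m e \<le> ?c e * ?n" if e: "e \<in> arcs G" for e
  proof -
    have "(cmod (f (head G e) - f (tail G e)))\<^sup>2
        \<le> 2 * (cmod (f (head G e)))\<^sup>2 + 2 * (cmod (f (tail G e)))\<^sup>2"
      by (rule norm_diff_sq_le)
    also have "\<dots> \<le> 2 * (1 / vwt m (head G e) * ?n) + 2 * (1 / vwt m (tail G e) * ?n)"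
      using point e by (intro add_mono mult_left_mono) auto
    finally have "(cmod (f (head G e) - f (tail G e)))\<^sup>2 * ewt m e
        \<le> (2 * (1 / vwt m (head G e) * ?n) + 2 * (1 / vwt m (tail G e) * ?n)) * ewt m e"
      using ewt_pos[OF e] by (intro mult_right_mono) auto
    also have "\<dots> = ?c e * ?n" by (simp add: algebra_simps)
    finally show ?thesis using e by (simp add: graph_deriv_def)
  qed
  then have "(l2_norm (arcs G) (ewt m) (graph_deriv G f))\<^sup>2 \<le> (\<Sum>e\<in>arcs G. ?c e * ?n)"
    unfolding es.norm_sq infsum_finite[OF assms(2)] by (rule sum_mono)
  also have "\<dots> = (\<Sum>e\<in>arcs G. ?c e) * ?n" by (simp only: sum_distrib_right)
  also have "\<dots> \<le> (1 + (\<Sum>e\<in>arcs G. ?c e)) * ?n" by (intro mult_right_mono) auto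
  finally show "(l2_norm (arcs G) (ewt m) (graph_deriv G f))\<^sup>2 \<le> (1 + (\<Sum>e\<in>arcs G. ?c e)) * ?n" .
qed

lemma laplacian_form:
  assumes "l2_operator (verts G) (vwt m) (arcs G) (ewt m) (graph_deriv G) M"
    and "f \<in> l2 (verts G) (vwt m)"
  shows "Re (l2_inner (verts G) (vwt m) (laplacian G m f) f)
    = (l2_norm (arcs G) (ewt m) (graph_deriv G f))\<^sup>2"
proof -
  interpret l2_operator "verts G" "vwt m" "arcs G" "ewt m" "graph_deriv G" M by fact
  show ?thesis
    using inner_gram_left[OF assms(2,2)] by (simp add: laplacian_def es.norm_sq_inner)
qed

lemma symmetric_laplacian:
  assumes "finite (verts G)" "finite (arcs G)"
  shows "symmetric_operator (verts G) (vwt m) (laplacian G m)"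
proof -
  obtain M where "l2_operator (verts G) (vwt m) (arcs G) (ewt m) (graph_deriv G) M"
    using deriv_operator_finite[OF assms] by blast
  then interpret d: l2_operator "verts G" "vwt m" "arcs G" "ewt m" "graph_deriv G" M .
  interpret g: l2_operator "verts G" "vwt m" "verts G" "vwt m" "\<lambda>f. d.gram f" "M\<^sup>2"
    by (rule d.gram_operator)
  show ?thesis
    unfolding laplacian_def
    by unfold_locales (auto simp: assms g.maps g.lincomb d.inner_gram_left d.inner_gram_right)
qed

end

text \<open>Functions in \<open>l2 A' w\<close> vanish off \<open>A'\<close>, so an inner product
  with one of them does not see the cut-off, and symmetry and the form are inherited.\<close>

lemma (in symmetric_operator) compression:
  assumes sub: "A' \<subseteq> A"
    and S: "\<And>f. f \<in> l2 A' w \<Longrightarrow> S f = (\<lambda>x. if x \<in> A' then T f x else 0)"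
  shows "symmetric_operator A' w S"
    and "f \<in> l2 A' w \<Longrightarrow> l2_inner A' w (S f) f = l2_inner A w (T f) f"
proof -
  interpret A': l2_space A' w using weight_pos sub by unfold_locales auto
  have fin: "finite A'" using sub finite_carrier by (rule finite_subset)
  have l2_sub: "f \<in> l2 A' w \<Longrightarrow> f \<in> l2 A w" for f
    using sub by (auto simp: A'.l2_finite[OF fin] l2_finite[OF finite_carrier])
  have left: "l2_inner A' w (S f) g = l2_inner A w (T f) g"
    if "f \<in> l2 A' w" "g \<in> l2 A' w" for f g
    unfolding l2_inner_def S[OF that(1)] using sub that A'.l2_outside
    by (intro infsum_cong_neutral) auto
  have right: "l2_inner A' w f (S g) = l2_inner A w f (T g)"
    if "f \<in> l2 A' w" "g \<in> l2 A' w" for f g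
    unfolding l2_inner_def S[OF that(2)] using sub that A'.l2_outside
    by (intro infsum_cong_neutral) auto
  show "symmetric_operator A' w S"
  proof
    fix f g :: "'a \<Rightarrow> complex" and a b assume fg: "f \<in> l2 A' w" "g \<in> l2 A' w"
    then have "(\<lambda>x. a * f x + b * g x) \<in> l2 A' w" by auto
    then show "S (\<lambda>x. a * f x + b * g x) = (\<lambda>x. a * S f x + b * S g x)"
      using fg by (simp add: S lincomb l2_sub fun_eq_iff)
    show "l2_inner A' w (S f) g = l2_inner A' w f (S g)"
      using fg by (simp add: left right symmetric l2_sub)
  qed (auto simp: fin A'.l2_finite S)
  show "f \<in> l2 A' w \<Longrightarrow> l2_inner A' w (S f) f = l2_inner A w (T f) f" by (rule left)
qed

text \<open>The adjoint of extension by zero is restriction. Only the vertex set of \<open>K\<close>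
  matters, as a vertex-virtualised graph may keep edges with an end outside it.\<close>

lemma (in weighted_graph) compressed_laplacian_eq:
  assumes fin: "finite (verts G)" "finite (arcs G)" and sub: "verts K \<subseteq> verts G"
    and f: "f \<in> l2 (verts K) (vwt m)"
  shows "compressed_laplacian K G m f = (\<lambda>x. if x \<in> verts K then laplacian G m f x else 0)"
proof -
  interpret L: symmetric_operator "verts G" "vwt m" "laplacian G m"
    by (rule symmetric_laplacian[OF fin])
  interpret K: l2_space "verts K" "vwt m" using vwt_pos sub by unfold_locales auto
  have finK: "finite (verts K)" using sub fin(1) by (rule finite_subset)
  have ext: "extend_by_zero (verts K) g = g" if "g \<in> l2 (verts K) (vwt m)" for g
    using that K.l2_outside by (auto simp: extend_by_zero_def)
  show ?thesis
    unfolding compressed_laplacian_def ext[OF f]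
  proof (rule l2_adjoint_eqI[OF K.weight_pos])
    show "(\<lambda>x. if x \<in> verts K then laplacian G m f x else 0) \<in> l2 (verts K) (vwt m)"
      using finK by (simp add: K.l2_finite)
    fix g assume g: "g \<in> l2 (verts K) (vwt m)"
    show "l2_inner (verts G) (vwt m) (extend_by_zero (verts K) g) (laplacian G m f)
        = l2_inner (verts K) (vwt m) g (\<lambda>x. if x \<in> verts K then laplacian G m f x else 0)"
      unfolding ext[OF g] l2_inner_def using sub g K.l2_outside
      by (intro infsum_cong_neutral) auto
  qed
qed

section \<open>Free actions and periodic graphs\<close>

locale free_action = group_action +
  assumes free: "g \<in> carrier G \<Longrightarrow> x \<in> E \<Longrightarrow> \<phi> g x = x \<Longrightarrow> g = \<one>"
    and finite_orbits: "finite (orbits G E \<phi>)"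
begin

lemma group: "group G"
  using group_hom by (simp add: group_hom_def)

lemma closed: "g \<in> carrier G \<Longrightarrow> x \<in> E \<Longrightarrow> \<phi> g x \<in> E"
  using element_image by blast

lemma orbit_image:
  assumes "g \<in> carrier G" "x \<in> E"
  shows "orbit G \<phi> (\<phi> g x) = orbit G \<phi> x"
proof -
  interpret group G by (rule group)
  have sub: "orbit G \<phi> (\<phi> h y) \<subseteq> orbit G \<phi> y" if "h \<in> carrier G" "y \<in> E" for h y
  proof
    fix z assume "z \<in> orbit G \<phi> (\<phi> h y)"
    then obtain k where k: "k \<in> carrier G" "z = \<phi> k (\<phi> h y)" by (auto simp: orbit_def)
    then have "z = \<phi> (k \<otimes> h) y" using that by (simp add: composition_rule)
    then show "z \<in> orbit G \<phi> y" using k(1) that(1) by (auto simp: orbit_def)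
  qed
  have "orbit G \<phi> (\<phi> (inv g) (\<phi> g x)) \<subseteq> orbit G \<phi> (\<phi> g x)"
    using assms by (intro sub closed) auto
  then show ?thesis using sub[OF assms] orbit_sym_aux[OF assms refl] by simp
qed

lemma orbit_eq:
  assumes "x \<in> E" "y \<in> orbit G \<phi> x"
  shows "orbit G \<phi> y = orbit G \<phi> x"
proof -
  obtain g where "g \<in> carrier G" "y = \<phi> g x" using assms(2) by (auto simp: orbit_def)
  then show ?thesis using orbit_image assms(1) by simp
qed

lemma orbit_subset: "x \<in> E \<Longrightarrow> orbit G \<phi> x \<subseteq> E"
  unfolding orbit_def using closed by auto

lemma orbit_mem_orbits: "x \<in> E \<Longrightarrow> orbit G \<phi> x \<in> orbits G E \<phi>"
  unfolding orbits_def by auto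

lemma orbits_cases:
  assumes "C \<in> orbits G E \<phi>" "x \<in> C"
  shows "x \<in> E" "C = orbit G \<phi> x"
proof -
  obtain y where y: "y \<in> E" "C = orbit G \<phi> y" using assms(1) by (auto simp: orbits_def)
  then show "x \<in> E" "C = orbit G \<phi> x"
    using orbit_subset[OF y(1)] orbit_eq[OF y(1), of x] assms(2) by auto
qed

lemma Union_orbits: "(\<Union>C\<in>orbits G E \<phi>. C) = E"
proof
  show "(\<Union>C\<in>orbits G E \<phi>. C) \<subseteq> E" using orbits_cases(1) by blast
  show "E \<subseteq> (\<Union>C\<in>orbits G E \<phi>. C)" using orbit_refl orbit_mem_orbits by blast
qed

text \<open>Freeness makes each orbit a copy of the group. Sums over the covering thereby become
  finite sums, over the quotient, of sums over the group.\<close>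

lemma bij_orbit:
  assumes x: "x \<in> E"
  shows "bij_betw (\<lambda>g. \<phi> g x) (carrier G) (orbit G \<phi> x)"
proof -
  interpret group G by (rule group)
  have "g = h" if gh: "g \<in> carrier G" "h \<in> carrier G" "\<phi> g x = \<phi> h x" for g h
  proof -
    have "\<phi> (inv h \<otimes> g) x = x"
      using gh x orbit_sym_aux[OF gh(2) x refl] by (simp add: composition_rule)
    then have "inv h \<otimes> g = \<one>" using free[of "inv h \<otimes> g" x] gh x by simp
    then show "g = h" using gh by (metis inv_closed inv_inv inv_equality)
  qed
  then show ?thesis by (auto simp: bij_betw_def inj_on_def orbit_def)
qed

lemma has_sum_orbit:
  assumes "x \<in> E"
  shows "((\<lambda>g. h (\<phi> g x)) has_sum s) (carrier G) \<longleftrightarrow> (h has_sum s) (orbit G \<phi> x)"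
  by (rule has_sum_reindex_bij_betw[OF bij_orbit[OF assms]])

text \<open>Both sums run over the same orbit, so the base point can be exchanged; this moves the
  end of an edge to the chosen vertex of its orbit.\<close>

lemma has_sum_orbit_cong:
  assumes "x \<in> E" "y \<in> E" "orbit G \<phi> x = orbit G \<phi> y"
  shows "((\<lambda>g. h (\<phi> g x)) has_sum s) (carrier G) \<longleftrightarrow> ((\<lambda>g. h (\<phi> g y)) has_sum s) (carrier G)"
  using assms by (simp add: has_sum_orbit)

lemma summable_orbit:
  fixes h :: "_ \<Rightarrow> real"
  assumes "h summable_on E" "x \<in> E"
  shows "(\<lambda>g. h (\<phi> g x)) summable_on carrier G"
proof -
  have "h summable_on orbit G \<phi> x"
    using assms(1) orbit_subset[OF assms(2)] by (rule summable_on_subset_banach)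
  then show ?thesis
    using has_sum_orbit[OF assms(2), of h] by (auto simp: summable_on_def)
qed

lemma has_sum_orbits:
  fixes h :: "_ \<Rightarrow> real"
  assumes r: "\<And>C. C \<in> orbits G E \<phi> \<Longrightarrow> r C \<in> C"
    and s: "\<And>C. C \<in> orbits G E \<phi> \<Longrightarrow> ((\<lambda>g. h (\<phi> g (r C))) has_sum s C) (carrier G)"
  shows "(h has_sum (\<Sum>C\<in>orbits G E \<phi>. s C)) E"
proof -
  have hs: "(h has_sum s C) C" if C: "C \<in> orbits G E \<phi>" for C
    using s[OF C] has_sum_orbit[of "r C" h "s C"] orbits_cases[OF C r[OF C]] by simp
  have "(h has_sum (\<Sum>C\<in>orbits G E \<phi>. s C)) (\<Union>C\<in>orbits G E \<phi>. C)"
  proof (rule sum_has_sum[OF finite_orbits hs])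
    fix C D assume "C \<in> orbits G E \<phi>" "D \<in> orbits G E \<phi>" "C \<noteq> D"
    then show "C \<inter> D = {}" using orbits_cases(2)[of C] orbits_cases(2)[of D] by blast
  qed
  then show ?thesis by (simp only: Union_orbits)
qed

end

lemma has_sum_sum:
  fixes f :: "'i \<Rightarrow> 'a \<Rightarrow> 'b::topological_comm_monoid_add"
  assumes "\<And>i. i \<in> I \<Longrightarrow> (f i has_sum s i) X"
  shows "((\<lambda>x. \<Sum>i\<in>I. f i x) has_sum (\<Sum>i\<in>I. s i)) X"
  using assms by (induction I rule: infinite_finite_induct) (auto intro!: has_sum_add)

section \<open>Orbit sums and the derivative on the covering graph\<close>

context periodic_weighted_graph
begin

sublocale va: free_action \<Gamma> "verts G" \<phi>
  by unfold_locales (use free_verts finite_vert_orbits in auto)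

sublocale ea: free_action \<Gamma> "arcs G" \<psi>
  by unfold_locales (use free_arcs finite_arc_orbits in auto)

abbreviation "Q \<equiv> quotient_graph \<Gamma> \<phi> \<psi> G"
abbreviation "mq \<equiv> quotient_weight m"
abbreviation "vorbit v \<equiv> Group_Action.orbit \<Gamma> \<phi> v"
abbreviation "eorbit e \<equiv> Group_Action.orbit \<Gamma> \<psi> e"

sublocale q: weighted_graph Q mq
  by (rule weighted_graph_quotient)

lemma verts_Q: "verts Q = orbits \<Gamma> (verts G) \<phi>" and arcs_Q: "arcs Q = orbits \<Gamma> (arcs G) \<psi>"
  by (simp_all add: quotient_graph_def)

lemma finite_Q: "finite (verts Q)" "finite (arcs Q)"
  by (simp_all add: verts_Q arcs_Q finite_vert_orbits finite_arc_orbits)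

lemma arc_orbit:
  assumes "c \<in> arcs Q" "e \<in> c"
  shows "e \<in> arcs G" "tail Q c = vorbit (tail G e)" "head Q c = vorbit (head G e)"
    "ewt mq c = ewt m e"
proof -
  show e: "e \<in> arcs G" using assms ea.orbits_cases(1) by (simp add: arcs_Q)
  have c: "c = eorbit e" using assms ea.orbits_cases(2) by (simp add: arcs_Q)
  show "tail Q c = vorbit (tail G e)" "head Q c = vorbit (head G e)" "ewt mq c = ewt m e"
    unfolding c by (simp_all add: quotient_graph_def tail_orbit head_orbit ewt_quotient e)
qed

lemma vert_orbit:
  assumes "C \<in> verts Q" "v \<in> C"
  shows "v \<in> verts G" "C = vorbit v" "vwt mq C = vwt m v"
proof -
  show v: "v \<in> verts G" using assms va.orbits_cases(1) by (simp add: verts_Q)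
  show c: "C = vorbit v" using assms va.orbits_cases(2) by (simp add: verts_Q)
  show "vwt mq C = vwt m v" unfolding c by (simp add: vwt_quotient v)
qed

lemma summable_vert_orbit:
  assumes "F \<in> l2 (verts G) (vwt m)" "v \<in> verts G"
  shows "(\<lambda>g. (cmod (F (\<phi> g v)))\<^sup>2) summable_on carrier \<Gamma>"
proof -
  have "(\<lambda>g. (cmod (F (\<phi> g v)))\<^sup>2 * vwt m (\<phi> g v)) summable_on carrier \<Gamma>"
    using va.summable_orbit[OF vs.l2_summable[OF assms(1)] assms(2)] .
  then have "(\<lambda>g. (cmod (F (\<phi> g v)))\<^sup>2 * vwt m v) summable_on carrier \<Gamma>"
    using assms(2) by (simp add: vwt_invariant cong: summable_on_cong)
  then have "(\<lambda>g. (cmod (F (\<phi> g v)))\<^sup>2 * vwt m v * (1 / vwt m v)) summable_on carrier \<Gamma>"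
    by (rule summable_on_cmult_left)
  then show ?thesis using vwt_pos[OF assms(2)] by simp
qed

lemma l2_vertsI:
  assumes out: "\<And>x. x \<notin> verts G \<Longrightarrow> F x = 0"
    and r: "\<And>C. C \<in> verts Q \<Longrightarrow> r C \<in> C"
    and summable: "\<And>C. C \<in> verts Q \<Longrightarrow> (\<lambda>g. (cmod (F (\<phi> g (r C))))\<^sup>2) summable_on carrier \<Gamma>"
  shows "F \<in> l2 (verts G) (vwt m)"
    and "((\<lambda>g. \<Sum>C\<in>verts Q. (cmod (F (\<phi> g (r C))))\<^sup>2 * vwt mq C) has_sum
      (l2_norm (verts G) (vwt m) F)\<^sup>2) (carrier \<Gamma>)"
proof -
  let ?s = "\<lambda>C. (\<Sum>\<^sub>\<infinity>g\<in>carrier \<Gamma>. (cmod (F (\<phi> g (r C))))\<^sup>2) * vwt mq C"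
  have s: "((\<lambda>g. (cmod (F (\<phi> g (r C))))\<^sup>2 * vwt mq C) has_sum ?s C) (carrier \<Gamma>)"
    if "C \<in> verts Q" for C
    by (intro has_sum_cmult_left has_sum_infsum summable that)
  have "((\<lambda>g. (cmod (F (\<phi> g (r C))))\<^sup>2 * vwt m (\<phi> g (r C))) has_sum ?s C) (carrier \<Gamma>)"
    if C: "C \<in> verts Q" for C
    using s[OF C] vert_orbit[OF C r[OF C]] by (simp add: vwt_invariant cong: has_sum_cong)
  then have sum: "((\<lambda>x. (cmod (F x))\<^sup>2 * vwt m x) has_sum (\<Sum>C\<in>verts Q. ?s C)) (verts G)"
    unfolding verts_Q by (intro va.has_sum_orbits[where r = r] r) (auto simp: verts_Q)
  then show "F \<in> l2 (verts G) (vwt m)"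
    using out by (auto simp: l2_def dest: has_sum_imp_summable)
  have "(l2_norm (verts G) (vwt m) F)\<^sup>2 = (\<Sum>C\<in>verts Q. ?s C)"
    unfolding vs.norm_sq using sum by (rule infsumI)
  then show "((\<lambda>g. \<Sum>C\<in>verts Q. (cmod (F (\<phi> g (r C))))\<^sup>2 * vwt mq C) has_sum
      (l2_norm (verts G) (vwt m) F)\<^sup>2) (carrier \<Gamma>)"
    using has_sum_sum[of "verts Q", OF s] by simp
qed

text \<open>By equivariance the ends of a translated edge are the translates of its ends. The
  representatives \<open>e\<close> are arbitrary, which leaves room to choose them well in the
  fibrewise estimates.\<close>

lemma deriv_orbits:
  assumes F: "F \<in> l2 (verts G) (vwt m)" and e: "\<And>c. c \<in> arcs Q \<Longrightarrow> e c \<in> c"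
    and s: "\<And>c. c \<in> arcs Q \<Longrightarrow>
      ((\<lambda>g. (cmod (F (\<phi> g (head G (e c))) - F (\<phi> g (tail G (e c)))))\<^sup>2) has_sum s c) (carrier \<Gamma>)"
  shows "graph_deriv G F \<in> l2 (arcs G) (ewt m)"
    and "(l2_norm (arcs G) (ewt m) (graph_deriv G F))\<^sup>2 = (\<Sum>c\<in>arcs Q. s c * ewt mq c)"
proof -
  have "((\<lambda>g. (cmod (graph_deriv G F (\<psi> g (e c))))\<^sup>2 * ewt m (\<psi> g (e c))) has_sum s c * ewt mq c)
      (carrier \<Gamma>)" if c: "c \<in> arcs Q" for c
    using has_sum_cmult_left[OF s[OF c], of "ewt mq c"] arc_orbit[OF c e[OF c]]
    by (simp add: graph_deriv_def ea.closed ewt_invariant head_equivariant tail_equivariant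
        cong: has_sum_cong)
  then have sum: "((\<lambda>x. (cmod (graph_deriv G F x))\<^sup>2 * ewt m x) has_sum
      (\<Sum>c\<in>arcs Q. s c * ewt mq c)) (arcs G)"
    unfolding arcs_Q by (intro ea.has_sum_orbits[where r = e] e) (auto simp: arcs_Q)
  then show "graph_deriv G F \<in> l2 (arcs G) (ewt m)"
    by (auto simp: l2_def graph_deriv_def dest: has_sum_imp_summable)
  show "(l2_norm (arcs G) (ewt m) (graph_deriv G F))\<^sup>2 = (\<Sum>c\<in>arcs Q. s c * ewt mq c)"
    unfolding es.norm_sq using sum by (rule infsumI)
qed

lemma summable_deriv_orbit:
  assumes F: "F \<in> l2 (verts G) (vwt m)" and "x \<in> verts G" "y \<in> verts G"
  shows "(\<lambda>g. (cmod (F (\<phi> g x) - F (\<phi> g y)))\<^sup>2) summable_on carrier \<Gamma>"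
proof (rule summable_on_comparison_test)
  show "(\<lambda>g. 2 * (cmod (F (\<phi> g x)))\<^sup>2 + 2 * (cmod (F (\<phi> g y)))\<^sup>2) summable_on carrier \<Gamma>"
    by (intro summable_on_add summable_on_cmult_right summable_vert_orbit assms)
qed (auto intro: norm_diff_sq_le)

lemma rel_weight_le_sup:
  assumes "C \<in> verts Q"
  shows "(\<Sum>c\<in>{c \<in> arcs Q. tail Q c = C}. ewt mq c) + (\<Sum>c\<in>{c \<in> arcs Q. head Q c = C}. ewt mq c)
    \<le> rel_weight_sup Q mq * vwt mq C"
proof -
  have "rel_weight Q mq C \<le> rel_weight_sup Q mq"
    unfolding rel_weight_sup_def using finite_Q assms by (intro cSUP_upper) auto
  then show ?thesis
    using q.vwt_pos[OF assms] finite_Q by (simp add: rel_weight_def divide_le_eq)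
qed

text \<open>\<open>S\<close> is the unweighted squared mass of \<open>F\<close> on each vertex
  orbit. The factor 2 comes from \<open>norm_diff_sq_le\<close>; regrouping the edges by tail and by
  head then produces the weighted degrees, a loop being counted in both groups, and these are
  bounded by the relative weight.\<close>

lemma deriv_bound:
  assumes F: "F \<in> l2 (verts G) (vwt m)"
  shows "graph_deriv G F \<in> l2 (arcs G) (ewt m) \<and>
    (l2_norm (arcs G) (ewt m) (graph_deriv G F))\<^sup>2
      \<le> 2 * rel_weight_sup Q mq * (l2_norm (verts G) (vwt m) F)\<^sup>2"
proof -
  have "\<exists>e. e \<in> c" if "c \<in> arcs Q" for c
    using that eact.orbit_refl by (auto simp: arcs_Q orbits_def)
  then obtain e where e: "\<And>c. c \<in> arcs Q \<Longrightarrow> e c \<in> c" by metis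
  have "\<exists>v. v \<in> C" if "C \<in> verts Q" for C
    using that vact.orbit_refl by (auto simp: verts_Q orbits_def)
  then obtain r where r: "\<And>C. C \<in> verts Q \<Longrightarrow> r C \<in> C" by metis
  define S where "S C = (\<Sum>\<^sub>\<infinity>g\<in>carrier \<Gamma>. (cmod (F (\<phi> g (r C))))\<^sup>2)" for C
  define s where "s c = (\<Sum>\<^sub>\<infinity>g\<in>carrier \<Gamma>.
    (cmod (F (\<phi> g (head G (e c))) - F (\<phi> g (tail G (e c)))))\<^sup>2)" for c
  have ends: "head G (e c) \<in> verts G" "tail G (e c) \<in> verts G" if "c \<in> arcs Q" for c
    using arc_orbit(1)[OF that e[OF that]] by auto
  have S: "((\<lambda>g. (cmod (F (\<phi> g v)))\<^sup>2) has_sum S (vorbit v)) (carrier \<Gamma>)"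
    if v: "v \<in> verts G" for v
  proof -
    have C: "vorbit v \<in> verts Q" using v by (simp add: verts_Q va.orbit_mem_orbits)
    have "r (vorbit v) \<in> verts G" "vorbit v = vorbit (r (vorbit v))"
      using vert_orbit[OF C r[OF C]] by auto
    moreover have "((\<lambda>g. (cmod (F (\<phi> g (r (vorbit v)))))\<^sup>2) has_sum S (vorbit v)) (carrier \<Gamma>)"
      unfolding S_def by (intro has_sum_infsum summable_vert_orbit[OF F] calculation)
    ultimately show ?thesis
      using va.has_sum_orbit_cong[of v "r (vorbit v)" "\<lambda>x. (cmod (F x))\<^sup>2"] v by simp
  qed
  have s: "((\<lambda>g. (cmod (F (\<phi> g (head G (e c))) - F (\<phi> g (tail G (e c)))))\<^sup>2) has_sum s c)
      (carrier \<Gamma>)" if "c \<in> arcs Q" for c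
    unfolding s_def by (intro has_sum_infsum summable_deriv_orbit[OF F] ends that)
  have s_le: "s c \<le> 2 * S (head Q c) + 2 * S (tail Q c)" if c: "c \<in> arcs Q" for c
  proof (rule has_sum_mono[OF s[OF c]])
    show "((\<lambda>g. 2 * (cmod (F (\<phi> g (head G (e c)))))\<^sup>2 + 2 * (cmod (F (\<phi> g (tail G (e c)))))\<^sup>2)
        has_sum 2 * S (head Q c) + 2 * S (tail Q c)) (carrier \<Gamma>)"
      unfolding arc_orbit(2,3)[OF c e[OF c]]
      by (intro has_sum_add has_sum_cmult_right S ends c)
  qed (rule norm_diff_sq_le)
  have S_nonneg: "0 \<le> S C" for C unfolding S_def by (intro infsum_nonneg) auto
  have group: "(\<Sum>c\<in>arcs Q. S (h c) * ewt mq c)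
      = (\<Sum>C\<in>verts Q. S C * (\<Sum>c\<in>{c \<in> arcs Q. h c = C}. ewt mq c))"
    if "h ` arcs Q \<subseteq> verts Q" for h
  proof -
    have "(\<Sum>C\<in>verts Q. \<Sum>c\<in>{c \<in> arcs Q. h c = C}. S (h c) * ewt mq c)
        = (\<Sum>c\<in>arcs Q. S (h c) * ewt mq c)"
      by (rule sum.group[OF finite_Q(2,1) that])
    then show ?thesis by (simp add: sum_distrib_left)
  qed
  have "(l2_norm (arcs G) (ewt m) (graph_deriv G F))\<^sup>2 = (\<Sum>c\<in>arcs Q. s c * ewt mq c)"
    by (rule deriv_orbits(2)[OF F e s])
  also have "\<dots> \<le> (\<Sum>c\<in>arcs Q. (2 * S (head Q c) + 2 * S (tail Q c)) * ewt mq c)"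
    using s_le q.ewt_pos by (intro sum_mono mult_right_mono) (auto simp: less_imp_le)
  also have "\<dots> = 2 * ((\<Sum>c\<in>arcs Q. S (tail Q c) * ewt mq c) + (\<Sum>c\<in>arcs Q. S (head Q c) * ewt mq c))"
    by (simp add: sum.distrib sum_distrib_left algebra_simps)
  also have "\<dots> = 2 * (\<Sum>C\<in>verts Q. S C * ((\<Sum>c\<in>{c \<in> arcs Q. tail Q c = C}. ewt mq c)
      + (\<Sum>c\<in>{c \<in> arcs Q. head Q c = C}. ewt mq c)))"
    by (subst (1 2) group) (auto simp: sum.distrib distrib_left)
  also have "\<dots> \<le> 2 * (\<Sum>C\<in>verts Q. S C * (rel_weight_sup Q mq * vwt mq C))"
    using rel_weight_le_sup S_nonneg by (intro mult_left_mono sum_mono) auto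
  also have "\<dots> = 2 * rel_weight_sup Q mq * (\<Sum>C\<in>verts Q. S C * vwt mq C)"
    by (simp add: sum_distrib_left mult_ac)
  also have "(\<Sum>C\<in>verts Q. S C * vwt mq C) = (l2_norm (verts G) (vwt m) F)\<^sup>2"
  proof (rule has_sum_unique)
    show "((\<lambda>g. \<Sum>C\<in>verts Q. (cmod (F (\<phi> g (r C))))\<^sup>2 * vwt mq C) has_sum
        (l2_norm (verts G) (vwt m) F)\<^sup>2) (carrier \<Gamma>)"
      using F vs.l2_outside vert_orbit(1)[OF _ r]
      by (intro l2_vertsI(2) r summable_vert_orbit) auto
    show "((\<lambda>g. \<Sum>C\<in>verts Q. (cmod (F (\<phi> g (r C))))\<^sup>2 * vwt mq C) has_sum
        (\<Sum>C\<in>verts Q. S C * vwt mq C)) (carrier \<Gamma>)"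
      using vert_orbit(1)[OF _ r] F unfolding S_def
      by (intro has_sum_sum has_sum_cmult_left has_sum_infsum summable_vert_orbit) auto
  qed
  finally show ?thesis using deriv_orbits(1)[OF F e s] by blast
qed

text \<open>The maximum with 1 secures the positivity that \<open>l2_operator\<close> requires; the
  sharp constant stays in \<open>deriv_bound\<close>.\<close>

lemma deriv_operator:
  "l2_operator (verts G) (vwt m) (arcs G) (ewt m) (graph_deriv G) (max 1 (2 * rel_weight_sup Q mq))"
proof (rule deriv_operatorI)
  fix F assume F: "F \<in> l2 (verts G) (vwt m)"
  have "2 * rel_weight_sup Q mq * (l2_norm (verts G) (vwt m) F)\<^sup>2
      \<le> max 1 (2 * rel_weight_sup Q mq) * (l2_norm (verts G) (vwt m) F)\<^sup>2"
    by (intro mult_right_mono) auto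
  then show "graph_deriv G F \<in> l2 (arcs G) (ewt m) \<and>
      (l2_norm (arcs G) (ewt m) (graph_deriv G F))\<^sup>2
        \<le> max 1 (2 * rel_weight_sup Q mq) * (l2_norm (verts G) (vwt m) F)\<^sup>2"
    using deriv_bound[OF F] by linarith
qed simp

end

section \<open>Fibrewise analysis over the quotient\<close>

locale periodic_section = periodic_weighted_graph \<Gamma> \<phi> \<psi> G m
  for \<Gamma> :: "('g, 'x) monoid_scheme" and \<phi> :: "'g \<Rightarrow> 'v \<Rightarrow> 'v" and \<psi> :: "'g \<Rightarrow> 'e \<Rightarrow> 'e"
    and G :: "('v, 'e) pre_digraph" and m :: "('v, 'e) weight" +
  fixes r :: "'v set \<Rightarrow> 'v"
  assumes r_mem: "C \<in> verts Q \<Longrightarrow> r C \<in> C"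
begin

text \<open>For the section given by a fundamental domain this is the restriction of
  \<open>F\<close> to the translate by \<open>g\<close>, read on the quotient.\<close>

definition fibre :: "('v \<Rightarrow> complex) \<Rightarrow> 'g \<Rightarrow> 'v set \<Rightarrow> complex" where
  "fibre F g C = (if C \<in> verts Q then F (\<phi> g (r C)) else 0)"

text \<open>Glues a family of functions on the quotient back together. For a vertex of the covering
  the group element described is unique because the action is free.\<close>

definition unfibre :: "('g \<Rightarrow> 'v set \<Rightarrow> complex) \<Rightarrow> 'v \<Rightarrow> complex" where
  "unfibre k x = (if x \<in> verts G
    then k (THE g. g \<in> carrier \<Gamma> \<and> \<phi> g (r (vorbit x)) = x) (vorbit x) else 0)"

lemma section_vert: "C \<in> verts Q \<Longrightarrow> r C \<in> verts G" "C \<in> verts Q \<Longrightarrow> vorbit (r C) = C"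
  using vert_orbit r_mem by metis+

lemma vert_coordinates:
  assumes "x \<in> verts G"
  obtains g where "g \<in> carrier \<Gamma>" "x = \<phi> g (r (vorbit x))" "vorbit x \<in> verts Q"
proof -
  have C: "vorbit x \<in> verts Q" using assms by (simp add: verts_Q va.orbit_mem_orbits)
  have "x \<in> vorbit (r (vorbit x))" using section_vert(2)[OF C] vact.orbit_refl[OF assms] by simp
  then show ?thesis using that C by (auto simp: Group_Action.orbit_def)
qed

lemma unfibre_apply:
  assumes g: "g \<in> carrier \<Gamma>" and C: "C \<in> verts Q"
  shows "unfibre k (\<phi> g (r C)) = k g C"
proof -
  let ?x = "\<phi> g (r C)"
  have orb: "vorbit ?x = C" using va.orbit_image[OF g section_vert(1)[OF C]] section_vert(2)[OF C] by simp
  have "(THE h. h \<in> carrier \<Gamma> \<and> \<phi> h (r C) = ?x) = g"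
    using g va.bij_orbit[OF section_vert(1)[OF C]]
    by (intro the_equality) (auto simp: bij_betw_def inj_on_def)
  then show ?thesis
    using va.closed[OF g section_vert(1)[OF C]] by (simp add: unfibre_def orb)
qed

lemma fibre_l2: "fibre F g \<in> l2 (verts Q) (vwt mq)"
  by (simp add: q.vs.l2_finite finite_Q fibre_def)

lemma norm_fibre:
  "(l2_norm (verts Q) (vwt mq) (fibre F g))\<^sup>2 = (\<Sum>C\<in>verts Q. (cmod (F (\<phi> g (r C))))\<^sup>2 * vwt mq C)"
  unfolding q.vs.norm_sq by (simp add: finite_Q fibre_def)

lemma has_sum_norm_fibre:
  assumes F: "F \<in> l2 (verts G) (vwt m)"
  shows "((\<lambda>g. (l2_norm (verts Q) (vwt mq) (fibre F g))\<^sup>2) has_sum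
    (l2_norm (verts G) (vwt m) F)\<^sup>2) (carrier \<Gamma>)"
  unfolding norm_fibre using F vs.l2_outside r_mem
  by (intro l2_vertsI(2) summable_vert_orbit section_vert) auto

text \<open>Splitting each fibre by an arbitrary choice would give no control of the sums over the
  group. Instead the finitely many point masses are split once, and the values of \<open>F\<close>
  serve as coefficients; membership in \<open>P\<close> and \<open>N\<close> follows since these are
  subspaces.\<close>

lemma fibrewise_decomposition:
  assumes F: "F \<in> l2 (verts G) (vwt m)"
    and sub: "fun_vs.subspace P" "fun_vs.subspace N"
    and supp: "P \<subseteq> l2 (verts Q) (vwt mq)" "N \<subseteq> l2 (verts Q) (vwt mq)"
    and sum: "l2 (verts Q) (vwt mq) \<subseteq> {\<lambda>x. p x + n x | p n. p \<in> P \<and> n \<in> N}"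
  obtains p n where "p \<in> l2 (verts G) (vwt m)" "n \<in> l2 (verts G) (vwt m)"
    "F = (\<lambda>x. p x + n x)"
    "\<And>g. g \<in> carrier \<Gamma> \<Longrightarrow> fibre p g \<in> P" "\<And>g. g \<in> carrier \<Gamma> \<Longrightarrow> fibre n g \<in> N"
proof -
  have "\<exists>a. a \<in> P \<and> (\<lambda>x. point_mass d x - a x) \<in> N" if "d \<in> verts Q" for d
  proof -
    have "point_mass d \<in> l2 (verts Q) (vwt mq)"
      using that by (auto simp: q.vs.l2_finite finite_Q point_mass_def)
    then obtain p n where "p \<in> P" "n \<in> N" "point_mass d = (\<lambda>x. p x + n x)" using sum by blast
    then show ?thesis by (intro exI[of _ p]) simp
  qed
  then have "\<forall>d\<in>verts Q. \<exists>a. a \<in> P \<and> (\<lambda>x. point_mass d x - a x) \<in> N" by blast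
  from bchoice[OF this] obtain a
    where a: "\<forall>d\<in>verts Q. a d \<in> P \<and> (\<lambda>x. point_mass d x - a d x) \<in> N" ..
  define b where "b = (\<lambda>d x. point_mass d x - a d x)"
  have ab: "a d \<in> P" "b d \<in> N" if "d \<in> verts Q" for d
    using a that by (simp_all add: b_def)
  define glue where "glue a = unfibre (\<lambda>g C. \<Sum>d\<in>verts Q. F (\<phi> g (r d)) * a d C)"
    for a :: "'v set \<Rightarrow> 'v set \<Rightarrow> complex"
  have glue: "glue a (\<phi> g (r C)) = (\<Sum>d\<in>verts Q. F (\<phi> g (r d)) * a d C)"
    if "g \<in> carrier \<Gamma>" "C \<in> verts Q" for a g C
    using that by (simp add: glue_def unfibre_apply)
  \<comment> \<open>With unit weights on the group, square summability of the glued functions is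
    closure of this space under finite linear combinations.\<close>
  interpret cs: l2_space "carrier \<Gamma>" "\<lambda>_. 1" by unfold_locales simp
  define u where "u d g = (if g \<in> carrier \<Gamma> then F (\<phi> g (r d)) else 0)" for d g
  have u: "u d \<in> l2 (carrier \<Gamma>) (\<lambda>_. 1)" if "d \<in> verts Q" for d
    using summable_vert_orbit[OF F section_vert(1)[OF that]]
    by (simp add: l2_def u_def cong: summable_on_cong)
  have glue_l2: "glue a \<in> l2 (verts G) (vwt m)" for a
  proof (rule l2_vertsI(1)[where r = r])
    fix C assume C: "C \<in> verts Q"
    have "(\<lambda>g. \<Sum>d\<in>verts Q. a d C * u d g) \<in> l2 (carrier \<Gamma>) (\<lambda>_. 1)"
      by (intro cs.l2_sum cs.l2_scale u)
    then have "(\<lambda>g. (cmod (\<Sum>d\<in>verts Q. a d C * u d g))\<^sup>2 * 1) summable_on carrier \<Gamma>"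
      by (rule cs.l2_summable)
    then show "(\<lambda>g. (cmod (glue a (\<phi> g (r C))))\<^sup>2) summable_on carrier \<Gamma>"
      using C by (simp add: glue u_def mult.commute cong: summable_on_cong)
  qed (auto simp: r_mem glue_def unfibre_def)
  have fibre_glue: "fibre (glue a) g \<in> S"
    if "fun_vs.subspace S" "S \<subseteq> l2 (verts Q) (vwt mq)" "\<And>d. d \<in> verts Q \<Longrightarrow> a d \<in> S"
      "g \<in> carrier \<Gamma>" for a S g
  proof -
    have "a d C = 0" if "d \<in> verts Q" "C \<notin> verts Q" for d C
      using that \<open>\<And>d. d \<in> verts Q \<Longrightarrow> a d \<in> S\<close> \<open>S \<subseteq> _\<close> q.vs.l2_outside by blast
    then have "fibre (glue a) g = (\<lambda>C. \<Sum>d\<in>verts Q. F (\<phi> g (r d)) * a d C)"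
      using that(4) by (auto simp: fibre_def glue)
    then show ?thesis using fun_subspace_sum[OF that(1,3)] by simp
  qed
  have "F x = glue a x + glue b x" for x
  proof (cases "x \<in> verts G")
    case False
    then show ?thesis using vs.l2_outside[OF F] by (simp add: glue_def unfibre_def)
  next
    case True
    then obtain g where g: "g \<in> carrier \<Gamma>" "x = \<phi> g (r (vorbit x))" "vorbit x \<in> verts Q"
      by (rule vert_coordinates)
    let ?C = "vorbit x"
    have "glue a (\<phi> g (r ?C)) + glue b (\<phi> g (r ?C))
        = (\<Sum>d\<in>verts Q. F (\<phi> g (r d)) * a d ?C + F (\<phi> g (r d)) * b d ?C)"
      by (simp only: glue[OF g(1,3)] sum.distrib)
    also have "\<dots> = (\<Sum>d\<in>verts Q. F (\<phi> g (r d)) * point_mass d ?C)"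
      by (intro sum.cong refl) (simp add: b_def algebra_simps)
    also have "\<dots> = F (\<phi> g (r ?C))"
      using g(3) finite_Q by (simp add: point_mass_def if_distrib[of "(*) _"] sum.delta cong: if_cong)
    finally show ?thesis using g(2) by simp
  qed
  then have "F = (\<lambda>x. glue a x + glue b x)" by blast
  moreover have "fibre (glue a) g \<in> P" "fibre (glue b) g \<in> N" if "g \<in> carrier \<Gamma>" for g
    using fibre_glue[OF sub(1) supp(1) _ that] fibre_glue[OF sub(2) supp(2) _ that] ab by blast+
  ultimately show ?thesis using that[OF glue_l2 glue_l2] by blast
qed

end

text \<open>Off \<open>E0\<close> the representative edge has both ends in the cell, so its
  translate by \<open>g\<close> involves the fibre at \<open>g\<close> alone. Over \<open>E0\<close>
  the representative is arbitrary and \<open>V0\<close> compensates.\<close>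

locale periodic_cell = periodic_section \<Gamma> \<phi> \<psi> G m r
  for \<Gamma> :: "('g, 'x) monoid_scheme" and \<phi> :: "'g \<Rightarrow> 'v \<Rightarrow> 'v" and \<psi> :: "'g \<Rightarrow> 'e \<Rightarrow> 'e"
    and G :: "('v, 'e) pre_digraph" and m :: "('v, 'e) weight"
    and r :: "'v set \<Rightarrow> 'v" +
  fixes E0 :: "'e set set" and V0 :: "'v set set" and rep :: "'e set \<Rightarrow> 'e"
  assumes rep: "c \<in> arcs Q \<Longrightarrow> rep c \<in> c"
    and rep_ends: "c \<in> arcs Q - E0 \<Longrightarrow> head G (rep c) = r (head Q c) \<and> tail G (rep c) = r (tail Q c)"
    and neighbourhood: "c \<in> E0 \<Longrightarrow> head Q c \<in> V0 \<or> tail Q c \<in> V0"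
begin

lemma rep_facts:
  assumes "c \<in> arcs Q"
  shows "head G (rep c) \<in> verts G" "tail G (rep c) \<in> verts G"
    "head Q c = vorbit (head G (rep c))" "tail Q c = vorbit (tail G (rep c))"
    "head Q c \<in> verts Q" "tail Q c \<in> verts Q"
  using arc_orbit[OF assms rep[OF assms]] q.head_in_verts[OF assms] q.tail_in_verts[OF assms]
  by auto

text \<open>Edges over \<open>E0\<close> contribute nonnegative energy and are discarded; each of
  the others sees a single fibre, so the inequality can be summed over the group.\<close>

lemma deriv_ge_fibrewise:
  assumes F: "F \<in> l2 (verts G) (vwt m)"
    and ge: "\<And>g. g \<in> carrier \<Gamma> \<Longrightarrow> a * (l2_norm (verts Q) (vwt mq) (fibre F g))\<^sup>2
      \<le> (l2_norm (arcs Q - E0) (ewt mq) (graph_deriv (edge_virtualised Q E0) (fibre F g)))\<^sup>2"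
  shows "a * (l2_norm (verts G) (vwt m) F)\<^sup>2 \<le> (l2_norm (arcs G) (ewt m) (graph_deriv G F))\<^sup>2"
proof -
  let ?d = "\<lambda>g c. (cmod (F (\<phi> g (head G (rep c))) - F (\<phi> g (tail G (rep c)))))\<^sup>2"
  define s where "s c = (\<Sum>\<^sub>\<infinity>g\<in>carrier \<Gamma>. ?d g c)" for c
  have s: "((\<lambda>g. ?d g c) has_sum s c) (carrier \<Gamma>)" if "c \<in> arcs Q" for c
    unfolding s_def by (intro has_sum_infsum summable_deriv_orbit[OF F] rep_facts that)
  interpret es': l2_space "arcs Q - E0" "ewt mq"
    by unfold_locales (auto intro: q.ewt_pos)
  have "a * (l2_norm (verts Q) (vwt mq) (fibre F g))\<^sup>2 \<le> (\<Sum>c\<in>arcs Q. ?d g c * ewt mq c)"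
    if g: "g \<in> carrier \<Gamma>" for g
  proof -
    have "(l2_norm (arcs Q - E0) (ewt mq) (graph_deriv (edge_virtualised Q E0) (fibre F g)))\<^sup>2
        = (\<Sum>c\<in>arcs Q - E0. ?d g c * ewt mq c)"
      unfolding es'.norm_sq using finite_Q rep_ends rep_facts(5,6)
      by (simp add: graph_deriv_def edge_virtualised_def fibre_def)
    also have "\<dots> \<le> (\<Sum>c\<in>arcs Q. ?d g c * ewt mq c)"
      using finite_Q q.ewt_pos by (intro sum_mono2) (auto simp: less_imp_le)
    finally show ?thesis using ge[OF g] by linarith
  qed
  moreover have "((\<lambda>g. \<Sum>c\<in>arcs Q. ?d g c * ewt mq c) has_sum (\<Sum>c\<in>arcs Q. s c * ewt mq c))
      (carrier \<Gamma>)"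
    by (intro has_sum_sum has_sum_cmult_left s)
  moreover have "(l2_norm (arcs G) (ewt m) (graph_deriv G F))\<^sup>2 = (\<Sum>c\<in>arcs Q. s c * ewt mq c)"
    by (rule deriv_orbits(2)[OF F rep s])
  ultimately show ?thesis
    by (simp only:) (intro has_sum_mono[OF has_sum_cmult_right[OF has_sum_norm_fibre[OF F]]])
qed

text \<open>
  If \<open>F\<close> vanishes over \<open>V0\<close>, every edge over \<open>E0\<close> has an end where \<open>F\<close> vanishes, so only the sum of
  \<open>\<bar>F\<bar>\<^sup>2\<close> over the orbit of the other end matters, and this can be computed fibrewise.
\<close>

lemma deriv_le_fibrewise:
  assumes F: "F \<in> l2 (verts G) (vwt m)"
    and van: "\<And>g C. g \<in> carrier \<Gamma> \<Longrightarrow> C \<in> V0 \<Longrightarrow> fibre F g C = 0"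
    and le: "\<And>g. g \<in> carrier \<Gamma> \<Longrightarrow> (l2_norm (arcs Q) (ewt mq) (graph_deriv Q (fibre F g)))\<^sup>2
      \<le> b * (l2_norm (verts Q) (vwt mq) (fibre F g))\<^sup>2"
  shows "(l2_norm (arcs G) (ewt m) (graph_deriv G F))\<^sup>2 \<le> b * (l2_norm (verts G) (vwt m) F)\<^sup>2"
proof -
  let ?f = "\<lambda>g c. (cmod (F (\<phi> g (r (head Q c))) - F (\<phi> g (r (tail Q c)))))\<^sup>2"
  let ?d = "\<lambda>g c. (cmod (F (\<phi> g (head G (rep c))) - F (\<phi> g (tail G (rep c)))))\<^sup>2"
  \<comment> \<open>\<open>?f\<close> differentiates inside one fibre, \<open>?d\<close> along the
    actual edge. Over \<open>E0\<close> they differ term by term, but fact \<open>d\<close> shows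
    that their sums over the group agree.\<close>
  define s where "s c = (\<Sum>\<^sub>\<infinity>g\<in>carrier \<Gamma>. ?f g c)" for c
  have s: "((\<lambda>g. ?f g c) has_sum s c) (carrier \<Gamma>)" if "c \<in> arcs Q" for c
    unfolding s_def by (intro has_sum_infsum summable_deriv_orbit[OF F] section_vert rep_facts that)
  \<comment> \<open>The fibres test only the chosen vertices; rewriting a vertex in coordinates
    extends the vanishing to every vertex over \<open>V0\<close>.\<close>
  have zero: "F (\<phi> g v) = 0" if gv: "g \<in> carrier \<Gamma>" "v \<in> verts G" "vorbit v \<in> V0" for g v
  proof -
    obtain h where h: "h \<in> carrier \<Gamma>" "\<phi> g v = \<phi> h (r (vorbit (\<phi> g v)))"
      "vorbit (\<phi> g v) \<in> verts Q"
      using vert_coordinates[OF va.closed[OF gv(1,2)]] by blast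
    then have "F (\<phi> g v) = fibre F h (vorbit (\<phi> g v))" by (simp add: fibre_def)
    also have "\<dots> = 0" using van[OF h(1)] gv(3) va.orbit_image[OF gv(1,2)] by simp
    finally show ?thesis .
  qed
  have d: "((\<lambda>g. ?d g c) has_sum s c) (carrier \<Gamma>)" if c: "c \<in> arcs Q" for c
  proof (cases "c \<in> E0")
    case False
    then show ?thesis using s[OF c] rep_ends c by simp
  next
    case True
    have orb: "vorbit (r (head Q c)) = head Q c" "vorbit (r (tail Q c)) = tail Q c"
      "r (head Q c) \<in> verts G" "r (tail Q c) \<in> verts G"
      using section_vert rep_facts[OF c] by auto
    from neighbourhood[OF True] show ?thesis
    proof
      assume V0: "head Q c \<in> V0"
      have "F (\<phi> g (r (head Q c))) = 0" "F (\<phi> g (head G (rep c))) = 0" if "g \<in> carrier \<Gamma>" for g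
        using zero[OF that] orb rep_facts[OF c] V0 by simp_all
      then have "((\<lambda>g. (cmod (F (\<phi> g (r (tail Q c)))))\<^sup>2) has_sum s c) (carrier \<Gamma>)"
        and *: "((\<lambda>g. ?d g c) has_sum s c) (carrier \<Gamma>)
          \<longleftrightarrow> ((\<lambda>g. (cmod (F (\<phi> g (tail G (rep c)))))\<^sup>2) has_sum s c) (carrier \<Gamma>)"
        using s[OF c] by (simp_all cong: has_sum_cong)
      then show ?thesis
        unfolding * using va.has_sum_orbit_cong[of "r (tail Q c)" "tail G (rep c)" "\<lambda>x. (cmod (F x))\<^sup>2"]
          orb rep_facts[OF c] by simp
    next
      assume V0: "tail Q c \<in> V0"
      have "F (\<phi> g (r (tail Q c))) = 0" "F (\<phi> g (tail G (rep c))) = 0" if "g \<in> carrier \<Gamma>" for g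
        using zero[OF that] orb rep_facts[OF c] V0 by simp_all
      then have "((\<lambda>g. (cmod (F (\<phi> g (r (head Q c)))))\<^sup>2) has_sum s c) (carrier \<Gamma>)"
        and *: "((\<lambda>g. ?d g c) has_sum s c) (carrier \<Gamma>)
          \<longleftrightarrow> ((\<lambda>g. (cmod (F (\<phi> g (head G (rep c)))))\<^sup>2) has_sum s c) (carrier \<Gamma>)"
        using s[OF c] by (simp_all cong: has_sum_cong)
      then show ?thesis
        unfolding * using va.has_sum_orbit_cong[of "r (head Q c)" "head G (rep c)" "\<lambda>x. (cmod (F x))\<^sup>2"]
          orb rep_facts[OF c] by simp
    qed
  qed
  have "(\<Sum>c\<in>arcs Q. ?f g c * ewt mq c) \<le> b * (l2_norm (verts Q) (vwt mq) (fibre F g))\<^sup>2"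
    if g: "g \<in> carrier \<Gamma>" for g
  proof -
    have "(l2_norm (arcs Q) (ewt mq) (graph_deriv Q (fibre F g)))\<^sup>2 = (\<Sum>c\<in>arcs Q. ?f g c * ewt mq c)"
      unfolding q.es.norm_sq using finite_Q rep_facts(5,6)
      by (simp add: graph_deriv_def fibre_def)
    then show ?thesis using le[OF g] by simp
  qed
  moreover have "((\<lambda>g. \<Sum>c\<in>arcs Q. ?f g c * ewt mq c) has_sum (\<Sum>c\<in>arcs Q. s c * ewt mq c))
      (carrier \<Gamma>)"
    by (intro has_sum_sum has_sum_cmult_left s)
  moreover have "(l2_norm (arcs G) (ewt m) (graph_deriv G F))\<^sup>2 = (\<Sum>c\<in>arcs Q. s c * ewt mq c)"
    by (rule deriv_orbits(2)[OF F rep d])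
  ultimately show ?thesis
    by (simp only:) (intro has_sum_mono[OF _ has_sum_cmult_right[OF has_sum_norm_fibre[OF F]]])
qed

end

section \<open>The spectral inclusion\<close>

context periodic_weighted_graph
begin

lemma fundamental_domain_ex1:
  assumes "fundamental_domain \<Gamma> \<phi> \<psi> G DV DE" "C \<in> verts Q"
  shows "\<exists>!v. v \<in> C \<inter> DV"
  using assms by (simp only: fundamental_domain_def verts_Q)

text \<open>
  Translate any edge of the orbit until one end lies in the fundamental domain; as the edge is not
  connecting, the other end then lies there too.
\<close>

lemma inner_representative:
  assumes fd: "fundamental_domain \<Gamma> \<phi> \<psi> G DV DE"
    and c: "c \<in> arcs Q" "c \<notin> eorbit ` connecting_edges G DV"
  shows "\<exists>e\<in>c. tail G e \<in> DV \<and> head G e \<in> DV"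
proof -
  obtain e where e: "e \<in> arcs G" "c = eorbit e" using c(1) by (auto simp: arcs_Q orbits_def)
  have "vorbit (tail G e) \<in> verts Q" using e by (auto simp: verts_Q intro: va.orbit_mem_orbits)
  from ex1_implies_ex[OF fundamental_domain_ex1[OF fd this]]
  obtain v where "v \<in> vorbit (tail G e)" "v \<in> DV" by blast
  then obtain g where g: "g \<in> carrier \<Gamma>" "\<phi> g (tail G e) \<in> DV"
    by (auto simp: Group_Action.orbit_def)
  have "\<psi> g e \<in> arcs G" "\<psi> g e \<in> c" "tail G (\<psi> g e) \<in> DV" "eorbit (\<psi> g e) = c"
    using e g ea.closed ea.orbit_image tail_equivariant by (auto simp: Group_Action.orbit_def)
  moreover from this have "\<psi> g e \<notin> connecting_edges G DV" using c(2) by blast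
  ultimately show ?thesis by (intro bexI[of _ "\<psi> g e"]) (auto simp: connecting_edges_def)
qed

lemma spectrum_laplacian_subset:
  fixes V0
  assumes fd: "fundamental_domain \<Gamma> \<phi> \<psi> G DV DE"
  defines "E0 \<equiv> eorbit ` connecting_edges G DV"
  assumes V0: "V0 \<subseteq> verts Q" "in_neighbourhood Q V0 E0"
  defines "Gm \<equiv> edge_virtualised Q E0" and "Gp \<equiv> vertex_virtualised Q V0"
  assumes z: "z \<in> l2_spectrum (verts G) (vwt m) (laplacian G m)"
  shows "\<exists>\<mu> k. z = complex_of_real \<mu> \<and> k \<in> {1..card (verts Q)} \<and>
    nth_eigenvalue (verts Gm) (vwt mq) (laplacian Gm mq) k \<le> \<mu> \<and>
    \<mu> \<le> (if k \<le> card (verts Q) - card V0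
      then nth_eigenvalue (verts Gp) (vwt mq) (compressed_laplacian Gp Q mq) k
      else 2 * rel_weight_sup Q mq)"
proof (rule ccontr)
  interpret d: l2_operator "verts G" "vwt m" "arcs G" "ewt m" "graph_deriv G"
    "max 1 (2 * rel_weight_sup Q mq)"
    by (rule deriv_operator)
  have spec: "z \<notin> l2_resolvent_set (verts G) (vwt m) (\<lambda>f. d.gram f)"
    using z by (simp add: l2_spectrum_def laplacian_def[abs_def])
  define \<mu> where "\<mu> = Re z"
  have z: "z = complex_of_real \<mu>"
    using d.gram_nonreal_resolvent[of z] spec by (auto simp: \<mu>_def complex_eq_iff)
  \<comment> \<open>A splitting with a gap of any size is now contradictory. It is applied to a
    trivial splitting above \<open>2 * rel_weight_sup Q mq\<close> and to the fibrewise one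
    below.\<close>
  have gap: False if "0 < c" "\<And>F. F \<in> l2 (verts G) (vwt m) \<Longrightarrow>
      \<exists>p\<in>l2 (verts G) (vwt m). \<exists>n\<in>l2 (verts G) (vwt m). F = (\<lambda>x. p x + n x) \<and>
      (\<mu> + c) * (l2_norm (verts G) (vwt m) p)\<^sup>2
        \<le> (l2_norm (arcs G) (ewt m) (graph_deriv G p))\<^sup>2 \<and>
      (l2_norm (arcs G) (ewt m) (graph_deriv G n))\<^sup>2
        \<le> (\<mu> - c) * (l2_norm (verts G) (vwt m) n)\<^sup>2" for c
    using d.gram_gap_resolvent[OF that] spec z by simp
  let ?\<rho> = "2 * rel_weight_sup Q mq"
  \<comment> \<open>This settles the indices above \<open>card (verts Q) - card V0\<close>, where
    the upper end is the default \<open>?\<rho>\<close>. If it failed, \<open>p = 0\<close> and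
    \<open>n = F\<close> would be a splitting with gap \<open>\<mu> - ?\<rho>\<close>.\<close>
  have "\<mu> \<le> ?\<rho>"
  proof (rule ccontr)
    assume "\<not> \<mu> \<le> ?\<rho>"
    then have "0 < \<mu> - ?\<rho>" by simp
    then show False
    proof (rule gap)
      fix F assume F: "F \<in> l2 (verts G) (vwt m)"
      show "\<exists>p\<in>l2 (verts G) (vwt m). \<exists>n\<in>l2 (verts G) (vwt m). F = (\<lambda>x. p x + n x) \<and>
        (\<mu> + (\<mu> - ?\<rho>)) * (l2_norm (verts G) (vwt m) p)\<^sup>2
          \<le> (l2_norm (arcs G) (ewt m) (graph_deriv G p))\<^sup>2 \<and>
        (l2_norm (arcs G) (ewt m) (graph_deriv G n))\<^sup>2
          \<le> (\<mu> - (\<mu> - ?\<rho>)) * (l2_norm (verts G) (vwt m) n)\<^sup>2"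
        using F deriv_bound[OF F] by (intro bexI[of _ "\<lambda>x. 0"] bexI[of _ F] conjI) auto
    qed
  qed
  have "finite V0" using V0(1) finite_Q(1) by (rule finite_subset)
  then have V0': "card (verts Gp) = card (verts Q) - card V0" "verts Gp \<subseteq> verts Q"
    "verts Gm = verts Q" "arcs Gm = arcs Q - E0"
    using V0(1) by (auto simp: Gp_def Gm_def vertex_virtualised_def edge_virtualised_def card_Diff_subset)
  interpret gm: weighted_graph Gm mq
    by unfold_locales
      (auto simp: Gm_def edge_virtualised_def q.head_in_verts q.tail_in_verts q.vwt_pos q.ewt_pos)
  have fin: "finite (verts Gm)" "finite (arcs Gm)" using finite_Q V0' by simp_all
  obtain M where dm: "l2_operator (verts Gm) (vwt mq) (arcs Gm) (ewt mq) (graph_deriv Gm) M"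
    using gm.deriv_operator_finite[OF fin] by blast
  obtain M' where dq: "l2_operator (verts Q) (vwt mq) (arcs Q) (ewt mq) (graph_deriv Q) M'"
    using q.deriv_operator_finite[OF finite_Q] by blast
  interpret L: symmetric_operator "verts Q" "vwt mq" "laplacian Q mq"
    by (rule q.symmetric_laplacian[OF finite_Q])
  have Sm: "symmetric_operator (verts Q) (vwt mq) (laplacian Gm mq)"
    using gm.symmetric_laplacian[OF fin] V0' by simp
  have comp: "compressed_laplacian Gp Q mq f = (\<lambda>x. if x \<in> verts Gp then laplacian Q mq f x else 0)"
    if "f \<in> l2 (verts Gp) (vwt mq)" for f
    by (rule q.compressed_laplacian_eq[OF finite_Q V0'(2) that])
  have Sp: "symmetric_operator (verts Gp) (vwt mq) (compressed_laplacian Gp Q mq)"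
    by (rule L.compression(1)[OF V0'(2) comp])
  interpret p: symmetric_operator "verts Gp" "vwt mq" "compressed_laplacian Gp Q mq" by (rule Sp)
  have l2_sub: "f \<in> l2 (verts Q) (vwt mq)" if "f \<in> l2 (verts Gp) (vwt mq)" for f
    using that V0'(2) p.l2_outside[OF that] by (auto simp: q.vs.l2_finite[OF finite_Q(1)])
  have formp: "Re (l2_inner (verts Gp) (vwt mq) (compressed_laplacian Gp Q mq f) f)
      = (l2_norm (arcs Q) (ewt mq) (graph_deriv Q f))\<^sup>2" if "f \<in> l2 (verts Gp) (vwt mq)" for f
    using L.compression(2)[OF V0'(2) comp that] q.laplacian_form[OF dq l2_sub[OF that]] by simp
  have formm: "Re (l2_inner (verts Q) (vwt mq) (laplacian Gm mq f) f)
      = (l2_norm (arcs Q - E0) (ewt mq) (graph_deriv Gm f))\<^sup>2" if "f \<in> l2 (verts Q) (vwt mq)" for f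
    using gm.laplacian_form[OF dm] that V0' by simp
  \<comment> \<open>This orders the two forms: on functions vanishing on \<open>V0\<close> the
    right-hand side is the form of the compressed Laplacian, by \<open>formp\<close>.\<close>
  have deriv_le: "(l2_norm (arcs Q - E0) (ewt mq) (graph_deriv Gm f))\<^sup>2
      \<le> (l2_norm (arcs Q) (ewt mq) (graph_deriv Q f))\<^sup>2" for f
  proof -
    have "(\<Sum>e\<in>arcs Q - E0. (cmod (graph_deriv Gm f e))\<^sup>2 * ewt mq e)
        = (\<Sum>e\<in>arcs Q - E0. (cmod (graph_deriv Q f e))\<^sup>2 * ewt mq e)"
      by (intro sum.cong refl) (simp add: graph_deriv_def Gm_def edge_virtualised_def)
    also have "\<dots> \<le> (\<Sum>e\<in>arcs Q. (cmod (graph_deriv Q f e))\<^sup>2 * ewt mq e)"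
      using finite_Q q.ewt_pos by (intro sum_mono2) (auto simp: less_imp_le)
    finally show ?thesis
      using gm.es.norm_sq[of "graph_deriv Gm f"] q.es.norm_sq[of "graph_deriv Q f"] finite_Q V0'(4)
      by simp
  qed
  assume none: "\<not> ?thesis"
  obtain c P N where c: "0 < c" and sub: "fun_vs.subspace P" "fun_vs.subspace N"
    and supp: "P \<subseteq> l2 (verts Q) (vwt mq)" "N \<subseteq> l2 (verts Gp) (vwt mq)"
    and sum: "l2 (verts Q) (vwt mq) = {\<lambda>x. p x + n x | p n. p \<in> P \<and> n \<in> N}"
    and P: "\<And>p. p \<in> P \<Longrightarrow> (\<mu> + c) * (l2_norm (verts Q) (vwt mq) p)\<^sup>2
        \<le> Re (l2_inner (verts Q) (vwt mq) (laplacian Gm mq p) p)"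
    and N: "\<And>n. n \<in> N \<Longrightarrow> Re (l2_inner (verts Gp) (vwt mq) (compressed_laplacian Gp Q mq n) n)
        \<le> (\<mu> - c) * (l2_norm (verts Gp) (vwt mq) n)\<^sup>2"
  proof (rule bracketing_decomposition[OF Sm Sp V0'(2) _ \<open>\<mu> \<le> ?\<rho>\<close>])
    show "\<not> (nth_eigenvalue (verts Q) (vwt mq) (laplacian Gm mq) k \<le> \<mu> \<and>
      \<mu> \<le> (if k \<le> card (verts Gp)
        then nth_eigenvalue (verts Gp) (vwt mq) (compressed_laplacian Gp Q mq) k else ?\<rho>))"
      if "k \<in> {1..card (verts Q)}" for k
      using none that z V0' by auto
    show "Re (l2_inner (verts Q) (vwt mq) (laplacian Gm mq f) f)
      \<le> Re (l2_inner (verts Gp) (vwt mq) (compressed_laplacian Gp Q mq f) f)"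
      if "f \<in> l2 (verts Gp) (vwt mq)" for f
      using formp[OF that] formm[OF l2_sub[OF that]] deriv_le[of f] by simp
  qed (rule that)
  define r where "r C = (SOME v. v \<in> C \<inter> DV)" for C
  have r: "r C \<in> C \<inter> DV" if "C \<in> verts Q" for C
    unfolding r_def by (rule someI_ex[OF ex1_implies_ex[OF fundamental_domain_ex1[OF fd that]]])
  \<comment> \<open>By uniqueness in the fundamental domain, an inner edge has its ends exactly at
    the values of the section.\<close>
  have r_unique: "v = r (vorbit v)" if "v \<in> verts G" "v \<in> DV" for v
  proof -
    have C: "vorbit v \<in> verts Q" using that by (simp add: verts_Q va.orbit_mem_orbits)
    have "v \<in> vorbit v \<inter> DV" using vact.orbit_refl[OF that(1)] that(2) by blast
    with fundamental_domain_ex1[OF fd C] show ?thesis using r[OF C] by metis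
  qed
  have "\<exists>e. e \<in> c \<and> (c \<notin> E0 \<longrightarrow> tail G e \<in> DV \<and> head G e \<in> DV)" if "c \<in> arcs Q" for c
  proof (cases "c \<in> E0")
    case True
    then show ?thesis using that eact.orbit_refl by (auto simp: arcs_Q orbits_def)
  next
    case False
    then show ?thesis using inner_representative[OF fd that] by (auto simp: E0_def)
  qed
  then have "\<forall>c\<in>arcs Q. \<exists>e. e \<in> c \<and> (c \<notin> E0 \<longrightarrow> tail G e \<in> DV \<and> head G e \<in> DV)" by blast
  from bchoice[OF this] obtain rep
    where rep: "\<forall>c\<in>arcs Q. rep c \<in> c \<and> (c \<notin> E0 \<longrightarrow> tail G (rep c) \<in> DV \<and> head G (rep c) \<in> DV)" ..
  interpret cell: periodic_cell \<Gamma> \<phi> \<psi> G m r E0 V0 rep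
  proof
    show "r C \<in> C" if "C \<in> verts Q" for C using r[OF that] by blast
    show "rep c \<in> c" if "c \<in> arcs Q" for c using rep that by blast
    show "head G (rep c) = r (head Q c) \<and> tail G (rep c) = r (tail Q c)" if "c \<in> arcs Q - E0" for c
    proof -
      have "rep c \<in> c" "tail G (rep c) \<in> DV" "head G (rep c) \<in> DV" "c \<in> arcs Q"
        using rep that by auto
      then show ?thesis
        using arc_orbit[of c "rep c"] r_unique[of "head G (rep c)"] r_unique[of "tail G (rep c)"]
        by simp
    qed
    show "head Q c \<in> V0 \<or> tail Q c \<in> V0" if "c \<in> E0" for c
      using V0(2) that unfolding in_neighbourhood_def by blast
  qed
  show False
  proof (rule gap[OF c])
    fix F assume F: "F \<in> l2 (verts G) (vwt m)"
    have "N \<subseteq> l2 (verts Q) (vwt mq)" using supp(2) l2_sub by blast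
    from cell.fibrewise_decomposition[OF F sub supp(1) this equalityD1[OF sum]]
    obtain p n where pn: "p \<in> l2 (verts G) (vwt m)" "n \<in> l2 (verts G) (vwt m)"
      "F = (\<lambda>x. p x + n x)" "\<And>g. g \<in> carrier \<Gamma> \<Longrightarrow> cell.fibre p g \<in> P"
      "\<And>g. g \<in> carrier \<Gamma> \<Longrightarrow> cell.fibre n g \<in> N" by blast
    have "(\<mu> + c) * (l2_norm (verts G) (vwt m) p)\<^sup>2
        \<le> (l2_norm (arcs G) (ewt m) (graph_deriv G p))\<^sup>2"
    proof (rule cell.deriv_ge_fibrewise[OF pn(1)])
      fix g assume "g \<in> carrier \<Gamma>"
      then have p: "cell.fibre p g \<in> P" by (rule pn(4))
      show "(\<mu> + c) * (l2_norm (verts Q) (vwt mq) (cell.fibre p g))\<^sup>2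
          \<le> (l2_norm (arcs Q - E0) (ewt mq)
            (graph_deriv (edge_virtualised Q E0) (cell.fibre p g)))\<^sup>2"
        using P[OF p] formm[OF cell.fibre_l2] by (simp add: Gm_def)
    qed
    moreover have "(l2_norm (arcs G) (ewt m) (graph_deriv G n))\<^sup>2
        \<le> (\<mu> - c) * (l2_norm (verts G) (vwt m) n)\<^sup>2"
    proof (rule cell.deriv_le_fibrewise[OF pn(2)])
      fix g assume "g \<in> carrier \<Gamma>"
      then have n: "cell.fibre n g \<in> N" by (rule pn(5))
      then have n': "cell.fibre n g \<in> l2 (verts Gp) (vwt mq)" using supp(2) by blast
      show "cell.fibre n g C = 0" if "C \<in> V0" for C
        using p.l2_outside[OF n'] that by (simp add: Gp_def vertex_virtualised_def)
      \<comment> \<open>The fibre vanishes on \<open>V0\<close>, so removing these vertices does not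
        change its norm.\<close>
      have "l2_norm (verts Gp) (vwt mq) (cell.fibre n g) = l2_norm (verts Q) (vwt mq) (cell.fibre n g)"
        unfolding l2_norm_def using V0'(2) p.l2_outside[OF n']
        by (intro arg_cong[of _ _ sqrt] infsum_cong_neutral) auto
      then show "(l2_norm (arcs Q) (ewt mq) (graph_deriv Q (cell.fibre n g)))\<^sup>2
          \<le> (\<mu> - c) * (l2_norm (verts Q) (vwt mq) (cell.fibre n g))\<^sup>2"
        using N[OF n] formp[OF n'] by simp
    qed
    ultimately show "\<exists>p\<in>l2 (verts G) (vwt m). \<exists>n\<in>l2 (verts G) (vwt m). F = (\<lambda>x. p x + n x) \<and>
        (\<mu> + c) * (l2_norm (verts G) (vwt m) p)\<^sup>2
          \<le> (l2_norm (arcs G) (ewt m) (graph_deriv G p))\<^sup>2 \<and>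
        (l2_norm (arcs G) (ewt m) (graph_deriv G n))\<^sup>2
          \<le> (\<mu> - c) * (l2_norm (verts G) (vwt m) n)\<^sup>2"
      using pn(1-3) by blast
  qed
qed

end

theorem theorem5p10:
  fixes \<Gamma> :: "('g, 'x) monoid_scheme"
    and \<phi> :: "'g \<Rightarrow> 'v \<Rightarrow> 'v" and \<psi> :: "'g \<Rightarrow> 'e \<Rightarrow> 'e"
    and Gt :: "('v, 'e) pre_digraph" and mt :: "('v, 'e) weight"
    and G Gm Gp :: "('v set, 'e set) pre_digraph" and m :: "('v set, 'e set) weight"
    and DV :: "'v set" and DE :: "'e set"
    and E0 :: "'e set set" and V0 :: "'v set set"
    and lam_minus lam_plus :: "nat \<Rightarrow> real"
  assumes "periodic_weighted_graph \<Gamma> \<phi> \<psi> Gt mt"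
    and "fundamental_domain \<Gamma> \<phi> \<psi> Gt DV DE"
  defines "G \<equiv> quotient_graph \<Gamma> \<phi> \<psi> Gt" and "m \<equiv> quotient_weight mt"
  defines "E0 \<equiv> Group_Action.orbit \<Gamma> \<psi> ` connecting_edges Gt DV"
  assumes "V0 \<subseteq> verts G" and "in_neighbourhood G V0 E0"
  defines "Gm \<equiv> edge_virtualised G E0" and "Gp \<equiv> vertex_virtualised G V0"
  defines "lam_minus \<equiv> nth_eigenvalue (verts Gm) (vwt m) (laplacian Gm m)"
    and "lam_plus \<equiv> (\<lambda>k. if k \<le> card (verts G) - card V0
      then nth_eigenvalue (verts Gp) (vwt m) (compressed_laplacian Gp G m) k
      else 2 * rel_weight_sup G m)"
  shows "l2_spectrum (verts Gt) (vwt mt) (laplacian Gt mt)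
      \<subseteq> complex_of_real ` (\<Union>k\<in>{1..card (verts G)}. {lam_minus k..lam_plus k})"
proof
  interpret periodic_weighted_graph \<Gamma> \<phi> \<psi> Gt mt by fact
  fix z assume "z \<in> l2_spectrum (verts Gt) (vwt mt) (laplacian Gt mt)"
  \<comment> \<open>The \<open>defines\<close> clauses count in \<open>assms\<close>: numbers 6 and
    7 are the two conditions on \<open>V0\<close>.\<close>
  from spectrum_laplacian_subset[OF assms(2) _ _ this, of V0] assms(6,7)
  obtain \<mu> k where "z = complex_of_real \<mu>" "k \<in> {1..card (verts G)}" "lam_minus k \<le> \<mu>" "\<mu> \<le> lam_plus k"
    unfolding lam_minus_def lam_plus_def Gm_def Gp_def E0_def G_def m_def by blast
  then have "\<mu> \<in> (\<Union>k\<in>{1..card (verts G)}. {lam_minus k..lam_plus k})" by (intro UN_I) auto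
  with \<open>z = complex_of_real \<mu>\<close>
  show "z \<in> complex_of_real ` (\<Union>k\<in>{1..card (verts G)}. {lam_minus k..lam_plus k})" by blast
qed

end
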